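(* Let $\mathcal G$ be a Lie groupoid, $M$ a smooth manifold, and let $P_1$ and $P_2$ be principal $\mathcal G$-bundles over $M$. Then the set $\mathsf{Mor}_{\mathsf{Bun}_{\mathcal G,M}}(P_1,P_2)$ of bundle morphisms from $P_1$ to $P_2$ is in one-to-one correspondence with the set $C^{\infty}(P_1\odot P_2,\mathcal G)^{\mathcal G^2}$ of generalized gauge transformations between $P_1$ and $P_2$.
   Context: Lie groupoids: a groupoid has a set of arrows $\mathcal G$, a set of objects $X_{\mathcal G}$, surjective source and target maps $s_{\mathcal G},t_{\mathcal G}:\mathcal G\to X_{\mathcal G}$, a unit map $\iota_{\mathcal G}:X_{\mathcal G}\to\mathcal G$, an inversion $g\mapsto g^{-1}$, and an associative product $g_1g_2$ defined iff $s_{\mathcal G}(g_1)=t_{\mathcal G}(g_2)$, with $s_{\mathcal G}(g_1g_2)=s_{\mathcal G}(g_2)$, $t_{\mathcal G}(g_1g_2)=t_{\mathcal G}(g_1)$ and the usual unit and inverse laws. It is a Lie groupoid if $X_{\mathcal G}$ is a smooth Hausdorff manifold, $\mathcal G$ is a smooth manifold (possibly non-Hausdorff, not second countable), $s_{\mathcal G}$ is a surjective submersion with Hausdorff fibres, and all other structure maps are smooth. Right action of $\mathcal G$ on a manifold $P$ with momentum $\varepsilon$: a smooth map $\varepsilon:P\to X_{\mathcal G}$ and a smooth map $(p,g)\mapsto pg$ from $P\times_\varepsilon\mathcal G=\{(p,g)\in P\times\mathcal G: \varepsilon(p)=t_{\mathcal G}(g)\}$ to $P$ with $\varepsilon(pg)=s_{\mathcal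 G}(g)$, $(pg)h=p(gh)$ whenever defined, and $p\,\iota_{\mathcal G}(\varepsilon(p))=p$. Principal $\mathcal G$-bundle $(P,\pi,\varepsilon,M)$ over $M$: smooth manifolds $P$ (possibly non-Hausdorff) and $M$ (Hausdorff), a right $\mathcal G$-action on $P$ with momentum $\varepsilon$, and a surjective submersion $\pi:P\to M$ with $\pi(pg)=\pi(p)$ such that $P\times_\varepsilon\mathcal G\to P\times_MP$, $(p,g)\mapsto(p,pg)$, is a diffeomorphism, where $P\times_M P=\{(p,q):\pi(p)=\pi(q)\}$. For principal $\mathcal G$-bundles $(P_i,\pi_i,\varepsilon_i,M)$, $i=1,2$, put $P_1\odot P_2=\{(p_1,p_2)\in P_1\times P_2:\pi_1(p_1)=\pi_2(p_2)\}$. Bundle morphism from $P_1$ to $P_2$ (morphism in the category $\mathsf{Bun}_{\mathcal G,M}$ of principal $\mathcal G$-bundles over $M$): a smooth map $\sigma:P_1\to P_2$ with $\pi_2\circ\sigma=\pi_1$, $\varepsilon_2\circ\sigma=\varepsilon_1$ and $\sigma(pg)=\sigma(p)g$ for all $(p,g)\in P_1\times_{\varepsilon_1}\mathcal G$. Generalized gauge transformation between $P_1$ and $P_2$: a smooth map $K:P_1\odot P_2\to\mathcal G$ with $s_{\mathcal G}(K(p_1,p_2))=\varepsilon_1(p_1)$, $t_{\mathcal G}(K(p_1,p_2))=\varepsilon_2(p_2)$ for all $(p_1,p_2)\in P_1\odot P_2$, and $K(p_1g_1,p_2g_2)=g_2^{-1}K(p_1,p_2)g_1$ whenever $t_{\mathcal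 G}(g_i)=\varepsilon_i(p_i)$, $i=1,2$. The set of these is $C^{\infty}(P_1\odot P_2,\mathcal G)^{\mathcal G^2}$. *)

theory Defs
  imports "HOL-Analysis.Analysis"
begin

section \<open>Smooth functions between finite-dimensional vector spaces\<close>

text \<open>
  Euclidean \<open>n\<close>-space is represented by an arbitrary \<open>n\<close>-dimensional linear subspace \<open>V\<close> of a
  type of class \<open>euclidean_space\<close>. The types themselves do not suffice: they all have positive
  dimension, which would exclude discrete manifolds.

  In \<open>Ck k V U f\<close> the set \<open>U\<close> is meant to be relatively open in the subspace \<open>V\<close>; the derivative
  \<open>f' x\<close> is then uniquely determined on \<open>V\<close>, and only its values there are used.
\<close>

primrec Ck :: "nat \<Rightarrow> 'a::real_normed_vector set \<Rightarrow> 'a set \<Rightarrow> ('a \<Rightarrow> 'b::real_normed_vector) \<Rightarrow> bool" where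
  "Ck 0 V U f \<longleftrightarrow> continuous_on U f"
| "Ck (Suc k) V U f \<longleftrightarrow>
     (\<exists>f'. (\<forall>x\<in>U. (f has_derivative f' x) (at x within U)) \<and> (\<forall>v\<in>V. Ck k V U (\<lambda>x. f' x v)))"

definition smooth_on :: "'a::real_normed_vector set \<Rightarrow> 'a set \<Rightarrow> ('a \<Rightarrow> 'b::real_normed_vector) \<Rightarrow> bool" where
  "smooth_on V U f \<longleftrightarrow> (\<forall>k. Ck k V U f)"

section \<open>Smooth manifolds\<close>

text \<open>A chart maps the open set \<open>chart_dom\<close> onto a relatively open subset of the vector space
  \<open>chart_model\<close>. The values of \<open>coord\<close> outside \<open>chart_dom\<close> are irrelevant.\<close>

record ('a, 'e) chart =
  chart_dom :: "'a set"
  chart_model :: "'e set"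
  coord :: "'a \<Rightarrow> 'e"

record ('a, 'e) mfd =
  mtop :: "'a topology"
  atlas :: "('a, 'e) chart set"

abbreviation pts :: "('a, 'e, 'z) mfd_scheme \<Rightarrow> 'a set" where
  "pts M \<equiv> topspace (mtop M)"

definition chart_on :: "'a topology \<Rightarrow> ('a, 'e::euclidean_space) chart \<Rightarrow> bool" where
  "chart_on T c \<longleftrightarrow>
     openin T (chart_dom c) \<and> subspace (chart_model c) \<and>
     openin (top_of_set (chart_model c)) (coord c ` chart_dom c) \<and>
     homeomorphic_map (subtopology T (chart_dom c)) (top_of_set (coord c ` chart_dom c)) (coord c)"

definition local_rep ::
  "('a, 'e) chart \<Rightarrow> ('b, 'f) chart \<Rightarrow> ('a \<Rightarrow> 'b) \<Rightarrow> 'e \<Rightarrow> 'f" where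
  "local_rep c d f = coord d \<circ> f \<circ> inv_into (chart_dom c) (coord c)"

definition compatible :: "('a, 'e::euclidean_space) chart \<Rightarrow> ('a, 'e) chart \<Rightarrow> bool" where
  "compatible c d \<longleftrightarrow>
     smooth_on (chart_model c) (coord c ` (chart_dom c \<inter> chart_dom d)) (local_rep c d id) \<and>
     smooth_on (chart_model d) (coord d ` (chart_dom c \<inter> chart_dom d)) (local_rep d c id)"

text \<open>Neither the Hausdorff property nor second countability is part of the notion of a manifold;
  the dimension is constant.\<close>

definition manifold :: "('a, 'e::euclidean_space) mfd \<Rightarrow> bool" where
  "manifold M \<longleftrightarrow>
     (\<forall>c\<in>atlas M. chart_on (mtop M) c) \<and>
     (\<Union>c\<in>atlas M. chart_dom c) = pts M \<and>
     (\<forall>c\<in>atlas M. \<forall>d\<in>atlas M. compatible c d) \<and>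
     (\<exists>n. \<forall>c\<in>atlas M. chart_dom c \<noteq> {} \<longrightarrow> dim (chart_model c) = n)"

text \<open>The maximal atlas generated by \<open>atlas M\<close>.\<close>

definition charts :: "('a, 'e::euclidean_space) mfd \<Rightarrow> ('a, 'e) chart set" where
  "charts M = {c. chart_on (mtop M) c \<and> (\<forall>d\<in>atlas M. compatible c d)}"

definition smooth_map ::
  "('a, 'e::euclidean_space) mfd \<Rightarrow> ('b, 'f::euclidean_space) mfd \<Rightarrow> ('a \<Rightarrow> 'b) \<Rightarrow> bool" where
  "smooth_map M N f \<longleftrightarrow>
     f ` pts M \<subseteq> pts N \<and>
     (\<forall>p\<in>pts M. \<exists>c\<in>charts M. \<exists>d\<in>charts N.
        p \<in> chart_dom c \<and> f ` chart_dom c \<subseteq> chart_dom d \<and>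
        smooth_on (chart_model c) (coord c ` chart_dom c) (local_rep c d f))"

definition diffeomorphism ::
  "('a, 'e::euclidean_space) mfd \<Rightarrow> ('b, 'f::euclidean_space) mfd \<Rightarrow> ('a \<Rightarrow> 'b) \<Rightarrow> bool" where
  "diffeomorphism M N f \<longleftrightarrow>
     bij_betw f (pts M) (pts N) \<and> smooth_map M N f \<and> smooth_map N M (inv_into (pts M) f)"

text \<open>Surjectivity of the differential at \<open>p\<close> is expressed in charts around \<open>p\<close> and \<open>f p\<close>; it does
  not depend on their choice.\<close>

definition submersion ::
  "('a, 'e::euclidean_space) mfd \<Rightarrow> ('b, 'f::euclidean_space) mfd \<Rightarrow> ('a \<Rightarrow> 'b) \<Rightarrow> bool" where
  "submersion M N f \<longleftrightarrow>
     smooth_map M N f \<and>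
     (\<forall>p\<in>pts M. \<exists>c\<in>charts M. \<exists>d\<in>charts N.
        p \<in> chart_dom c \<and> f ` chart_dom c \<subseteq> chart_dom d \<and>
        (\<exists>D. (local_rep c d f has_derivative D) (at (coord c p) within coord c ` chart_dom c) \<and>
             D ` chart_model c = chart_model d))"

definition prod_chart :: "('a, 'e) chart \<Rightarrow> ('b, 'f) chart \<Rightarrow> ('a \<times> 'b, 'e \<times> 'f) chart" where
  "prod_chart c d =
     \<lparr>chart_dom = chart_dom c \<times> chart_dom d, chart_model = chart_model c \<times> chart_model d,
      coord = map_prod (coord c) (coord d)\<rparr>"

definition prod_mfd :: "('a, 'e) mfd \<Rightarrow> ('b, 'f) mfd \<Rightarrow> ('a \<times> 'b, 'e \<times> 'f) mfd" where
  "prod_mfd M N =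
     \<lparr>mtop = prod_topology (mtop M) (mtop N),
      atlas = {prod_chart c d | c d. c \<in> atlas M \<and> d \<in> atlas N}\<rparr>"

text \<open>
  The embedded submanifold structure on a subset \<open>S\<close> of \<open>M\<close>: subspace topology, with the
  restrictions to \<open>S\<close> of the slice charts of \<open>M\<close> as atlas. It is meaningful only if the slice
  charts cover \<open>S\<close>, i.e. if \<open>S\<close> is an embedded submanifold; below it is used only for fibre products
  in which one of the two maps is a submersion.
\<close>

definition submfd :: "('a, 'e::euclidean_space) mfd \<Rightarrow> 'a set \<Rightarrow> ('a, 'e) mfd" where
  "submfd M S =
     \<lparr>mtop = subtopology (mtop M) S,
      atlas = {\<lparr>chart_dom = chart_dom c \<inter> S, chart_model = W, coord = coord c\<rparr> | c W.
                 c \<in> charts M \<and> subspace W \<and> W \<subseteq> chart_model c \<and>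
                 coord c ` (chart_dom c \<inter> S) = coord c ` chart_dom c \<inter> W}\<rparr>"

section \<open>Lie groupoids\<close>

record ('g, 'eg, 'x, 'ex) groupoid =
  arrows :: "('g, 'eg) mfd"
  objects :: "('x, 'ex) mfd"
  src :: "'g \<Rightarrow> 'x"
  tgt :: "'g \<Rightarrow> 'x"
  ident :: "'x \<Rightarrow> 'g"
  ginv :: "'g \<Rightarrow> 'g"
  mult :: "'g \<Rightarrow> 'g \<Rightarrow> 'g"

abbreviation arr :: "('g, 'eg, 'x, 'ex, 'z) groupoid_scheme \<Rightarrow> 'g set" where
  "arr G \<equiv> pts (arrows G)"

abbreviation obj :: "('g, 'eg, 'x, 'ex, 'z) groupoid_scheme \<Rightarrow> 'x set" where
  "obj G \<equiv> pts (objects G)"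

definition is_groupoid :: "('g, 'eg, 'x, 'ex) groupoid \<Rightarrow> bool" where
  "is_groupoid G \<longleftrightarrow>
     src G ` arr G = obj G \<and> tgt G ` arr G = obj G \<and>
     (\<forall>x\<in>obj G. ident G x \<in> arr G \<and> src G (ident G x) = x \<and> tgt G (ident G x) = x) \<and>
     (\<forall>g\<in>arr G. ginv G g \<in> arr G \<and> src G (ginv G g) = tgt G g \<and> tgt G (ginv G g) = src G g) \<and>
     (\<forall>g\<in>arr G. \<forall>h\<in>arr G. src G g = tgt G h \<longrightarrow>
        mult G g h \<in> arr G \<and> src G (mult G g h) = src G h \<and> tgt G (mult G g h) = tgt G g) \<and>
     (\<forall>g\<in>arr G. \<forall>h\<in>arr G. \<forall>k\<in>arr G. src G g = tgt G h \<longrightarrow> src G h = tgt G k \<longrightarrow>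
        mult G (mult G g h) k = mult G g (mult G h k)) \<and>
     (\<forall>g\<in>arr G. mult G g (ident G (src G g)) = g \<and> mult G (ident G (tgt G g)) g = g) \<and>
     (\<forall>g\<in>arr G. mult G g (ginv G g) = ident G (tgt G g) \<and> mult G (ginv G g) g = ident G (src G g))"

definition composable :: "('g, 'eg, 'x, 'ex) groupoid \<Rightarrow> ('g \<times> 'g) set" where
  "composable G = {(g, h). g \<in> arr G \<and> h \<in> arr G \<and> src G g = tgt G h}"

definition lie_groupoid ::
  "('g, 'eg::euclidean_space, 'x, 'ex::euclidean_space) groupoid \<Rightarrow> bool" where
  "lie_groupoid G \<longleftrightarrow>
     is_groupoid G \<and>
     manifold (objects G) \<and> Hausdorff_space (mtop (objects G)) \<and>
     manifold (arrows G) \<and>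
     submersion (arrows G) (objects G) (src G) \<and>
     (\<forall>x\<in>obj G. Hausdorff_space (subtopology (mtop (arrows G)) {g \<in> arr G. src G g = x})) \<and>
     smooth_map (arrows G) (objects G) (tgt G) \<and>
     smooth_map (objects G) (arrows G) (ident G) \<and>
     smooth_map (arrows G) (arrows G) (ginv G) \<and>
     smooth_map (submfd (prod_mfd (arrows G) (arrows G)) (composable G)) (arrows G)
       (\<lambda>(g, h). mult G g h)"

section \<open>Principal bundles\<close>

record ('p, 'ep, 'm, 'x, 'g) pbundle =
  total :: "('p, 'ep) mfd"
  bproj :: "'p \<Rightarrow> 'm"
  moment :: "'p \<Rightarrow> 'x"
  act :: "'p \<Rightarrow> 'g \<Rightarrow> 'p"

definition act_dom ::
  "('g, 'eg, 'x, 'ex) groupoid \<Rightarrow> ('p, 'ep) mfd \<Rightarrow> ('p \<Rightarrow> 'x) \<Rightarrow> ('p \<times> 'g) set" where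
  "act_dom G P \<epsilon> = {(p, g). p \<in> pts P \<and> g \<in> arr G \<and> \<epsilon> p = tgt G g}"

definition act_mfd ::
  "('g, 'eg::euclidean_space, 'x, 'ex) groupoid \<Rightarrow> ('p, 'ep::euclidean_space) mfd \<Rightarrow> ('p \<Rightarrow> 'x) \<Rightarrow>
   ('p \<times> 'g, 'ep \<times> 'eg) mfd" where
  "act_mfd G P \<epsilon> = submfd (prod_mfd P (arrows G)) (act_dom G P \<epsilon>)"

definition right_action ::
  "('g, 'eg::euclidean_space, 'x, 'ex::euclidean_space) groupoid \<Rightarrow>
   ('p, 'ep::euclidean_space) mfd \<Rightarrow> ('p \<Rightarrow> 'x) \<Rightarrow> ('p \<Rightarrow> 'g \<Rightarrow> 'p) \<Rightarrow> bool" where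
  "right_action G P \<epsilon> a \<longleftrightarrow>
     smooth_map P (objects G) \<epsilon> \<and>
     smooth_map (act_mfd G P \<epsilon>) P (\<lambda>(p, g). a p g) \<and>
     (\<forall>(p, g)\<in>act_dom G P \<epsilon>. \<epsilon> (a p g) = src G g) \<and>
     (\<forall>(p, g)\<in>act_dom G P \<epsilon>. \<forall>h\<in>arr G. src G g = tgt G h \<longrightarrow> a (a p g) h = a p (mult G g h)) \<and>
     (\<forall>p\<in>pts P. a p (ident G (\<epsilon> p)) = p)"

definition fib_prod :: "('p, 'ep) mfd \<Rightarrow> ('p \<Rightarrow> 'm) \<Rightarrow> ('q, 'eq) mfd \<Rightarrow> ('q \<Rightarrow> 'm) \<Rightarrow> ('p \<times> 'q) set" where
  "fib_prod P \<pi> Q \<rho> = {(p, q). p \<in> pts P \<and> q \<in> pts Q \<and> \<pi> p = \<rho> q}"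

definition fib_prod_mfd ::
  "('p, 'ep::euclidean_space) mfd \<Rightarrow> ('p \<Rightarrow> 'm) \<Rightarrow> ('q, 'eq::euclidean_space) mfd \<Rightarrow> ('q \<Rightarrow> 'm) \<Rightarrow>
   ('p \<times> 'q, 'ep \<times> 'eq) mfd" where
  "fib_prod_mfd P \<pi> Q \<rho> = submfd (prod_mfd P Q) (fib_prod P \<pi> Q \<rho>)"

definition principal_bundle ::
  "('g, 'eg::euclidean_space, 'x, 'ex::euclidean_space) groupoid \<Rightarrow> ('m, 'em::euclidean_space) mfd \<Rightarrow>
   ('p, 'ep::euclidean_space, 'm, 'x, 'g) pbundle \<Rightarrow> bool" where
  "principal_bundle G M P \<longleftrightarrow>
     manifold (total P) \<and> manifold M \<and> Hausdorff_space (mtop M) \<and>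
     right_action G (total P) (moment P) (act P) \<and>
     submersion (total P) M (bproj P) \<and> bproj P ` pts (total P) = pts M \<and>
     (\<forall>(p, g)\<in>act_dom G (total P) (moment P). bproj P (act P p g) = bproj P p) \<and>
     diffeomorphism (act_mfd G (total P) (moment P))
       (fib_prod_mfd (total P) (bproj P) (total P) (bproj P)) (\<lambda>(p, g). (p, act P p g))"

text \<open>Morphisms and gauge transformations are total functions in HOL; requiring them to be
  \<open>extensional\<close> makes equality of functions agree with equality on the actual domain.\<close>

definition bundle_morphisms ::
  "('g, 'eg::euclidean_space, 'x, 'ex::euclidean_space) groupoid \<Rightarrow>
   ('p, 'ep::euclidean_space, 'm, 'x, 'g) pbundle \<Rightarrow> ('q, 'eq::euclidean_space, 'm, 'x, 'g) pbundle \<Rightarrow>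
   ('p \<Rightarrow> 'q) set" where
  "bundle_morphisms G P Q =
     {\<sigma> \<in> extensional (pts (total P)).
        smooth_map (total P) (total Q) \<sigma> \<and>
        (\<forall>p\<in>pts (total P). bproj Q (\<sigma> p) = bproj P p) \<and>
        (\<forall>p\<in>pts (total P). moment Q (\<sigma> p) = moment P p) \<and>
        (\<forall>(p, g)\<in>act_dom G (total P) (moment P). \<sigma> (act P p g) = act Q (\<sigma> p) g)}"

definition gauge_transformations ::
  "('g, 'eg::euclidean_space, 'x, 'ex::euclidean_space) groupoid \<Rightarrow>
   ('p, 'ep::euclidean_space, 'm, 'x, 'g) pbundle \<Rightarrow> ('q, 'eq::euclidean_space, 'm, 'x, 'g) pbundle \<Rightarrow>
   ('p \<times> 'q \<Rightarrow> 'g) set" where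
  "gauge_transformations G P Q =
     {K \<in> extensional (fib_prod (total P) (bproj P) (total Q) (bproj Q)).
        smooth_map (fib_prod_mfd (total P) (bproj P) (total Q) (bproj Q)) (arrows G) K \<and>
        (\<forall>(p, q)\<in>fib_prod (total P) (bproj P) (total Q) (bproj Q).
           src G (K (p, q)) = moment P p \<and> tgt G (K (p, q)) = moment Q q \<and>
           (\<forall>g\<in>arr G. \<forall>h\<in>arr G. tgt G g = moment P p \<longrightarrow> tgt G h = moment Q q \<longrightarrow>
              K (act P p g, act Q q h) = mult G (mult G (ginv G h) (K (p, q))) g))}"

end

theory Submission
  imports Defs
begin

text \<open>
  A principal bundle has a division map: for two points \<open>q\<close> and \<open>q'\<close> of the same fibre there is exactly
  one arrow \<open>g\<close> with \<open>q g = q'\<close>, and it depends smoothly on \<open>(q, q')\<close>. A morphism \<open>\<sigma>\<close> from \<open>P\<close> to \<open>Q\<close>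
  corresponds to the map \<open>K\<close> with \<open>q K(p, q) = \<sigma> p\<close>, that is, \<open>K(p, q)\<close> is the quotient of \<open>\<sigma> p\<close> by \<open>q\<close>.
  Equivariance of \<open>K\<close> is then an identity in the groupoid, using that the action is free on fibres.
  Conversely, \<open>q K(p, q)\<close> does not depend on the point \<open>q\<close> over the base point of \<open>p\<close>, because
  \<open>(q h) (h\<^sup>-\<^sup>1 K(p, q)) = q K(p, q)\<close>, so that it defines \<open>\<sigma> p\<close>. The two assignments are inverse to each
  other (\<open>gauge_of_morphism_in_gauge_transformations\<close>, \<open>morphism_of_gauge_in_bundle_morphisms\<close>).

  The rest is smoothness. The maps above pass through fibre products, whose smooth structure comes
  from slice charts, and \<open>\<sigma>\<close> is smooth because \<open>q\<close> can be chosen by a local section of the projection.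
  Both require one fact about submersions, \<open>submersion_normal_form\<close>: in suitable charts a submersion
  is a linear surjection \<open>D\<close>. With a linear right inverse of \<open>D\<close>, local sections (\<open>local_section\<close>) and
  slice charts of fibre products (\<open>fibre_product_embedded\<close>) are given by formulas. For the domain
  of the action this is applied to the target map, a submersion since it is the source map after
  inversion.

  The normal form rests on the smooth inverse function theorem for maps between open subsets of a
  linear subspace (\<open>smooth_local_inverse\<close>). The inverse exists and is differentiable by the inverse
  function theorem on the whole space; that it is as often differentiable as the map follows from
  \<open>Ck_inverse_family\<close>: if a family of linear maps is \<open>k\<close> times continuously differentiable in its
  parameter and the inverses of its members are uniformly bounded, then the family of these
  inverses is \<open>k\<close> times continuously differentiable as well.
\<close>

section \<open>Calculus on open subsets of subspaces\<close>

lemma Ck_cong: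
  assumes "\<And>x. x \<in> U \<Longrightarrow> f x = g x" and "Ck k V U f"
  shows "Ck k V U g"
proof (cases k)
  case 0
  then show ?thesis
    using assms by (metis Ck.simps(1) continuous_on_cong)
next
  case (Suc j)
  then obtain f' where f': "\<forall>x\<in>U. (f has_derivative f' x) (at x within U)"
    "\<forall>v\<in>V. Ck j V U (\<lambda>x. f' x v)"
    using assms(2) by auto
  have "\<forall>x\<in>U. (g has_derivative f' x) (at x within U)"
    using f'(1) assms(1) by (metis has_derivative_transform)
  with f'(2) Suc show ?thesis
    by auto
qed

lemma Ck_subset:
  assumes "Ck k V U f" and "U' \<subseteq> U" and "V' \<subseteq> V"
  shows "Ck k V' U' f"
  using assms
proof (induction k arbitrary: f)
  case 0
  then show ?case
    by (auto intro: continuous_on_subset)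
next
  case (Suc k)
  then obtain f' where f': "\<forall>x\<in>U. (f has_derivative f' x) (at x within U)"
    "\<forall>v\<in>V. Ck k V U (\<lambda>x. f' x v)"
    by auto
  have "\<forall>x\<in>U'. (f has_derivative f' x) (at x within U')"
    using f'(1) Suc.prems(2) has_derivative_subset by blast
  moreover have "\<forall>v\<in>V'. Ck k V' U' (\<lambda>x. f' x v)"
    using f'(2) Suc by blast
  ultimately show ?case
    by auto
qed

lemma Ck_lower: "Ck (Suc k) V U f \<Longrightarrow> Ck k V U f"
proof (induction k arbitrary: f)
  case 0
  then show ?case
    by (auto simp: continuous_on_eq_continuous_within intro: has_derivative_continuous)
next
  case (Suc k)
  then obtain f' where "\<forall>x\<in>U. (f has_derivative f' x) (at x within U)"
    "\<forall>v\<in>V. Ck (Suc k) V U (\<lambda>x. f' x v)"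
    by (auto simp del: Ck.simps simp add: Ck.simps(2)[where k = "Suc k"])
  with Suc.IH show ?case
    by auto
qed

lemma Ck_const: "Ck k V U (\<lambda>x. c)"
proof (induction k arbitrary: c)
  case (Suc k)
  then show ?case
    by (auto intro!: exI[of _ "\<lambda>x v. 0"])
qed auto

lemma Ck_ident: "Ck k V U (\<lambda>x. x)"
proof (cases k)
  case (Suc j)
  then show ?thesis
    by (auto intro!: exI[of _ "\<lambda>x v. v"] Ck_const)
qed auto

lemma Ck_linear_comp:
  assumes "bounded_linear L" and "Ck k V U f"
  shows "Ck k V U (\<lambda>x. L (f x))"
  using assms(2)
proof (induction k arbitrary: f)
  case 0
  then show ?case
    using assms(1) by (auto intro: bounded_linear.continuous_on)
next
  case (Suc k)
  then obtain f' where f': "\<forall>x\<in>U. (f has_derivative f' x) (at x within U)"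
    "\<forall>v\<in>V. Ck k V U (\<lambda>x. f' x v)"
    by auto
  have "\<forall>x\<in>U. ((\<lambda>x. L (f x)) has_derivative (\<lambda>v. L (f' x v))) (at x within U)"
    using f'(1) bounded_linear.has_derivative[OF assms(1)] by blast
  moreover have "\<forall>v\<in>V. Ck k V U (\<lambda>x. L (f' x v))"
    using Suc.IH f'(2) by blast
  ultimately show ?case
    by (auto intro!: exI[of _ "\<lambda>x v. L (f' x v)"])
qed

lemma Ck_linear: "bounded_linear L \<Longrightarrow> Ck k V U L"
  using Ck_linear_comp[OF _ Ck_ident] .

lemma Ck_add:
  assumes "Ck k V U f" and "Ck k V U g"
  shows "Ck k V U (\<lambda>x. f x + g x)"
  using assms
proof (induction k arbitrary: f g)
  case 0
  then show ?case
    by (auto intro: continuous_on_add)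
next
  case (Suc k)
  then obtain f' g' where "\<forall>x\<in>U. (f has_derivative f' x) (at x within U)"
    "\<forall>v\<in>V. Ck k V U (\<lambda>x. f' x v)" "\<forall>x\<in>U. (g has_derivative g' x) (at x within U)"
    "\<forall>v\<in>V. Ck k V U (\<lambda>x. g' x v)"
    by auto
  with Suc.IH show ?case
    by (auto intro!: exI[of _ "\<lambda>x v. f' x v + g' x v"] has_derivative_add)
qed

lemma Ck_diff:
  assumes "Ck k V U f" and "Ck k V U g"
  shows "Ck k V U (\<lambda>x. f x - g x)"
  using Ck_add[OF assms(1) Ck_linear_comp[OF bounded_linear_minus[OF bounded_linear_ident] assms(2)]]
  by simp

lemma Ck_sum:
  assumes "\<And>i. i \<in> I \<Longrightarrow> Ck k V U (f i)"
  shows "Ck k V U (\<lambda>x. \<Sum>i\<in>I. f i x)"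
  using assms
  by (induction I rule: infinite_finite_induct) (auto intro: Ck_const Ck_add)

lemma Ck_scaleR:
  fixes a :: "'a::real_normed_vector \<Rightarrow> real"
  assumes "Ck k V U a" and "Ck k V U f"
  shows "Ck k V U (\<lambda>x. a x *\<^sub>R f x)"
  using assms
proof (induction k arbitrary: a f)
  case 0
  then show ?case
    by (auto intro: continuous_on_scaleR)
next
  case (Suc k)
  then obtain a' f' where d: "\<forall>x\<in>U. (a has_derivative a' x) (at x within U)"
    "\<forall>v\<in>V. Ck k V U (\<lambda>x. a' x v)" "\<forall>x\<in>U. (f has_derivative f' x) (at x within U)"
    "\<forall>v\<in>V. Ck k V U (\<lambda>x. f' x v)"
    by auto
  have "\<forall>x\<in>U. ((\<lambda>x. a x *\<^sub>R f x) has_derivative (\<lambda>v. a x *\<^sub>R f' x v + a' x v *\<^sub>R f x)) (at x within U)"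
    using d by (auto intro!: has_derivative_scaleR)
  moreover have "\<forall>v\<in>V. Ck k V U (\<lambda>x. a x *\<^sub>R f' x v + a' x v *\<^sub>R f x)"
    using d Suc.IH Ck_lower[OF Suc.prems(1)] Ck_lower[OF Suc.prems(2)] by (auto intro!: Ck_add)
  ultimately show ?case
    by (auto intro!: exI[of _ "\<lambda>x v. a x *\<^sub>R f' x v + a' x v *\<^sub>R f x"])
qed

lemma Ck_inner_left: "Ck k V U f \<Longrightarrow> Ck k V U (\<lambda>x. f x \<bullet> b)"
  by (rule Ck_linear_comp[OF bounded_linear_inner_left])

lemma Ck_Pair:
  assumes "Ck k V U f" and "Ck k V U g"
  shows "Ck k V U (\<lambda>x. (f x, g x))"
proof -
  have "bounded_linear (\<lambda>x::'b. (x, 0::'c))" "bounded_linear (\<lambda>y::'c. (0::'b, y))"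
    by (auto intro!: bounded_linear_Pair bounded_linear_ident bounded_linear_zero)
  from Ck_add[OF Ck_linear_comp[OF this(1) assms(1)] Ck_linear_comp[OF this(2) assms(2)]]
  show ?thesis
    by simp
qed

text \<open>The vectors of \<open>B\<close> form an orthonormal basis of \<open>V\<close>. It serves to write a linear map depending on
  a point as a finite sum of scalar functions times vector functions, for which the product rule
  is available.\<close>

lemma subspace_coordinates:
  fixes V :: "'a::euclidean_space set"
  assumes "subspace V"
  obtains B where "finite B" "B \<subseteq> V" "\<And>v. v \<in> V \<Longrightarrow> (\<Sum>b\<in>B. (v \<bullet> b) *\<^sub>R b) = v"
proof -
  obtain B where B: "B \<subseteq> V" "pairwise orthogonal B" "\<And>x. x \<in> B \<Longrightarrow> norm x = 1"
    "independent B" "span B = V"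
    using orthonormal_basis_subspace[OF assms] by metis
  have fin: "finite B"
    using B(4) independent_imp_finite by blast
  have "(\<Sum>b\<in>B. (v \<bullet> b) *\<^sub>R b) = v" if "v \<in> V" for v
  proof (rule linear_eq_on_span[where B = B])
    show "linear (\<lambda>v. \<Sum>b\<in>B. (v \<bullet> b) *\<^sub>R b)"
      by (intro linearI) (simp_all add: inner_add_left scaleR_add_left sum.distrib scaleR_sum_right)
    show "linear (\<lambda>v::'a. v)"
      by (intro linearI) simp_all
    show "v \<in> span B"
      using that B(5) by simp
    fix c assume c: "c \<in> B"
    have "(\<Sum>b\<in>B. (c \<bullet> b) *\<^sub>R b) = (\<Sum>b\<in>B. if b = c then c else 0)"
      using B(2,3) c by (intro sum.cong) (auto simp: pairwise_def orthogonal_def norm_eq_1)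
    then show "(\<Sum>b\<in>B. (c \<bullet> b) *\<^sub>R b) = c"
      using c fin by simp
  qed
  then show ?thesis
    using that fin B(1) by blast
qed

lemma subspace_projection:
  fixes V :: "'a::euclidean_space set"
  assumes "subspace V"
  obtains \<pi> where "bounded_linear \<pi>" "\<And>v. v \<in> V \<Longrightarrow> \<pi> v = v" "\<And>x. \<pi> x \<in> V"
proof -
  obtain B where B: "finite B" "B \<subseteq> V" "\<And>v. v \<in> V \<Longrightarrow> (\<Sum>b\<in>B. (v \<bullet> b) *\<^sub>R b) = v"
    using subspace_coordinates[OF assms] by metis
  let ?p = "\<lambda>x. \<Sum>b\<in>B. (x \<bullet> b) *\<^sub>R b"
  have "bounded_linear ?p"
    by (intro bounded_linear_sum bounded_linear_compose[OF bounded_linear_scaleR_left]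
        bounded_linear_inner_left)
  moreover have "?p x \<in> V" for x
    using B(2) assms by (auto intro!: subspace_sum subspace_scale)
  ultimately show ?thesis
    using that[of ?p] B(3) by blast
qed

text \<open>Restrict \<open>f\<close> to the line through \<open>x\<close> in direction \<open>v\<close>, which stays in \<open>U\<close> for small times.\<close>

lemma has_derivative_unique_on_subspace:
  fixes f :: "'a::euclidean_space \<Rightarrow> 'b::real_normed_vector"
  assumes "subspace V" "openin (top_of_set V) U" "x \<in> U" "v \<in> V"
    and A: "(f has_derivative A) (at x within U)" and B: "(f has_derivative B) (at x within U)"
  shows "A v = B v"
proof -
  obtain W where W: "open W" "U = V \<inter> W"
    using assms(2) by (auto simp: openin_open)
  let ?l = "\<lambda>t::real. x + t *\<^sub>R v"
  let ?T = "?l -` W"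
  have "open ?T"
    using W(1) by (intro continuous_open_vimage) (auto intro!: continuous_intros)
  have T0: "0 \<in> ?T"
    using assms(3) W by auto
  have lT: "?l ` ?T \<subseteq> U"
    using assms(1,3,4) W by (auto simp: subspace_add subspace_scale)
  have l: "(?l has_derivative (\<lambda>t. t *\<^sub>R v)) (at 0 within ?T)"
    by (auto intro!: derivative_eq_intros)
  have "(f \<circ> ?l has_derivative A \<circ> (\<lambda>t. t *\<^sub>R v)) (at 0 within ?T)"
    using has_derivative_subset[OF A lT] by (intro diff_chain_within[OF l]) simp
  moreover have "(f \<circ> ?l has_derivative B \<circ> (\<lambda>t. t *\<^sub>R v)) (at 0 within ?T)"
    using has_derivative_subset[OF B lT] by (intro diff_chain_within[OF l]) simp
  moreover have "at 0 within ?T = at (0::real)"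
    using \<open>open ?T\<close> T0 by (rule at_within_open[rotated])
  ultimately have "A \<circ> (\<lambda>t. t *\<^sub>R v) = B \<circ> (\<lambda>t. t *\<^sub>R v)"
    by (metis has_derivative_unique)
  from fun_cong[OF this, of 1] show ?thesis
    by simp
qed

text \<open>Composing \<open>f\<close> with a projection onto \<open>V'\<close> does not change it, hence does not change its
  derivative in directions of \<open>V\<close>.\<close>

lemma derivative_in_subspace:
  fixes f :: "'a::euclidean_space \<Rightarrow> 'b::euclidean_space"
  assumes "subspace V" "openin (top_of_set V) U" "x \<in> U" "v \<in> V"
    and "subspace V'" "f ` U \<subseteq> V'" and f': "(f has_derivative f') (at x within U)"
  shows "f' v \<in> V'"
proof -
  obtain \<pi> where \<pi>: "bounded_linear \<pi>" "\<And>v. v \<in> V' \<Longrightarrow> \<pi> v = v" "\<And>x. \<pi> x \<in> V'"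
    using subspace_projection[OF assms(5)] by metis
  have "((\<lambda>x. \<pi> (f x)) has_derivative (\<lambda>v. \<pi> (f' v))) (at x within U)"
    by (rule bounded_linear.has_derivative[OF \<pi>(1) f'])
  then have "(f has_derivative (\<lambda>v. \<pi> (f' v))) (at x within U)"
    by (rule has_derivative_transform[rotated 2]) (use assms(3,6) \<pi>(2) in auto)
  then have "f' v = \<pi> (f' v)"
    using has_derivative_unique_on_subspace[OF assms(1-4) f'] by blast
  then show ?thesis
    using \<pi>(3) by metis
qed

text \<open>The derivative of the composite is a linear map at \<open>f x\<close> applied to a vector \<open>f' x v\<close> that varies
  as well. That vector lies in \<open>V'\<close>; expanded in a basis of \<open>V'\<close>, it turns the expression into a sum
  of products of functions of class \<open>k\<close>.\<close>

lemma Ck_compose: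
  fixes f :: "'a::euclidean_space \<Rightarrow> 'b::euclidean_space"
  assumes V: "subspace V" "openin (top_of_set V) U" and V': "subspace V'" "U' \<subseteq> V'"
    and fU: "f ` U \<subseteq> U'" and "Ck k V U f" and "Ck k V' U' g"
  shows "Ck k V U (\<lambda>x. g (f x))"
  using assms(6,7)
proof (induction k arbitrary: g)
  case 0
  then show ?case
    using fU by (auto intro: continuous_on_compose2)
next
  case (Suc k)
  obtain f' where f': "\<forall>x\<in>U. (f has_derivative f' x) (at x within U)"
    "\<forall>v\<in>V. Ck k V U (\<lambda>x. f' x v)"
    using Suc.prems(1) by auto
  obtain g' where g': "\<forall>x\<in>U'. (g has_derivative g' x) (at x within U')"
    "\<forall>v\<in>V'. Ck k V' U' (\<lambda>x. g' x v)"
    using Suc.prems(2) by auto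
  obtain B where B: "finite B" "B \<subseteq> V'" "\<And>v. v \<in> V' \<Longrightarrow> (\<Sum>b\<in>B. (v \<bullet> b) *\<^sub>R b) = v"
    using subspace_coordinates[OF V'(1)] by metis
  have "((\<lambda>x. g (f x)) has_derivative (\<lambda>v. g' (f x) (f' x v))) (at x within U)" if "x \<in> U" for x
  proof -
    have "(g has_derivative g' (f x)) (at (f x) within f ` U)"
      using g'(1) that fU by (meson has_derivative_subset image_subset_iff)
    then show ?thesis
      using diff_chain_within[of f "f' x" x U g] f'(1) that by (simp add: o_def)
  qed
  moreover have "Ck k V U (\<lambda>x. g' (f x) (f' x v))" if "v \<in> V" for v
  proof -
    have eq: "(\<Sum>b\<in>B. (f' x v \<bullet> b) *\<^sub>R g' (f x) b) = g' (f x) (f' x v)" if "x \<in> U" for x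
    proof -
      have "f' x v \<in> V'"
        using derivative_in_subspace[OF V \<open>x \<in> U\<close> \<open>v \<in> V\<close> V'(1)] f'(1) fU V'(2) that by blast
      then have e: "(\<Sum>b\<in>B. (f' x v \<bullet> b) *\<^sub>R b) = f' x v"
        by (rule B(3))
      have "linear (g' (f x))"
        using g'(1) fU that has_derivative_linear by blast
      then have "g' (f x) (\<Sum>b\<in>B. (f' x v \<bullet> b) *\<^sub>R b) = (\<Sum>b\<in>B. (f' x v \<bullet> b) *\<^sub>R g' (f x) b)"
        by (simp add: linear_sum linear_scale)
      with e show ?thesis
        by simp
    qed
    have "Ck k V U (\<lambda>x. \<Sum>b\<in>B. (f' x v \<bullet> b) *\<^sub>R g' (f x) b)"
      using f'(2) g'(2) B(2) that Ck_lower[OF Suc.prems(1)]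
      by (intro Ck_sum Ck_scaleR Ck_inner_left Suc.IH) auto
    then show ?thesis
      by (rule Ck_cong[rotated]) (rule eq)
  qed
  ultimately show ?case
    by (auto intro!: exI[of _ "\<lambda>x v. g' (f x) (f' x v)"])
qed

lemma at_within_openin:
  assumes "openin (top_of_set V) T" "T \<subseteq> U" "U \<subseteq> V" "x \<in> T"
  shows "at x within T = at x within U"
proof -
  obtain W where "open W" "T = V \<inter> W"
    using assms(1) by (auto simp: openin_open)
  then show ?thesis
    using assms by (intro at_within_nhd[of x W]) auto
qed

text \<open>The derivatives supplied by the various neighbourhoods may disagree off \<open>V\<close>, where nothing pins
  them down. The derivative at \<open>x\<close> is taken from a neighbourhood chosen for \<open>x\<close>; on directions in
  \<open>V\<close> this does not depend on the choice, so near \<open>x\<close> it is the derivative coming from one fixed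
  neighbourhood.\<close>

lemma Ck_local:
  fixes f :: "'a::euclidean_space \<Rightarrow> 'b::real_normed_vector"
  assumes V: "subspace V" "U \<subseteq> V"
    and "\<And>x. x \<in> U \<Longrightarrow> \<exists>T. openin (top_of_set V) T \<and> x \<in> T \<and> T \<subseteq> U \<and> Ck k V T f"
  shows "Ck k V U f"
  using assms(3)
proof (induction k arbitrary: f)
  case 0
  have "continuous (at x within U) f" if x: "x \<in> U" for x
  proof -
    obtain T where T: "openin (top_of_set V) T" "x \<in> T" "T \<subseteq> U" "Ck 0 V T f"
      using 0[OF x] by blast
    then have "continuous (at x within T) f"
      by (auto simp: continuous_on_eq_continuous_within)
    then show ?thesis
      using at_within_openin[OF T(1,3) V(2) T(2)] by simp
  qed
  then show ?case
    by (auto simp: continuous_on_eq_continuous_within)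
next
  case (Suc k)
  have "\<exists>T f'. openin (top_of_set V) T \<and> x \<in> T \<and> T \<subseteq> U \<and>
      (\<forall>x\<in>T. (f has_derivative f' x) (at x within T)) \<and> (\<forall>v\<in>V. Ck k V T (\<lambda>x. f' x v))" if "x \<in> U" for x
    using Suc.prems[OF that] by (simp only: Ck.simps) blast
  then obtain T F where TF: "\<And>x. x \<in> U \<Longrightarrow> openin (top_of_set V) (T x) \<and> x \<in> T x \<and> T x \<subseteq> U \<and>
      (\<forall>y\<in>T x. (f has_derivative F x y) (at y within T x)) \<and> (\<forall>v\<in>V. Ck k V (T x) (\<lambda>y. F x y v))"
    by metis
  have "(f has_derivative F x x) (at x within U)" if "x \<in> U" for x
    using TF[OF that] at_within_openin[of V "T x" U x] V(2) by metis
  moreover have "Ck k V U (\<lambda>x. F x x v)" if v: "v \<in> V" for v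
  proof (rule Suc.IH)
    fix x assume x: "x \<in> U"
    have "F x y v = F y y v" if y: "y \<in> T x" for y
    proof (rule has_derivative_unique_on_subspace[OF V(1) _ _ v])
      have yU: "y \<in> U"
        using TF[OF x] y by blast
      show "openin (top_of_set V) (T x \<inter> T y)" "y \<in> T x \<inter> T y"
        using TF[OF x] TF[OF yU] y by auto
      show "(f has_derivative F x y) (at y within T x \<inter> T y)"
        "(f has_derivative F y y) (at y within T x \<inter> T y)"
        using TF[OF x] TF[OF yU] y by (auto intro: has_derivative_subset)
    qed
    moreover have "Ck k V (T x) (\<lambda>y. F x y v)"
      using TF[OF x] v by blast
    ultimately have "Ck k V (T x) (\<lambda>y. F y y v)"
      by (rule Ck_cong)
    then show "\<exists>T. openin (top_of_set V) T \<and> x \<in> T \<and> T \<subseteq> U \<and> Ck k V T (\<lambda>x. F x x v)"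
      using TF[OF x] by blast
  qed
  ultimately show ?case
    by (auto intro!: exI[of _ "\<lambda>x. F x x"])
qed

section \<open>The inverse function theorem on subspaces\<close>

text \<open>Because \<open>a\<close> vanishes at \<open>y\<close>, the product rule holds although \<open>m\<close> is merely continuous. This is what
  makes the inverse of a differentiable family of linear maps differentiable.\<close>

lemma has_derivative_scaleR_vanishing:
  fixes a :: "'a::real_normed_vector \<Rightarrow> real" and m :: "'a \<Rightarrow> 'b::real_normed_vector"
  assumes a: "(a has_derivative a') (at y within U)" and a0: "a y = 0"
    and m: "continuous (at y within U) m"
  shows "((\<lambda>z. a z *\<^sub>R m z) has_derivative (\<lambda>h. a' h *\<^sub>R m y)) (at y within U)"
proof -
  have bl: "bounded_linear a'"
    using a by (rule has_derivative_bounded_linear)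
  obtain K where K: "\<And>h. norm (a' h) \<le> norm h * K"
    using bounded_linear.bounded[OF bl] by blast
  let ?q = "\<lambda>z. (1 / norm (z - y)) *\<^sub>R (a z - (a y + a' (z - y)))"
  let ?r = "\<lambda>z. (1 / norm (z - y) * a' (z - y)) *\<^sub>R (m z - m y)"
  have mlim: "(m \<longlongrightarrow> m y) (at y within U)"
    using m by (simp add: continuous_within)
  have "(?q \<longlongrightarrow> 0) (at y within U)"
    using a by (simp add: has_derivative_within)
  then have "((\<lambda>z. ?q z *\<^sub>R m z) \<longlongrightarrow> 0 *\<^sub>R m y) (at y within U)"
    using mlim by (rule tendsto_scaleR)
  moreover have "(?r \<longlongrightarrow> 0) (at y within U)"
  proof (rule Lim_null_comparison)
    have "norm (?r z) \<le> K * norm (m z - m y)" if "z \<noteq> y" for z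
    proof -
      have "norm (1 / norm (z - y) * a' (z - y)) \<le> K"
        using K[of "z - y"] that by (simp add: field_simps)
      then show ?thesis
        unfolding norm_scaleR real_norm_def[symmetric] by (rule mult_right_mono) simp
    qed
    then show "\<forall>\<^sub>F z in at y within U. norm (?r z) \<le> K * norm (m z - m y)"
      by (auto simp: eventually_at_filter)
    have "((\<lambda>z. K * norm (m z - m y)) \<longlongrightarrow> K * norm (m y - m y)) (at y within U)"
      by (intro tendsto_intros mlim)
    then show "((\<lambda>z. K * norm (m z - m y)) \<longlongrightarrow> 0) (at y within U)"
      by simp
  qed
  ultimately have "((\<lambda>z. ?q z *\<^sub>R m z + ?r z) \<longlongrightarrow> 0) (at y within U)"
    using tendsto_add by fastforce
  moreover have "?q z *\<^sub>R m z + ?r z =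
      (1 / norm (z - y)) *\<^sub>R (a z *\<^sub>R m z - (a y *\<^sub>R m y + a' (z - y) *\<^sub>R m y))" for z
    using a0 by (simp add: algebra_simps)
  moreover have "bounded_linear (\<lambda>h. a' h *\<^sub>R m y)"
    using bl by (rule bounded_linear_scaleR_const)
  ultimately show ?thesis
    by (simp add: has_derivative_within)
qed

text \<open>From \<open>M z w - M y w = M z (w - L z (M y w))\<close> and the uniform bound on \<open>M\<close>.\<close>

lemma continuous_inverse_family:
  fixes L M :: "'a::real_normed_vector \<Rightarrow> 'b::euclidean_space \<Rightarrow> 'b"
  assumes lin: "\<And>y. y \<in> U \<Longrightarrow> linear (M y)"
    and inv: "\<And>y w. y \<in> U \<Longrightarrow> M y (L y w) = w" "\<And>y w. y \<in> U \<Longrightarrow> L y (M y w) = w"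
    and bd: "\<And>y w. y \<in> U \<Longrightarrow> norm (M y w) \<le> C * norm w"
    and L: "\<And>w. continuous_on U (\<lambda>y. L y w)"
  shows "continuous_on U (\<lambda>y. M y w)"
  unfolding continuous_on_def
proof
  fix y assume y: "y \<in> U"
  have "((\<lambda>z. M z w - M y w) \<longlongrightarrow> 0) (at y within U)"
  proof (rule Lim_null_comparison)
    have "norm (M z w - M y w) \<le> C * norm (w - L z (M y w))" if "z \<in> U" for z
      using bd[OF that, of "w - L z (M y w)"] by (simp add: linear_diff[OF lin[OF that]] inv that)
    then show "\<forall>\<^sub>F z in at y within U. norm (M z w - M y w) \<le> C * norm (w - L z (M y w))"
      by (auto simp: eventually_at_filter)
    have "((\<lambda>z. L z (M y w)) \<longlongrightarrow> L y (M y w)) (at y within U)"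
      using L y by (auto simp: continuous_on_def)
    then have "((\<lambda>z. C * norm (w - L z (M y w))) \<longlongrightarrow> C * norm (w - L y (M y w))) (at y within U)"
      by (intro tendsto_intros)
    then show "((\<lambda>z. C * norm (w - L z (M y w))) \<longlongrightarrow> 0) (at y within U)"
      by (simp add: inv y)
  qed
  then show "((\<lambda>z. M z w) \<longlongrightarrow> M y w) (at y within U)"
    by (rule LIM_zero_cancel)
qed

text \<open>With \<open>u = M y w\<close> fixed, \<open>M z w = u + M z (w - L z u)\<close>, and the argument \<open>w - L z u\<close> vanishes at
  \<open>z = y\<close>. So the derivative of \<open>M\<close> at \<open>y\<close> is \<open>- M y \<circ> L' \<circ> M y\<close>, which involves only the derivative of
  \<open>L\<close> and \<open>M\<close> itself; hence \<open>M\<close> gains one order of differentiability at each step of the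
  induction.\<close>

lemma Ck_inverse_family:
  fixes L M :: "'a::real_normed_vector \<Rightarrow> 'b::euclidean_space \<Rightarrow> 'b"
  assumes lin: "\<And>y. y \<in> U \<Longrightarrow> linear (L y)" "\<And>y. y \<in> U \<Longrightarrow> linear (M y)"
    and inv: "\<And>y w. y \<in> U \<Longrightarrow> M y (L y w) = w" "\<And>y w. y \<in> U \<Longrightarrow> L y (M y w) = w"
    and bd: "\<And>y w. y \<in> U \<Longrightarrow> norm (M y w) \<le> C * norm w"
    and "\<And>w. Ck k V U (\<lambda>y. L y w)"
  shows "Ck k V U (\<lambda>y. M y w)"
  using assms(6)
proof (induction k arbitrary: w)
  case 0
  then have "continuous_on U (\<lambda>y. M y w)"
    by (intro continuous_inverse_family[OF lin(2) inv bd]) auto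
  then show ?case
    by simp
next
  case (Suc k)
  have "\<forall>c. \<exists>f'. (\<forall>y\<in>U. ((\<lambda>y. L y c) has_derivative f' y) (at y within U)) \<and>
      (\<forall>v\<in>V. Ck k V U (\<lambda>y. f' y v))"
    using Suc.prems by (simp only: Ck.simps) blast
  then obtain F where F: "\<And>c y. y \<in> U \<Longrightarrow> ((\<lambda>y. L y c) has_derivative F c y) (at y within U)"
      "\<And>c v. v \<in> V \<Longrightarrow> Ck k V U (\<lambda>y. F c y v)"
    by metis
  have Lk: "\<And>w. Ck k V U (\<lambda>y. L y w)"
    using Suc.prems Ck_lower by blast
  then have Mk: "\<And>w. Ck k V U (\<lambda>y. M y w)"
    using Suc.IH by blast
  have Mc: "continuous_on U (\<lambda>y. M y w)" for w
    using Ck_lower[OF Suc.prems] 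
    by (intro continuous_inverse_family[OF lin(2) inv bd])
      (auto simp: continuous_on_eq_continuous_within intro!: has_derivative_continuous[OF F(1)])
  let ?D = "\<lambda>y h. \<Sum>b\<in>Basis. (- ((\<Sum>c\<in>Basis. (M y w \<bullet> c) *\<^sub>R F c y h) \<bullet> b)) *\<^sub>R M y b"
  have "((\<lambda>z. M z w) has_derivative ?D y) (at y within U)" if y: "y \<in> U" for y
  proof -
    let ?u = "M y w"
    have Lu: "L z ?u = (\<Sum>c\<in>Basis. (?u \<bullet> c) *\<^sub>R L z c)" if "z \<in> U" for z
    proof -
      have "L z ?u = L z (\<Sum>c\<in>Basis. (?u \<bullet> c) *\<^sub>R c)"
        by (simp only: euclidean_representation)
      then show ?thesis
        by (simp add: linear_sum[OF lin(1)[OF that]] linear_scale[OF lin(1)[OF that]])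
    qed
    have Mz: "M z w = ?u + (\<Sum>b\<in>Basis. ((w - (\<Sum>c\<in>Basis. (?u \<bullet> c) *\<^sub>R L z c)) \<bullet> b) *\<^sub>R M z b)"
      if z: "z \<in> U" for z
    proof -
      have "M z (w - L z ?u) = M z (\<Sum>b\<in>Basis. ((w - L z ?u) \<bullet> b) *\<^sub>R b)"
        by (simp only: euclidean_representation)
      also have "\<dots> = (\<Sum>b\<in>Basis. ((w - L z ?u) \<bullet> b) *\<^sub>R M z b)"
        by (simp only: linear_sum[OF lin(2)[OF z]] linear_scale[OF lin(2)[OF z]])
      finally have "M z (w - L z ?u) = \<dots>" .
      moreover have "M z (w - L z ?u) = M z w - ?u"
        by (simp only: linear_diff[OF lin(2)[OF z]] inv(1)[OF z])
      ultimately have "M z w - ?u = (\<Sum>b\<in>Basis. ((w - L z ?u) \<bullet> b) *\<^sub>R M z b)"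
        by simp
      then show ?thesis
        unfolding Lu[OF z] by (simp only: diff_eq_eq add.commute)
    qed
    have "((\<lambda>z. ?u + (\<Sum>b\<in>Basis. ((w - (\<Sum>c\<in>Basis. (?u \<bullet> c) *\<^sub>R L z c)) \<bullet> b) *\<^sub>R M z b))
        has_derivative (\<lambda>h. 0 + ?D y h)) (at y within U)"
    proof (intro has_derivative_add has_derivative_const has_derivative_sum
        has_derivative_scaleR_vanishing)
      fix b :: 'b
      have "((\<lambda>z. (w - (\<Sum>c\<in>Basis. (?u \<bullet> c) *\<^sub>R L z c)) \<bullet> b) has_derivative
          (\<lambda>h. (0 - (\<Sum>c\<in>Basis. (?u \<bullet> c) *\<^sub>R F c y h)) \<bullet> b)) (at y within U)"
        using F(1)[OF y]
        by (intro has_derivative_inner_left has_derivative_diff has_derivative_const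
            has_derivative_sum has_derivative_scaleR_right)
      then show "((\<lambda>z. (w - (\<Sum>c\<in>Basis. (?u \<bullet> c) *\<^sub>R L z c)) \<bullet> b) has_derivative
          (\<lambda>h. - ((\<Sum>c\<in>Basis. (?u \<bullet> c) *\<^sub>R F c y h) \<bullet> b))) (at y within U)"
        by simp
      show "(w - (\<Sum>c\<in>Basis. (?u \<bullet> c) *\<^sub>R L y c)) \<bullet> b = 0"
        using Lu[OF y] inv(2)[OF y] by simp
      show "continuous (at y within U) (\<lambda>z. M z b)"
        using Mc y by (auto simp: continuous_on_eq_continuous_within)
    qed
    then have "((\<lambda>z. ?u + (\<Sum>b\<in>Basis. ((w - (\<Sum>c\<in>Basis. (?u \<bullet> c) *\<^sub>R L z c)) \<bullet> b) *\<^sub>R M z b))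
        has_derivative ?D y) (at y within U)"
      by simp
    then show ?thesis
    proof (rule has_derivative_transform[rotated 2])
      show "y \<in> U"
        by (rule y)
    qed (rule Mz)
  qed
  moreover have "Ck k V U (\<lambda>y. ?D y v)" if "v \<in> V" for v
  proof -
    have "Ck k V U (\<lambda>y. (-1) * ((\<Sum>c\<in>Basis. (M y w \<bullet> c) *\<^sub>R F c y v) \<bullet> b))" for b
      by (intro Ck_linear_comp[OF bounded_linear_mult_right] Ck_inner_left Ck_sum Ck_scaleR Mk
          F(2) that)
    then have "Ck k V U (\<lambda>y. - ((\<Sum>c\<in>Basis. (M y w \<bullet> c) *\<^sub>R F c y v) \<bullet> b))" for b
      by simp
    then show ?thesis
      by (intro Ck_sum Ck_scaleR Mk)
  qed
  ultimately show ?case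
    by (auto intro!: exI[of _ ?D])
qed

text \<open>The derivative of \<open>G\<close> at \<open>y\<close> inverts the derivative of \<open>F\<close> at \<open>G y\<close>. If \<open>G\<close> is of class \<open>k\<close>, so are
  \<open>y \<mapsto> F' (G y)\<close> and its inverse; then \<open>G\<close> is of class \<open>Suc k\<close>.\<close>

lemma Ck_inverse:
  fixes F G :: "'a::euclidean_space \<Rightarrow> 'a"
  assumes "open U" and "open T" and GT: "G ` T \<subseteq> U"
    and F': "\<And>x. x \<in> U \<Longrightarrow> (F has_derivative F' x) (at x)"
    and G': "\<And>y. y \<in> T \<Longrightarrow> (G has_derivative G' y) (at y)"
    and inv: "\<And>y w. y \<in> T \<Longrightarrow> G' y (F' (G y) w) = w" "\<And>y w. y \<in> T \<Longrightarrow> F' (G y) (G' y w) = w"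
    and bd: "\<And>y w. y \<in> T \<Longrightarrow> norm (G' y w) \<le> C * norm w"
    and F: "\<And>v j. Ck j UNIV U (\<lambda>x. F' x v)"
  shows "Ck k UNIV T G"
proof (induction k)
  case 0
  then show ?case
    using G' by (auto intro!: continuous_at_imp_continuous_on has_derivative_continuous)
next
  case (Suc k)
  have "Ck k UNIV T (\<lambda>y. G' y v)" for v
  proof (rule Ck_inverse_family[OF _ _ inv bd])
    show "linear (F' (G y))" if "y \<in> T" for y
    proof -
      have "G y \<in> U"
        using GT that by blast
      then show ?thesis
        by (rule has_derivative_linear[OF F'])
    qed
    show "linear (G' y)" if "y \<in> T" for y
      using G'[OF that] by (rule has_derivative_linear)
    show "Ck k UNIV T (\<lambda>y. F' (G y) w)" for w
      by (rule Ck_compose[OF _ _ _ _ GT Suc F]) (simp_all add: \<open>open T\<close>)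
  qed
  moreover have "\<forall>y\<in>T. (G has_derivative G' y) (at y within T)"
    using G' has_derivative_at_withinI by blast
  ultimately show ?case
    by auto
qed

lemma smooth_local_inverse_UNIV:
  fixes F :: "'a::euclidean_space \<Rightarrow> 'a"
  assumes "open U" and x0: "x0 \<in> U" and F: "\<And>k. Ck k UNIV U F"
    and D: "(F has_derivative (\<lambda>v. v)) (at x0)"
  obtains U1 T G where "open U1" "x0 \<in> U1" "U1 \<subseteq> U" "open T" "homeomorphism U1 T F G"
    "\<And>k. Ck k UNIV T G"
proof -
  have "Ck (Suc 0) UNIV U F"
    by (rule F)
  then obtain F' where "\<forall>x\<in>U. (F has_derivative F' x) (at x within U)"
    by (simp only: Ck.simps) blast
  then have F': "\<And>x. x \<in> U \<Longrightarrow> (F has_derivative F' x) (at x)"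
    using at_within_open[OF _ \<open>open U\<close>] by simp
  have F'k: "Ck k UNIV U (\<lambda>x. F' x v)" for k v
  proof -
    obtain f' where f': "\<forall>x\<in>U. (F has_derivative f' x) (at x within U)"
      "\<forall>v\<in>UNIV. Ck k UNIV U (\<lambda>x. f' x v)"
      using F[of "Suc k"] by auto
    have "f' x = F' x" if "x \<in> U" for x
      using f'(1) F'[OF that] at_within_open[OF that \<open>open U\<close>] that by (metis has_derivative_unique)
    then have "f' x v = F' x v" if "x \<in> U" for x
      using that by simp
    moreover have "Ck k UNIV U (\<lambda>x. f' x v)"
      using f'(2) by blast
    ultimately show ?thesis
      by (rule Ck_cong)
  qed
  let ?f' = "\<lambda>x. Blinfun (F' x)"
  have bl: "bounded_linear (F' x)" if "x \<in> U" for x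
    using F'[OF that] by (rule has_derivative_bounded_linear)
  have app: "blinfun_apply (?f' x) = F' x" if "x \<in> U" for x
    using bl[OF that] by (rule bounded_linear_Blinfun_apply)
  have "continuous_on U (\<lambda>x. blinfun_of_matrix (\<lambda>i j. F' x j \<bullet> i))"
    using F'k[of 0] by (auto intro!: continuous_intros)
  then have contU: "continuous_on U ?f'"
    by (rule continuous_on_eq) (simp add: Blinfun_eq_matrix bl)
  have "F' x0 = (\<lambda>v. v)"
    using F'[OF x0] D has_derivative_unique by blast
  then have f'0: "?f' x0 = id_blinfun"
    using app[OF x0] by (intro blinfun_eqI) simp
  \<comment> \<open>At distance at most 1/2 from the identity, the inverses of the derivatives have norm at most 2.\<close>
  define N where "N = U \<inter> ?f' -` ball id_blinfun (1/2)"
  have "open N"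
    unfolding N_def using contU \<open>open U\<close> by (intro continuous_open_preimage) auto
  have x0N: "x0 \<in> N"
    using x0 f'0 by (simp add: N_def)
  have NU: "N \<subseteq> U"
    by (auto simp: N_def)
  obtain U1 T G G' where G: "open U1" "U1 \<subseteq> N" "x0 \<in> U1" "open T" "F x0 \<in> T" "homeomorphism U1 T F G"
      "\<And>y. y \<in> T \<Longrightarrow> (G has_derivative (G' y)) (at y)"
      "\<And>y. y \<in> T \<Longrightarrow> G' y = inv (blinfun_apply (?f' (G y)))"
      "\<And>y. y \<in> T \<Longrightarrow> bij (blinfun_apply (?f' (G y)))"
  proof (rule inverse_function_theorem[of N F ?f' x0 id_blinfun])
    show "(F has_derivative blinfun_apply (?f' x)) (at x)" if "x \<in> N" for x
      using F' app that NU by auto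
    show "continuous_on N ?f'"
      using contU NU continuous_on_subset by blast
    show "id_blinfun o\<^sub>L ?f' x0 = id_blinfun"
      by (intro blinfun_eqI) (simp add: f'0)
  qed (use \<open>open N\<close> x0N in auto)
  have GN: "G ` T \<subseteq> N"
    using G(2,6) by (auto simp: homeomorphism_def)
  have "Ck k UNIV T G" for k
  proof (rule Ck_inverse[OF \<open>open U\<close> \<open>open T\<close> _ F' G(7) _ _ _ F'k])
    show "G ` T \<subseteq> U"
      using GN NU by blast
    fix y w assume y: "y \<in> T"
    have GyN: "G y \<in> N" and Gy: "G y \<in> U"
      using GN NU y by auto
    show i1: "G' y (F' (G y) w) = w"
      using G(8,9)[OF y] app[OF Gy] by (simp add: bij_is_inj inv_f_f)
    show i2: "F' (G y) (G' y w) = w"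
      using G(8,9)[OF y] app[OF Gy] by (simp add: bij_is_surj surj_f_inv_f)
    have "norm (?f' (G y) - id_blinfun) \<le> 1/2"
      using GyN by (simp add: N_def dist_norm norm_minus_commute)
    then have "norm (F' (G y) u - u) \<le> 1/2 * norm u" for u
      using norm_blinfun[of "?f' (G y) - id_blinfun" u] app[OF Gy]
        mult_right_mono[of "norm (?f' (G y) - id_blinfun)" "1/2" "norm u"]
      by (simp add: blinfun.diff_left)
    then have "norm (w - G' y w) \<le> 1/2 * norm (G' y w)"
      using i2 by metis
    then show "norm (G' y w) \<le> 2 * norm w"
      using norm_triangle_ineq2[of "G' y w" w] by (simp add: norm_minus_commute)
  qed
  then show ?thesis
    using that[of U1 T G] G NU by blast
qed

text \<open>Extend \<open>h\<close> from \<open>V\<close> to the whole space by the identity in the directions complementary to \<open>V\<close>: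
  the map \<open>z \<mapsto> h (\<pi> z) + (z - \<pi> z)\<close> maps exactly the points of \<open>V\<close> into \<open>V\<close>, so its local inverse
  restricts to one of \<open>h\<close>.\<close>

lemma smooth_local_inverse:
  fixes h :: "'a::euclidean_space \<Rightarrow> 'a"
  assumes V: "subspace V" and U: "openin (top_of_set V) U" and x0: "x0 \<in> U"
    and h: "smooth_on V U h" "h ` U \<subseteq> V"
    and D: "(h has_derivative D) (at x0 within U)" "\<And>v. v \<in> V \<Longrightarrow> D v = v"
  obtains U1 g where "openin (top_of_set V) U1" "x0 \<in> U1" "U1 \<subseteq> U"
    "openin (top_of_set V) (h ` U1)" "smooth_on V (h ` U1) g" "\<And>x. x \<in> U1 \<Longrightarrow> g (h x) = x"
proof -
  obtain \<pi> where \<pi>: "bounded_linear \<pi>" "\<And>v. v \<in> V \<Longrightarrow> \<pi> v = v" "\<And>x. \<pi> x \<in> V"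
    using subspace_projection[OF V] by metis
  obtain W where W: "open W" "U = V \<inter> W"
    using U by (auto simp: openin_open)
  let ?U = "\<pi> -` W"
  let ?F = "\<lambda>z. h (\<pi> z) + (z - \<pi> z)"
  have opU: "open ?U"
    using W(1) \<pi>(1) by (intro continuous_open_vimage linear_continuous_on) 
      (auto simp: linear_continuous_at)
  have \<pi>U: "\<pi> ` ?U \<subseteq> U"
    using \<pi>(3) W(2) by auto
  have h\<pi>: "Ck k UNIV ?U (\<lambda>z. h (\<pi> z))" for k
  proof (rule Ck_compose[OF _ _ V _ \<pi>U])
    show "Ck k V U h"
      using h(1) by (simp add: smooth_on_def)
  qed (use W(2) opU in \<open>auto intro: Ck_linear \<pi>(1)\<close>)
  have "Ck k UNIV ?U ?F" for k
    by (rule Ck_add[OF h\<pi> Ck_diff[OF Ck_ident Ck_linear[OF \<pi>(1)]]])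
  moreover have x0U: "x0 \<in> ?U" and \<pi>x0: "\<pi> x0 = x0" and x0V: "x0 \<in> V"
    using x0 W(2) \<pi>(2) by auto
  moreover have "(?F has_derivative (\<lambda>v. v)) (at x0)"
  proof -
    have "(h has_derivative D) (at (\<pi> x0) within \<pi> ` ?U)"
      using has_derivative_subset[OF D(1) \<pi>U] \<pi>x0 by simp
    then have "(h \<circ> \<pi> has_derivative D \<circ> \<pi>) (at x0 within ?U)"
      by (intro diff_chain_within bounded_linear_imp_has_derivative \<pi>(1))
    then have "((\<lambda>z. h (\<pi> z)) has_derivative (\<lambda>v. D (\<pi> v))) (at x0)"
      using at_within_open[OF x0U opU] by (simp add: o_def)
    then have "(?F has_derivative (\<lambda>v. D (\<pi> v) + (v - \<pi> v))) (at x0)"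
      by (intro has_derivative_add has_derivative_diff has_derivative_ident
          bounded_linear_imp_has_derivative \<pi>(1))
    then show ?thesis
      using D(2) \<pi>(3) by simp
  qed
  ultimately obtain U1 T G where G: "open U1" "x0 \<in> U1" "U1 \<subseteq> ?U" "open T" "homeomorphism U1 T ?F G"
    "\<And>k. Ck k UNIV T G"
    using smooth_local_inverse_UNIV[OF opU, of x0 ?F] by blast
  have Fh: "?F z = h z" if "z \<in> V" for z
    using \<pi>(2)[OF that] by simp
  have im: "h ` (U1 \<inter> V) = T \<inter> V"
  proof
    show "h ` (U1 \<inter> V) \<subseteq> T \<inter> V"
    proof
      fix y assume "y \<in> h ` (U1 \<inter> V)"
      then obtain z where z: "z \<in> U1" "z \<in> V" "y = h z"
        by auto
      have "z \<in> U"
        using z G(3) W(2) \<pi>(2) by auto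
      moreover have "?F z \<in> T"
        using G(5) z(1) by (auto simp: homeomorphism_def)
      ultimately show "y \<in> T \<inter> V"
        using z Fh h(2) by auto
    qed
    show "T \<inter> V \<subseteq> h ` (U1 \<inter> V)"
    proof
      fix y assume y: "y \<in> T \<inter> V"
      let ?z = "G y"
      have z: "?z \<in> U1" "?F ?z = y"
        using G(5) y by (auto simp: homeomorphism_def)
      have "h (\<pi> ?z) \<in> V"
        using h(2) \<pi>U z(1) G(3) by blast
      then have "y - h (\<pi> ?z) + \<pi> ?z \<in> V"
        using y \<pi>(3) V by (intro subspace_add subspace_diff) auto
      moreover have "y - h (\<pi> ?z) + \<pi> ?z = ?z"
        using z(2) by (simp add: algebra_simps)
      ultimately have "?z \<in> V"
        by simp
      then show "y \<in> h ` (U1 \<inter> V)"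
        using z Fh by (intro image_eqI[of _ _ ?z]) auto
    qed
  qed
  show ?thesis
  proof (rule that[of "U1 \<inter> V" G])
    show "openin (top_of_set V) (U1 \<inter> V)"
      using G(1) by (auto simp: openin_open)
    show "openin (top_of_set V) (h ` (U1 \<inter> V))"
      unfolding im using G(4) by (auto simp: openin_open)
    show "smooth_on V (h ` (U1 \<inter> V)) G"
      unfolding im smooth_on_def using G(6) Ck_subset by blast
    show "U1 \<inter> V \<subseteq> U"
      using G(3) W(2) \<pi>(2) by auto
    show "G (h x) = x" if "x \<in> U1 \<inter> V" for x
      using that G(5) Fh[of x] by (auto simp: homeomorphism_def)
  qed (use G(2) x0V in auto)
qed

section \<open>Smooth maps on open subsets of subspaces\<close>

lemma smooth_on_cong:
  "(\<And>x. x \<in> U \<Longrightarrow> f x = g x) \<Longrightarrow> smooth_on V U f \<Longrightarrow> smooth_on V U g"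
  unfolding smooth_on_def using Ck_cong by blast

lemma smooth_on_subset:
  "smooth_on V U f \<Longrightarrow> U' \<subseteq> U \<Longrightarrow> V' \<subseteq> V \<Longrightarrow> smooth_on V' U' f"
  unfolding smooth_on_def using Ck_subset by blast

lemma smooth_on_compose:
  fixes f :: "'a::euclidean_space \<Rightarrow> 'b::euclidean_space"
  assumes "subspace V" "openin (top_of_set V) U" "subspace V'" "U' \<subseteq> V'" "f ` U \<subseteq> U'"
    and "smooth_on V U f" and "smooth_on V' U' g"
  shows "smooth_on V U (\<lambda>x. g (f x))"
  using Ck_compose[OF assms(1-5)] assms(6,7) unfolding smooth_on_def by blast

lemma smooth_on_linear: "bounded_linear f \<Longrightarrow> smooth_on V U f"
  by (simp add: smooth_on_def Ck_linear)

lemma smooth_on_continuous: "smooth_on V U f \<Longrightarrow> continuous_on U f"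
  unfolding smooth_on_def by (metis Ck.simps(1))

lemma smooth_on_add: "smooth_on V U f \<Longrightarrow> smooth_on V U g \<Longrightarrow> smooth_on V U (\<lambda>x. f x + g x)"
  by (simp add: smooth_on_def Ck_add)

lemma smooth_on_diff: "smooth_on V U f \<Longrightarrow> smooth_on V U g \<Longrightarrow> smooth_on V U (\<lambda>x. f x - g x)"
  by (simp add: smooth_on_def Ck_diff)

lemma smooth_on_Pair: "smooth_on V U f \<Longrightarrow> smooth_on V U g \<Longrightarrow> smooth_on V U (\<lambda>x. (f x, g x))"
  by (simp add: smooth_on_def Ck_Pair)

lemma smooth_on_linear_comp:
  "bounded_linear L \<Longrightarrow> smooth_on V U f \<Longrightarrow> smooth_on V U (\<lambda>x. L (f x))"
  by (simp add: smooth_on_def Ck_linear_comp)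

lemma smooth_on_const: "smooth_on V U (\<lambda>x. c)"
  by (simp add: smooth_on_def Ck_const)

lemma smooth_on_ident: "smooth_on V U (\<lambda>x. x)"
  by (simp add: smooth_on_def Ck_ident)

lemma openin_preimage_subspace:
  assumes "openin (top_of_set V) U" "continuous_on U f" "f ` U \<subseteq> V'" "openin (top_of_set V') W"
  shows "openin (top_of_set V) {u \<in> U. f u \<in> W}"
proof -
  obtain Z where Z: "open Z" "W = V' \<inter> Z"
    using assms(4) by (auto simp: openin_open)
  have "openin (top_of_set U) (U \<inter> f -` Z)"
    using assms(2) Z(1) continuous_openin_preimage_gen by blast
  moreover have "U \<inter> f -` Z = {u \<in> U. f u \<in> W}"
    using assms(3) Z(2) by auto
  ultimately show ?thesis
    using assms(1) openin_trans by fastforce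
qed

section \<open>Charts\<close>

text \<open>This form speaks of open sets only, without subspace topologies on the chart domain and its
  image; new charts are verified through it.\<close>

lemma chart_on_iff:
  "chart_on T c \<longleftrightarrow>
     openin T (chart_dom c) \<and> subspace (chart_model c) \<and>
     inj_on (coord c) (chart_dom c) \<and> coord c ` chart_dom c \<subseteq> chart_model c \<and>
     (\<forall>A. openin T A \<longrightarrow> A \<subseteq> chart_dom c \<longrightarrow> openin (top_of_set (chart_model c)) (coord c ` A)) \<and>
     (\<forall>W. openin (top_of_set (chart_model c)) W \<longrightarrow> openin T {x \<in> chart_dom c. coord c x \<in> W})"
  (is "?L \<longleftrightarrow> ?R")
proof
  let ?D = "chart_dom c" and ?V = "chart_model c"
  let ?X = "subtopology T ?D" and ?Y = "top_of_set (coord c ` ?D)"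
  assume L: ?L
  then have D: "openin T ?D" "subspace ?V" "openin (top_of_set ?V) (coord c ` ?D)"
    and h: "homeomorphic_map ?X ?Y (coord c)"
    by (auto simp: chart_on_def)
  have ts: "topspace ?X = ?D"
    using D(1) openin_subset by fastforce
  have cV: "coord c ` ?D \<subseteq> ?V"
    using D(3) openin_imp_subset by blast
  have "openin (top_of_set ?V) (coord c ` A)" if "openin T A" "A \<subseteq> ?D" for A
  proof -
    have "openin ?X A"
      using that openin_subset_topspace_eq by (metis inf.absorb_iff1 openin_subtopology)
    then have "openin ?Y (coord c ` A)"
      using homeomorphic_imp_open_map[OF h] by (simp add: open_map_def)
    then show ?thesis
      using D(3) openin_trans by blast
  qed
  moreover have "openin T {x \<in> ?D. coord c x \<in> W}" if W: "openin (top_of_set ?V) W" for W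
  proof -
    have "openin ?Y (coord c ` ?D \<inter> W)"
      using W cV by (auto simp: openin_open)
    from openin_continuous_map_preimage[OF homeomorphic_imp_continuous_map[OF h] this]
    have "openin ?X {x \<in> ?D. coord c x \<in> coord c ` ?D \<inter> W}"
      unfolding ts .
    moreover have "{x \<in> ?D. coord c x \<in> coord c ` ?D \<inter> W} = {x \<in> ?D. coord c x \<in> W}"
      by auto
    ultimately have "openin ?X {x \<in> ?D. coord c x \<in> W}"
      by simp
    then show ?thesis
      using D(1) openin_open_subtopology by blast
  qed
  ultimately show ?R
    using D cV homeomorphic_imp_injective_map[OF h] ts by auto
next
  let ?D = "chart_dom c" and ?V = "chart_model c"
  let ?X = "subtopology T ?D" and ?Y = "top_of_set (coord c ` ?D)"
  assume R: ?R
  have ts: "topspace ?X = ?D"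
    using R openin_subset by fastforce
  have op: "openin (top_of_set ?V) (coord c ` ?D)"
    using R by blast
  have "homeomorphic_map ?X ?Y (coord c)"
  proof (rule bijective_open_imp_homeomorphic_map)
    show "continuous_map ?X ?Y (coord c)"
      unfolding continuous_map_def
    proof (intro conjI allI impI)
      show "coord c \<in> topspace ?X \<rightarrow> topspace ?Y"
        using ts by auto
      fix W assume "openin ?Y W"
      then have "openin (top_of_set ?V) W"
        using op openin_trans by blast
      then have "openin T {x \<in> ?D. coord c x \<in> W}"
        using R by blast
      then show "openin ?X {x \<in> topspace ?X. coord c x \<in> W}"
        using R ts openin_open_subtopology[of T ?D] by auto
    qed
    show "open_map ?X ?Y (coord c)"
      unfolding open_map_def
    proof (intro allI impI)
      fix A assume "openin ?X A"
      then have A: "openin T A" "A \<subseteq> ?D"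
        using R openin_open_subtopology[of T ?D] by auto
      then have "openin (top_of_set ?V) (coord c ` A)"
        using R by blast
      then show "openin ?Y (coord c ` A)"
        using A(2) R by (meson image_mono openin_subset_trans)
    qed
  qed (use ts R in auto)
  then show ?L
    using R op by (simp add: chart_on_def)
qed

lemma chart_onD:
  assumes "chart_on T c"
  shows "openin T (chart_dom c)" "subspace (chart_model c)" "inj_on (coord c) (chart_dom c)"
    "coord c ` chart_dom c \<subseteq> chart_model c"
    "\<And>A. openin T A \<Longrightarrow> A \<subseteq> chart_dom c \<Longrightarrow> openin (top_of_set (chart_model c)) (coord c ` A)"
    "\<And>W. openin (top_of_set (chart_model c)) W \<Longrightarrow> openin T {x \<in> chart_dom c. coord c x \<in> W}"
  using assms unfolding chart_on_iff by blast+

lemma local_rep_coord: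
  assumes "chart_on T c" "x \<in> chart_dom c"
  shows "local_rep c d f (coord c x) = coord d (f x)"
  using chart_onD(3)[OF assms(1)] assms(2) by (simp add: local_rep_def)

text \<open>The expression of \<open>f\<close> in the charts \<open>c\<close> and \<open>d\<close> is smooth on the part of the chart domain given by
  \<open>A\<close>. Having \<open>A\<close> as a parameter avoids shrinking the charts.\<close>

definition smooth_in_charts ::
  "('a, 'e::euclidean_space) chart \<Rightarrow> ('b, 'f::euclidean_space) chart \<Rightarrow> 'a set \<Rightarrow> ('a \<Rightarrow> 'b) \<Rightarrow> bool" where
  "smooth_in_charts c d A f \<longleftrightarrow> smooth_on (chart_model c) (coord c ` A) (local_rep c d f)"

lemma smooth_in_chartsI:
  assumes "chart_on T c" "A \<subseteq> chart_dom c" "smooth_on (chart_model c) (coord c ` A) F"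
    and "\<And>x. x \<in> A \<Longrightarrow> F (coord c x) = coord d (f x)"
  shows "smooth_in_charts c d A f"
  unfolding smooth_in_charts_def
proof (rule smooth_on_cong[OF _ assms(3)])
  fix u assume "u \<in> coord c ` A"
  then obtain x where "x \<in> A" "u = coord c x"
    by auto
  then show "F u = local_rep c d f u"
    using local_rep_coord[OF assms(1)] assms(2,4) by (metis subsetD)
qed

lemma smooth_in_charts_subset:
  "smooth_in_charts c d A f \<Longrightarrow> A' \<subseteq> A \<Longrightarrow> smooth_in_charts c d A' f"
  unfolding smooth_in_charts_def by (auto intro: smooth_on_subset)

text \<open>Smoothness depends on the charts only through their values on \<open>A\<close>, and passes to a smaller model
  space. This covers restrictions to open sets as well as to slices.\<close>

lemma smooth_in_charts_change:
  assumes "chart_on T c" "chart_on T' c'" "A \<subseteq> chart_dom c" "A \<subseteq> chart_dom c'"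
    and "chart_model c' \<subseteq> chart_model c"
    and "\<And>x. x \<in> A \<Longrightarrow> coord c' x = coord c x"
    and "\<And>x. x \<in> A \<Longrightarrow> coord d' (f' x) = coord d (f x)"
    and "smooth_in_charts c d A f"
  shows "smooth_in_charts c' d' A f'"
proof (rule smooth_in_chartsI[OF assms(2,4)])
  have "coord c' ` A \<subseteq> coord c ` A"
    using assms(6) by auto
  then show "smooth_on (chart_model c') (coord c' ` A) (local_rep c d f)"
    using assms(5,8) unfolding smooth_in_charts_def by (blast intro: smooth_on_subset)
  show "local_rep c d f (coord c' x) = coord d' (f' x)" if "x \<in> A" for x
    using local_rep_coord[OF assms(1)] assms(3,6,7) that by (metis subsetD)
qed

lemma smooth_in_charts_comp:
  assumes c: "chart_on T c" and d: "chart_on T' d" and A: "openin T A" "A \<subseteq> chart_dom c"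
    and f: "smooth_in_charts c d A f" and fA: "f ` A \<subseteq> B" and B: "B \<subseteq> chart_dom d"
    and g: "smooth_in_charts d e B g"
  shows "smooth_in_charts c e A (\<lambda>x. g (f x))"
proof (rule smooth_in_chartsI[OF c A(2)])
  show "smooth_on (chart_model c) (coord c ` A) (\<lambda>u. local_rep d e g (local_rep c d f u))"
  proof (rule smooth_on_compose[of "chart_model c" "coord c ` A" "chart_model d" "coord d ` B"])
    show "subspace (chart_model c)" "subspace (chart_model d)"
      using c d chart_onD by blast+
    show "openin (top_of_set (chart_model c)) (coord c ` A)"
      using chart_onD(5)[OF c A] .
    show "coord d ` B \<subseteq> chart_model d"
      using B chart_onD(4)[OF d] by blast
    show "local_rep c d f ` coord c ` A \<subseteq> coord d ` B"
      using local_rep_coord[OF c] A(2) fA by fastforce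
    show "smooth_on (chart_model c) (coord c ` A) (local_rep c d f)"
      "smooth_on (chart_model d) (coord d ` B) (local_rep d e g)"
      using f g by (simp_all add: smooth_in_charts_def)
  qed
  show "local_rep d e g (local_rep c d f (coord c x)) = coord e (g (f x))" if x: "x \<in> A" for x
  proof -
    have "x \<in> chart_dom c" "f x \<in> chart_dom d"
      using x A(2) fA B by auto
    then show ?thesis
      by (simp add: local_rep_coord[OF c] local_rep_coord[OF d])
  qed
qed

lemma smooth_in_charts_local:
  assumes c: "chart_on T c" and A: "A \<subseteq> chart_dom c"
    and loc: "\<And>x. x \<in> A \<Longrightarrow> \<exists>B. openin T B \<and> x \<in> B \<and> B \<subseteq> A \<and> smooth_in_charts c d B f"
  shows "smooth_in_charts c d A f"
  unfolding smooth_in_charts_def smooth_on_def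
proof
  fix k
  show "Ck k (chart_model c) (coord c ` A) (local_rep c d f)"
  proof (rule Ck_local)
    show "subspace (chart_model c)" "coord c ` A \<subseteq> chart_model c"
      using chart_onD(2,4)[OF c] A by auto
    fix u assume "u \<in> coord c ` A"
    then obtain x where x: "x \<in> A" "u = coord c x"
      by auto
    then obtain B where B: "openin T B" "x \<in> B" "B \<subseteq> A" "smooth_in_charts c d B f"
      using loc by blast
    then have "openin (top_of_set (chart_model c)) (coord c ` B)"
      using chart_onD(5)[OF c B(1)] A by auto
    then show "\<exists>T. openin (top_of_set (chart_model c)) T \<and> u \<in> T \<and> T \<subseteq> coord c ` A \<and>
        Ck k (chart_model c) T (local_rep c d f)"
      using B x by (intro exI[of _ "coord c ` B"]) (auto simp: smooth_in_charts_def smooth_on_def)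
  qed
qed

lemma smooth_in_charts_preimage:
  assumes c: "chart_on T c" and d: "chart_on T' d" and A: "openin T A" "A \<subseteq> chart_dom c"
    and f: "smooth_in_charts c d A f" and fA: "f ` A \<subseteq> chart_dom d" and W: "openin T' W"
  shows "openin T {x \<in> A. f x \<in> W}"
proof -
  let ?F = "local_rep c d f"
  have "openin (top_of_set (chart_model d)) (coord d ` (W \<inter> chart_dom d))"
    using W chart_onD(1,5)[OF d] by (intro chart_onD(5)[OF d]) auto
  then obtain Z where Z: "open Z" "coord d ` (W \<inter> chart_dom d) = chart_model d \<inter> Z"
    by (auto simp: openin_open)
  have cA: "openin (top_of_set (chart_model c)) (coord c ` A)"
    using chart_onD(5)[OF c A] .
  have "continuous_on (coord c ` A) ?F"
    using f smooth_on_continuous unfolding smooth_in_charts_def by blast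
  then have "openin (top_of_set (coord c ` A)) (coord c ` A \<inter> ?F -` Z)"
    using Z(1) continuous_openin_preimage_gen by blast
  then have "openin (top_of_set (chart_model c)) (coord c ` A \<inter> ?F -` Z)"
    using cA openin_trans by blast
  then have "openin T {x \<in> chart_dom c. coord c x \<in> coord c ` A \<inter> ?F -` Z}"
    by (rule chart_onD(6)[OF c])
  moreover have "{x \<in> chart_dom c. coord c x \<in> coord c ` A \<inter> ?F -` Z} = {x \<in> A. f x \<in> W}"
  proof -
    have "coord d (f x) \<in> Z \<longleftrightarrow> f x \<in> W" if "x \<in> A" for x
    proof -
      have fx: "f x \<in> chart_dom d"
        using fA that by auto
      then have "coord d (f x) \<in> Z \<longleftrightarrow> coord d (f x) \<in> coord d ` (W \<inter> chart_dom d)"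
        using Z(2) chart_onD(4)[OF d] by auto
      also have "\<dots> \<longleftrightarrow> f x \<in> W"
        using fx chart_onD(3)[OF d] by (auto dest: inj_onD)
      finally show ?thesis .
    qed
    moreover have "coord c x \<in> coord c ` A \<longleftrightarrow> x \<in> A" if "x \<in> chart_dom c" for x
      using that A(2) chart_onD(3)[OF c] by (auto dest: inj_onD)
    moreover have "?F (coord c x) = coord d (f x)" if "x \<in> A" for x
      using that A(2) local_rep_coord[OF c] by blast
    ultimately have "coord c x \<in> coord c ` A \<inter> ?F -` Z \<longleftrightarrow> x \<in> A \<and> f x \<in> W"
      if "x \<in> chart_dom c" for x
      using that by (metis (lifting) Int_iff vimage_eq)
    then show ?thesis
      using A(2) by blast
  qed
  ultimately show ?thesis
    by simp
qed

lemma compatible_iff: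
  "compatible c d \<longleftrightarrow> smooth_in_charts c d (chart_dom c \<inter> chart_dom d) (\<lambda>x. x) \<and>
    smooth_in_charts d c (chart_dom d \<inter> chart_dom c) (\<lambda>x. x)"
  by (simp add: compatible_def smooth_in_charts_def id_def Int_commute)

text \<open>A manifold up to the constancy of the dimension. Products and embedded subsets are of this kind
  without any dimension count.\<close>

definition charted :: "('a, 'e::euclidean_space) mfd \<Rightarrow> bool" where
  "charted M \<longleftrightarrow>
     (\<forall>c\<in>atlas M. chart_on (mtop M) c) \<and>
     (\<Union>c\<in>atlas M. chart_dom c) = pts M \<and>
     (\<forall>c\<in>atlas M. \<forall>d\<in>atlas M. compatible c d)"

lemma manifold_charted: "manifold M \<Longrightarrow> charted M"
  by (simp add: manifold_def charted_def)

lemma charts_chart_on: "c \<in> charts M \<Longrightarrow> chart_on (mtop M) c"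
  by (simp add: charts_def)

lemma atlas_charts: "charted M \<Longrightarrow> c \<in> atlas M \<Longrightarrow> c \<in> charts M"
  by (simp add: charted_def charts_def)

lemma chart_dom_pts: "c \<in> charts M \<Longrightarrow> chart_dom c \<subseteq> pts M"
  using charts_chart_on chart_onD(1) openin_subset by metis

lemma chart_at:
  assumes "charted M" "p \<in> pts M"
  obtains c where "c \<in> atlas M" "c \<in> charts M" "p \<in> chart_dom c"
  using assms atlas_charts[OF assms(1)] unfolding charted_def by blast

text \<open>Near each point the change of charts factors through a chart of the defining atlas.\<close>

lemma smooth_in_charts_transition:
  assumes M: "charted M" and c: "c \<in> charts M" and d: "d \<in> charts M"
  shows "smooth_in_charts c d (chart_dom c \<inter> chart_dom d) (\<lambda>x. x)"
proof (rule smooth_in_charts_local[OF charts_chart_on[OF c]])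
  fix x assume x: "x \<in> chart_dom c \<inter> chart_dom d"
  then obtain e where e: "e \<in> atlas M" "e \<in> charts M" "x \<in> chart_dom e"
    using chart_dom_pts[OF c] by (meson IntD1 M chart_at subsetD)
  let ?A = "chart_dom c \<inter> chart_dom d \<inter> chart_dom e"
  have op: "openin (mtop M) ?A"
    using c d e(2) charts_chart_on chart_onD(1) by blast
  have ce: "smooth_in_charts c e ?A (\<lambda>x. x)"
    using c e(1) by (auto simp: charts_def compatible_iff intro: smooth_in_charts_subset)
  have ed: "smooth_in_charts e d ?A (\<lambda>x. x)"
    using d e(1) by (auto simp: charts_def compatible_iff intro: smooth_in_charts_subset)
  have "smooth_in_charts c d ?A (\<lambda>x. x)"
    by (rule smooth_in_charts_comp[OF charts_chart_on[OF c] charts_chart_on[OF e(2)] op _ ce _ _ ed])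
      auto
  then show "\<exists>B. openin (mtop M) B \<and> x \<in> B \<and> B \<subseteq> chart_dom c \<inter> chart_dom d \<and>
      smooth_in_charts c d B (\<lambda>x. x)"
    using op x e(3) by blast
qed auto

lemma chart_on_restrict:
  assumes "chart_on T c" "openin T A"
  shows "chart_on T (c\<lparr>chart_dom := chart_dom c \<inter> A\<rparr>)"
proof -
  have "openin T {x \<in> chart_dom c \<inter> A. coord c x \<in> W}" if "openin (top_of_set (chart_model c)) W" for W
  proof -
    have "openin T ({x \<in> chart_dom c. coord c x \<in> W} \<inter> A)"
      using chart_onD(6)[OF assms(1) that] assms(2) by blast
    then show ?thesis
      by (rule back_subst[of "openin T"]) auto
  qed
  then show ?thesis
    using chart_onD[OF assms(1)] assms(2) unfolding chart_on_iff
    by (auto intro: inj_on_subset)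
qed

lemma charts_restrict:
  assumes c: "c \<in> charts M" and A: "openin (mtop M) A"
  shows "c\<lparr>chart_dom := chart_dom c \<inter> A\<rparr> \<in> charts M"
proof -
  let ?c = "c\<lparr>chart_dom := chart_dom c \<inter> A\<rparr>"
  have on: "chart_on (mtop M) ?c"
    using chart_on_restrict[OF charts_chart_on[OF c] A] .
  have "compatible ?c d" if d: "d \<in> atlas M" for d
  proof -
    have cd: "compatible c d"
      using c d by (simp add: charts_def)
    have 1: "smooth_in_charts c d (chart_dom ?c \<inter> chart_dom d) (\<lambda>x. x)"
      using cd by (auto simp: compatible_iff intro: smooth_in_charts_subset)
    have "smooth_in_charts ?c d (chart_dom ?c \<inter> chart_dom d) (\<lambda>x. x)"
      by (rule smooth_in_charts_change[OF charts_chart_on[OF c] on _ _ _ _ _ 1]) auto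
    moreover have "smooth_in_charts d ?c (chart_dom d \<inter> chart_dom ?c) (\<lambda>x. x)"
    proof -
      have "smooth_in_charts d c (chart_dom d \<inter> chart_dom ?c) (\<lambda>x. x)"
        using cd by (auto simp: compatible_iff intro: smooth_in_charts_subset)
      moreover have "local_rep d ?c (\<lambda>x. x) = local_rep d c (\<lambda>x. x)"
        by (simp add: local_rep_def)
      ultimately show ?thesis
        by (simp add: smooth_in_charts_def)
    qed
    ultimately show ?thesis
      by (simp add: compatible_iff)
  qed
  then show ?thesis
    using on by (simp add: charts_def)
qed

section \<open>Smoothness at a point\<close>

definition smooth_at ::
  "('a, 'e::euclidean_space) mfd \<Rightarrow> ('b, 'f::euclidean_space) mfd \<Rightarrow> ('a \<Rightarrow> 'b) \<Rightarrow> 'a \<Rightarrow> bool" where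
  "smooth_at M N f p \<longleftrightarrow> (\<exists>c\<in>charts M. \<exists>d\<in>charts N. \<exists>A. openin (mtop M) A \<and> p \<in> A \<and>
     A \<subseteq> chart_dom c \<and> f ` A \<subseteq> chart_dom d \<and> smooth_in_charts c d A f)"

lemma smooth_map_iff:
  "smooth_map M N f \<longleftrightarrow> f ` pts M \<subseteq> pts N \<and> (\<forall>p\<in>pts M. smooth_at M N f p)"
proof -
  have "(\<exists>c\<in>charts M. \<exists>d\<in>charts N. p \<in> chart_dom c \<and> f ` chart_dom c \<subseteq> chart_dom d \<and>
      smooth_on (chart_model c) (coord c ` chart_dom c) (local_rep c d f)) \<longleftrightarrow> smooth_at M N f p"
    (is "?L \<longleftrightarrow> ?R") for p
  proof
    assume ?L
    then show ?R
      unfolding smooth_at_def smooth_in_charts_def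
      by (meson chart_onD(1) charts_chart_on order_refl)
  next
    assume ?R
    then obtain c d A where c: "c \<in> charts M" "d \<in> charts N" "openin (mtop M) A" "p \<in> A"
      "A \<subseteq> chart_dom c" "f ` A \<subseteq> chart_dom d" "smooth_in_charts c d A f"
      by (auto simp: smooth_at_def)
    let ?c = "c\<lparr>chart_dom := chart_dom c \<inter> A\<rparr>"
    have c': "?c \<in> charts M"
      using charts_restrict c by blast
    have "smooth_in_charts ?c d A f"
      by (rule smooth_in_charts_change[OF charts_chart_on[OF c(1)] charts_chart_on[OF c'] c(5) _ _ _ _ c(7)])
        (use c in auto)
    moreover have "chart_dom ?c = A"
      using c(5) by auto
    ultimately show ?L
      using c c' by (intro bexI[OF _ c'] bexI[OF _ c(2)]) (simp add: smooth_in_charts_def)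
  qed
  then show ?thesis
    by (simp add: smooth_map_def)
qed

lemma smooth_mapD:
  assumes "smooth_map M N f" "p \<in> pts M"
  shows "smooth_at M N f p" "f p \<in> pts N"
  using assms by (auto simp: smooth_map_iff)

lemma smooth_at_pts:
  assumes "smooth_at M N f p"
  shows "p \<in> pts M" "f p \<in> pts N"
  using assms chart_dom_pts unfolding smooth_at_def by blast+

text \<open>The charts that witness smoothness may be replaced by any given ones.\<close>

lemma smooth_at_in_charts:
  assumes M: "charted M" and N: "charted N" and f: "smooth_at M N f p"
    and c: "c \<in> charts M" "p \<in> chart_dom c" and d: "d \<in> charts N" "f p \<in> chart_dom d"
  obtains A where "openin (mtop M) A" "p \<in> A" "A \<subseteq> chart_dom c" "f ` A \<subseteq> chart_dom d"
    "smooth_in_charts c d A f"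
proof -
  obtain c0 d0 A0 where 0: "c0 \<in> charts M" "d0 \<in> charts N" "openin (mtop M) A0" "p \<in> A0"
      "A0 \<subseteq> chart_dom c0" "f ` A0 \<subseteq> chart_dom d0" "smooth_in_charts c0 d0 A0 f"
    using f by (auto simp: smooth_at_def)
  note on = charts_chart_on[OF c(1)] charts_chart_on[OF d(1)] charts_chart_on[OF 0(1)]
    charts_chart_on[OF 0(2)]
  let ?A = "{x \<in> A0. f x \<in> chart_dom d} \<inter> chart_dom c"
  have "openin (mtop M) {x \<in> A0. f x \<in> chart_dom d}"
    using smooth_in_charts_preimage[OF on(3,4) 0(3,5,7,6) chart_onD(1)[OF on(2)]] .
  then have op: "openin (mtop M) ?A"
    using chart_onD(1)[OF on(1)] by blast
  have 1: "smooth_in_charts c c0 ?A (\<lambda>x. x)"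
    using smooth_in_charts_transition[OF M c(1) 0(1)] by (rule smooth_in_charts_subset) (use 0(5) in auto)
  have 2: "smooth_in_charts c d0 ?A f"
    by (rule smooth_in_charts_comp[OF on(1,3) op _ 1 _ 0(5,7)]) auto
  have 3: "smooth_in_charts d0 d (chart_dom d0 \<inter> chart_dom d) (\<lambda>x. x)"
    using smooth_in_charts_transition[OF N 0(2) d(1)] .
  have "smooth_in_charts c d ?A f"
    by (rule smooth_in_charts_comp[OF on(1,4) op _ 2 _ _ 3]) (use 0(6) in auto)
  then show ?thesis
    using that[of ?A] op 0(4) c(2) d(2) by blast
qed

lemma smooth_at_comp:
  assumes M: "charted M" and N: "charted N"
    and f: "smooth_at M N f p" and g: "smooth_at N L g (f p)"
  shows "smooth_at M L (\<lambda>x. g (f x)) p"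
proof -
  obtain d e B where g': "d \<in> charts N" "e \<in> charts L" "openin (mtop N) B" "f p \<in> B"
      "B \<subseteq> chart_dom d" "g ` B \<subseteq> chart_dom e" "smooth_in_charts d e B g"
    using g by (auto simp: smooth_at_def)
  obtain c where c: "c \<in> charts M" "p \<in> chart_dom c"
    using f by (auto simp: smooth_at_def)
  have "f p \<in> chart_dom d"
    using g' by auto
  then obtain A where A: "openin (mtop M) A" "p \<in> A" "A \<subseteq> chart_dom c" "f ` A \<subseteq> chart_dom d"
    "smooth_in_charts c d A f"
    using smooth_at_in_charts[OF M N f c g'(1)] by blast
  note on = charts_chart_on[OF c(1)] charts_chart_on[OF g'(1)]
  let ?A = "{x \<in> A. f x \<in> B}"
  have op: "openin (mtop M) ?A"
    using smooth_in_charts_preimage[OF on A(1,3,5,4) g'(3)] .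
  have cd: "smooth_in_charts c d ?A f"
    using A(5) by (rule smooth_in_charts_subset) auto
  have "smooth_in_charts c e ?A (\<lambda>x. g (f x))"
    by (rule smooth_in_charts_comp[OF on op _ cd _ g'(5,7)]) (use A(3) in auto)
  moreover have "p \<in> ?A" "?A \<subseteq> chart_dom c" "(\<lambda>x. g (f x)) ` ?A \<subseteq> chart_dom e"
    using A g' by auto
  ultimately show ?thesis
    unfolding smooth_at_def using c(1) g'(2) op by blast
qed

lemma smooth_at_cong:
  assumes f: "smooth_at M N f p" and B: "openin (mtop M) B" "p \<in> B" "\<And>x. x \<in> B \<Longrightarrow> f x = g x"
  shows "smooth_at M N g p"
proof -
  obtain c d A where c: "c \<in> charts M" "d \<in> charts N" "openin (mtop M) A" "p \<in> A"
      "A \<subseteq> chart_dom c" "f ` A \<subseteq> chart_dom d" "smooth_in_charts c d A f"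
    using f by (auto simp: smooth_at_def)
  have "smooth_in_charts c d (A \<inter> B) f"
    using c(7) by (rule smooth_in_charts_subset) auto
  then have "smooth_in_charts c d (A \<inter> B) g"
    using c(5) B(3) by (intro smooth_in_charts_change[OF charts_chart_on[OF c(1)] charts_chart_on[OF c(1)], of "A \<inter> B" d g d f]) auto
  moreover have "openin (mtop M) (A \<inter> B)" "p \<in> A \<inter> B" "A \<inter> B \<subseteq> chart_dom c"
    "g ` (A \<inter> B) \<subseteq> chart_dom d"
    using c B by force+
  ultimately show ?thesis
    unfolding smooth_at_def using c(1,2) by blast
qed

lemma smooth_map_preimage:
  assumes f: "smooth_map M N f" and W: "openin (mtop N) W"
  shows "openin (mtop M) {x \<in> pts M. f x \<in> W}"
proof (subst openin_subopen, intro ballI)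
  fix p assume p: "p \<in> {x \<in> pts M. f x \<in> W}"
  then obtain c d A where c: "c \<in> charts M" "d \<in> charts N" "openin (mtop M) A" "p \<in> A"
      "A \<subseteq> chart_dom c" "f ` A \<subseteq> chart_dom d" "smooth_in_charts c d A f"
    using smooth_mapD(1)[OF f, of p] by (auto simp: smooth_at_def)
  have "openin (mtop M) {x \<in> A. f x \<in> W}"
    using smooth_in_charts_preimage[OF charts_chart_on[OF c(1)] charts_chart_on[OF c(2)] c(3,5,7,6) W] .
  moreover have "{x \<in> A. f x \<in> W} \<subseteq> {x \<in> pts M. f x \<in> W}"
    using c(3) openin_subset by blast
  ultimately show "\<exists>T. openin (mtop M) T \<and> p \<in> T \<and> T \<subseteq> {x \<in> pts M. f x \<in> W}"
    using c(4) p by (intro exI[of _ "{x \<in> A. f x \<in> W}"]) auto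
qed

section \<open>New charts from old\<close>

text \<open>To belong to the maximal atlas, it suffices to be related smoothly near each point to one chart
  of that atlas.\<close>

lemma charts_if_locally_smooth:
  assumes on: "chart_on (mtop M) c'" and atl: "\<And>e. e \<in> atlas M \<Longrightarrow> chart_on (mtop M) e"
    and loc: "\<And>x. x \<in> chart_dom c' \<Longrightarrow> \<exists>c\<in>charts M. \<exists>A. openin (mtop M) A \<and> x \<in> A \<and>
      A \<subseteq> chart_dom c \<and> A \<subseteq> chart_dom c' \<and>
      smooth_in_charts c' c A (\<lambda>x. x) \<and> smooth_in_charts c c' A (\<lambda>x. x)"
  shows "c' \<in> charts M"
proof -
  have "compatible c' e" if e: "e \<in> atlas M" for e
  proof -
    have eon: "chart_on (mtop M) e"
      using atl[OF e] .
    have key: "\<exists>A. openin (mtop M) A \<and> x \<in> A \<and> A \<subseteq> chart_dom c' \<inter> chart_dom e \<and>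
        smooth_in_charts c' e A (\<lambda>x. x) \<and> smooth_in_charts e c' A (\<lambda>x. x)"
      if x: "x \<in> chart_dom c'" "x \<in> chart_dom e" for x
    proof -
      obtain c A where c: "c \<in> charts M" and A: "openin (mtop M) A" "x \<in> A" "A \<subseteq> chart_dom c"
        "A \<subseteq> chart_dom c'" and s: "smooth_in_charts c' c A (\<lambda>x. x)" "smooth_in_charts c c' A (\<lambda>x. x)"
        using loc[OF x(1)] by blast
      have con: "chart_on (mtop M) c"
        using c by (rule charts_chart_on)
      let ?A = "A \<inter> chart_dom e"
      have op: "openin (mtop M) ?A"
        using A(1) chart_onD(1)[OF eon] by blast
      have ce: "smooth_in_charts c e (chart_dom c \<inter> chart_dom e) (\<lambda>x. x)"
        "smooth_in_charts e c (chart_dom e \<inter> chart_dom c) (\<lambda>x. x)"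
        using c e by (auto simp: charts_def compatible_iff)
      have 1: "smooth_in_charts c' c ?A (\<lambda>x. x)" "smooth_in_charts e c ?A (\<lambda>x. x)"
        using s(1) ce(2) A(3) by (auto intro: smooth_in_charts_subset)
      have "smooth_in_charts c' e ?A (\<lambda>x. x)"
        by (rule smooth_in_charts_comp[OF on con op _ 1(1) _ _ ce(1)]) (use A in auto)
      moreover have "smooth_in_charts e c' ?A (\<lambda>x. x)"
        by (rule smooth_in_charts_comp[OF eon con op _ 1(2) _ _ s(2)]) (use A in auto)
      ultimately show ?thesis
        using op A x by (intro exI[of _ ?A]) auto
    qed
    have "smooth_in_charts c' e (chart_dom c' \<inter> chart_dom e) (\<lambda>x. x)"
      by (rule smooth_in_charts_local[OF on]) (use key in blast)+
    moreover have "smooth_in_charts e c' (chart_dom e \<inter> chart_dom c') (\<lambda>x. x)"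
      unfolding Int_commute[of "chart_dom e"]
      by (rule smooth_in_charts_local[OF eon]) (use key in blast)+
    ultimately show ?thesis
      by (simp add: compatible_iff)
  qed
  then show ?thesis
    using on by (simp add: charts_def)
qed

text \<open>A chart followed by a diffeomorphism between open subsets of its model space is again a chart.\<close>

lemma charts_postcompose:
  assumes M: "charted M" and c: "c \<in> charts M"
    and \<psi>: "smooth_on (chart_model c) (coord c ` chart_dom c) \<psi>"
    and op: "openin (top_of_set (chart_model c)) (\<psi> ` coord c ` chart_dom c)"
    and \<psi>': "smooth_on (chart_model c) (\<psi> ` coord c ` chart_dom c) \<psi>'"
    and inv: "\<And>u. u \<in> coord c ` chart_dom c \<Longrightarrow> \<psi>' (\<psi> u) = u"
  shows "c\<lparr>coord := \<psi> \<circ> coord c\<rparr> \<in> charts M"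
proof -
  let ?c = "c\<lparr>coord := \<psi> \<circ> coord c\<rparr>" and ?D = "chart_dom c" and ?V = "chart_model c"
  let ?U = "coord c ` ?D"
  have con: "chart_on (mtop M) c"
    using c by (rule charts_chart_on)
  note D = chart_onD[OF con]
  have \<psi>V: "\<psi> ` ?U \<subseteq> ?V"
    using op openin_imp_subset by blast
  have opU: "openin (top_of_set ?V) ?U"
    using D(1,5) by blast
  have inj: "inj_on \<psi> ?U"
    using inv by (rule inj_on_inverseI)
  have on: "chart_on (mtop M) ?c"
    unfolding chart_on_iff
  proof (intro conjI allI impI)
    show "inj_on (coord ?c) (chart_dom ?c)"
      using comp_inj_on[OF D(3) inj] by simp
    show "coord ?c ` chart_dom ?c \<subseteq> chart_model ?c"
      using \<psi>V by auto
    fix A assume A: "openin (mtop M) A" "A \<subseteq> chart_dom ?c"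
    have "openin (top_of_set ?V) {u \<in> \<psi> ` ?U. \<psi>' u \<in> coord c ` A}"
    proof (rule openin_preimage_subspace[OF op smooth_on_continuous[OF \<psi>']])
      show "\<psi>' ` \<psi> ` ?U \<subseteq> ?V"
        using inv D(4) by auto
      show "openin (top_of_set ?V) (coord c ` A)"
        using A D(5) by auto
    qed
    moreover have "{u \<in> \<psi> ` ?U. \<psi>' u \<in> coord c ` A} = coord ?c ` A"
      using A(2) inv by force
    ultimately show "openin (top_of_set (chart_model ?c)) (coord ?c ` A)"
      by simp
  next
    fix W assume "openin (top_of_set (chart_model ?c)) W"
    then have "openin (top_of_set ?V) {u \<in> ?U. \<psi> u \<in> W}"
      using openin_preimage_subspace[OF opU smooth_on_continuous[OF \<psi>] \<psi>V] by simp
    then have "openin (mtop M) {x \<in> ?D. coord c x \<in> {u \<in> ?U. \<psi> u \<in> W}}"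
      by (rule D(6))
    moreover have "{x \<in> ?D. coord c x \<in> {u \<in> ?U. \<psi> u \<in> W}} = {x \<in> chart_dom ?c. coord ?c x \<in> W}"
      by auto
    ultimately show "openin (mtop M) {x \<in> chart_dom ?c. coord ?c x \<in> W}"
      by simp
  qed (use D in auto)
  have fwd: "smooth_in_charts c ?c ?D (\<lambda>x. x)"
    by (rule smooth_in_chartsI[OF con _ \<psi>]) auto
  have "smooth_on (chart_model ?c) (coord ?c ` ?D) \<psi>'"
    using \<psi>' by (simp add: image_comp)
  then have bwd: "smooth_in_charts ?c c ?D (\<lambda>x. x)"
    by (rule smooth_in_chartsI[OF on, rotated]) (use inv in auto)
  show ?thesis
  proof (rule charts_if_locally_smooth[OF on])
    show "chart_on (mtop M) e" if "e \<in> atlas M" for e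
      using M that by (simp add: charted_def)
    show "\<exists>d\<in>charts M. \<exists>A. openin (mtop M) A \<and> x \<in> A \<and> A \<subseteq> chart_dom d \<and> A \<subseteq> chart_dom ?c \<and>
        smooth_in_charts ?c d A (\<lambda>x. x) \<and> smooth_in_charts d ?c A (\<lambda>x. x)"
      if "x \<in> chart_dom ?c" for x
      using that c D(1) fwd bwd by (intro bexI[of _ c] exI[of _ ?D]) auto
  qed
qed

lemma charts_pullback:
  assumes M: "charted M" and N: "charted N"
    and f: "smooth_map M N f" and g: "smooth_map N M g"
    and gf: "\<And>x. x \<in> pts M \<Longrightarrow> g (f x) = x" and fg: "\<And>y. y \<in> pts N \<Longrightarrow> f (g y) = y"
    and d: "d \<in> charts N"
  shows "\<lparr>chart_dom = {x \<in> pts M. f x \<in> chart_dom d}, chart_model = chart_model d,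
    coord = coord d \<circ> f\<rparr> \<in> charts M" (is "?c \<in> _")
proof -
  have don: "chart_on (mtop N) d"
    using d by (rule charts_chart_on)
  note D = chart_onD[OF don]
  have on: "chart_on (mtop M) ?c"
    unfolding chart_on_iff
  proof (intro conjI allI impI)
    show "openin (mtop M) (chart_dom ?c)"
      using smooth_map_preimage[OF f D(1)] by simp
    show "inj_on (coord ?c) (chart_dom ?c)"
      using D(3) gf by (auto simp: inj_on_def) metis
    show "coord ?c ` chart_dom ?c \<subseteq> chart_model ?c"
      using D(4) by auto
  next
    fix A assume A: "openin (mtop M) A" "A \<subseteq> chart_dom ?c"
    have "f ` A = {y \<in> pts N. g y \<in> A}"
    proof
      show "f ` A \<subseteq> {y \<in> pts N. g y \<in> A}"
        using A(2) gf smooth_mapD(2)[OF f] by auto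
      show "{y \<in> pts N. g y \<in> A} \<subseteq> f ` A"
        using fg by (metis (lifting) image_eqI mem_Collect_eq subsetI)
    qed
    then have "openin (mtop N) (f ` A)"
      using smooth_map_preimage[OF g A(1)] by simp
    then have "openin (top_of_set (chart_model d)) (coord d ` f ` A)"
      using A(2) by (intro D(5)) auto
    then show "openin (top_of_set (chart_model ?c)) (coord ?c ` A)"
      by (simp add: image_comp)
  next
    fix W assume "openin (top_of_set (chart_model ?c)) W"
    then have "openin (mtop N) {y \<in> chart_dom d. coord d y \<in> W}"
      using D(6) by simp
    from smooth_map_preimage[OF f this]
    show "openin (mtop M) {x \<in> chart_dom ?c. coord ?c x \<in> W}"
      by (rule back_subst[of "openin (mtop M)"]) auto
  qed (use D in auto)
  show ?thesis
  proof (rule charts_if_locally_smooth[OF on])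
    show "chart_on (mtop M) e" if "e \<in> atlas M" for e
      using M that by (simp add: charted_def)
    fix x assume x: "x \<in> chart_dom ?c"
    then have xM: "x \<in> pts M" and fx: "f x \<in> chart_dom d" "f x \<in> pts N"
      using smooth_mapD(2)[OF f] by auto
    obtain e where e: "e \<in> charts M" "x \<in> chart_dom e"
      using chart_at[OF M xM] by metis
    have eon: "chart_on (mtop M) e"
      using e(1) by (rule charts_chart_on)
    obtain A where A: "openin (mtop M) A" "x \<in> A" "A \<subseteq> chart_dom e" "f ` A \<subseteq> chart_dom d"
      "smooth_in_charts e d A f"
      using smooth_at_in_charts[OF M N smooth_mapD(1)[OF f xM] e d fx(1)] .
    have gfx: "g (f x) \<in> chart_dom e"
      using gf[OF xM] e(2) by simp
    obtain B where B: "openin (mtop N) B" "f x \<in> B" "B \<subseteq> chart_dom d" "g ` B \<subseteq> chart_dom e"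
      "smooth_in_charts d e B g"
      using smooth_at_in_charts[OF N M smooth_mapD(1)[OF g fx(2)] d fx(1) e(1) gfx] .
    let ?A = "A \<inter> {x \<in> pts M. f x \<in> B}"
    have op: "openin (mtop M) ?A"
      using A(1) smooth_map_preimage[OF f B(1)] by blast
    have dom: "?A \<subseteq> chart_dom ?c"
      using B(3) by auto
    have "smooth_on (chart_model e) (coord e ` ?A) (local_rep e d f)"
      using A(5) unfolding smooth_in_charts_def by (rule smooth_on_subset) auto
    then have 1: "smooth_in_charts e ?c ?A (\<lambda>x. x)"
      by (rule smooth_in_chartsI[OF eon, rotated]) (use A(3) in \<open>auto simp: subset_iff local_rep_coord[OF eon]\<close>)
    have "smooth_on (chart_model ?c) (coord ?c ` ?A) (local_rep d e g)"
      using B(5) unfolding smooth_in_charts_def by (rule smooth_on_subset) auto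
    moreover have "local_rep d e g (coord ?c x) = coord e x" if "x \<in> ?A" for x
    proof -
      have "f x \<in> chart_dom d" "g (f x) = x"
        using that B(3) gf by auto
      then show ?thesis
        using local_rep_coord[OF don, of "f x" e g] by simp
    qed
    ultimately have 2: "smooth_in_charts ?c e ?A (\<lambda>x. x)"
      by (rule smooth_in_chartsI[OF on dom])
    have "x \<in> ?A" "?A \<subseteq> chart_dom e"
      using A B xM by auto
    with op dom 1 2 e(1) show "\<exists>d\<in>charts M. \<exists>A. openin (mtop M) A \<and> x \<in> A \<and> A \<subseteq> chart_dom d \<and>
        A \<subseteq> chart_dom ?c \<and> smooth_in_charts ?c d A (\<lambda>x. x) \<and> smooth_in_charts d ?c A (\<lambda>x. x)"
      by blast
  qed
qed

section \<open>Products\<close>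

lemma prod_chart_sel [simp]:
  "chart_dom (prod_chart c d) = chart_dom c \<times> chart_dom d"
  "chart_model (prod_chart c d) = chart_model c \<times> chart_model d"
  "coord (prod_chart c d) = map_prod (coord c) (coord d)"
  by (simp_all add: prod_chart_def)

lemma mtop_prod_mfd [simp]: "mtop (prod_mfd M N) = prod_topology (mtop M) (mtop N)"
  by (simp add: prod_mfd_def)

lemma chart_on_prod:
  assumes c: "chart_on T c" and d: "chart_on T' d"
  shows "chart_on (prod_topology T T') (prod_chart c d)"
  unfolding chart_on_iff
proof (intro conjI allI impI)
  note C = chart_onD[OF c] and D = chart_onD[OF d]
  show "openin (prod_topology T T') (chart_dom (prod_chart c d))"
    using C(1) D(1) by (simp add: openin_prod_Times_iff)
  show "subspace (chart_model (prod_chart c d))"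
    using C(2) D(2) by (simp add: subspace_Times)
  show "inj_on (coord (prod_chart c d)) (chart_dom (prod_chart c d))"
    using C(3) D(3) by (simp add: map_prod_inj_on)
  show "coord (prod_chart c d) ` chart_dom (prod_chart c d) \<subseteq> chart_model (prod_chart c d)"
    using C(4) D(4) by auto
  show "openin (top_of_set (chart_model (prod_chart c d))) (coord (prod_chart c d) ` A)"
    if A: "openin (prod_topology T T') A" "A \<subseteq> chart_dom (prod_chart c d)" for A
  proof (subst openin_subopen, intro ballI)
    fix u assume "u \<in> coord (prod_chart c d) ` A"
    then obtain x y where xy: "(x, y) \<in> A" "u = (coord c x, coord d y)"
      by auto
    obtain X Y where XY: "openin T X" "openin T' Y" "x \<in> X" "y \<in> Y" "X \<times> Y \<subseteq> A"
      using A(1)[unfolded openin_prod_topology_alt, rule_format, OF xy(1)] by blast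
    then have "X \<subseteq> chart_dom c" "Y \<subseteq> chart_dom d"
      using A(2) by auto
    then have "openin (top_of_set (chart_model c \<times> chart_model d)) (coord c ` X \<times> coord d ` Y)"
      using C(5) D(5) XY by (intro openin_Times) auto
    moreover have "coord c ` X \<times> coord d ` Y \<subseteq> coord (prod_chart c d) ` A"
      using XY(5) by force
    ultimately show "\<exists>T. openin (top_of_set (chart_model (prod_chart c d))) T \<and> u \<in> T \<and>
        T \<subseteq> coord (prod_chart c d) ` A"
      using xy XY by (intro exI[of _ "coord c ` X \<times> coord d ` Y"]) auto
  qed
  show "openin (prod_topology T T') {x \<in> chart_dom (prod_chart c d). coord (prod_chart c d) x \<in> W}"
    if W: "openin (top_of_set (chart_model (prod_chart c d))) W" for W
  proof (subst openin_subopen, intro ballI)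
    fix z assume z: "z \<in> {x \<in> chart_dom (prod_chart c d). coord (prod_chart c d) x \<in> W}"
    then obtain x y where xy: "z = (x, y)" "x \<in> chart_dom c" "y \<in> chart_dom d" "(coord c x, coord d y) \<in> W"
      by auto
    obtain Z where Z: "open Z" "W = (chart_model c \<times> chart_model d) \<inter> Z"
      using W by (auto simp: openin_open)
    then obtain X Y where XY: "open X" "open Y" "coord c x \<in> X" "coord d y \<in> Y" "X \<times> Y \<subseteq> Z"
      using xy(4) open_prod_elim[of Z "(coord c x, coord d y)"] by (metis IntD2 mem_Sigma_iff)
    let ?X = "{x \<in> chart_dom c. coord c x \<in> chart_model c \<inter> X}"
    let ?Y = "{y \<in> chart_dom d. coord d y \<in> chart_model d \<inter> Y}"
    have "openin T ?X" "openin T' ?Y"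
      by (rule C(6) D(6), rule openin_open_Int, rule XY)+
    then have "openin (prod_topology T T') (?X \<times> ?Y)"
      by (simp add: openin_prod_Times_iff)
    moreover have "z \<in> ?X \<times> ?Y"
      using xy XY C(4) D(4) by auto
    moreover have "?X \<times> ?Y \<subseteq> {x \<in> chart_dom (prod_chart c d). coord (prod_chart c d) x \<in> W}"
      using XY(5) Z(2) by auto
    ultimately show "\<exists>S. openin (prod_topology T T') S \<and> z \<in> S \<and>
        S \<subseteq> {x \<in> chart_dom (prod_chart c d). coord (prod_chart c d) x \<in> W}"
      by blast
  qed
qed

lemma smooth_in_charts_prod:
  assumes c: "chart_on T c" and d: "chart_on T' d"
    and A: "openin T A" "A \<subseteq> chart_dom c" and B: "openin T' B" "B \<subseteq> chart_dom d"
    and f: "smooth_in_charts c c' A f" and g: "smooth_in_charts d d' B g"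
  shows "smooth_in_charts (prod_chart c d) (prod_chart c' d') (A \<times> B) (\<lambda>z. (f (fst z), g (snd z)))"
proof (rule smooth_in_chartsI[OF chart_on_prod[OF c d]])
  note C = chart_onD[OF c] and D = chart_onD[OF d]
  let ?V = "chart_model c \<times> chart_model d" and ?U = "coord c ` A \<times> coord d ` B"
  have op: "openin (top_of_set ?V) ?U"
    using C(5)[OF A] D(5)[OF B] by (rule openin_Times)
  have V: "subspace ?V"
    using C(2) D(2) by (rule subspace_Times)
  have sub: "coord c ` A \<subseteq> chart_model c" "coord d ` B \<subseteq> chart_model d"
    using C(4) D(4) A(2) B(2) by (meson image_mono order_trans)+
  have "smooth_on ?V ?U (\<lambda>z. local_rep c c' f (fst z))"
    by (rule smooth_on_compose[OF V op C(2) sub(1)])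
      (use f in \<open>auto simp: smooth_in_charts_def intro: smooth_on_linear bounded_linear_fst\<close>)
  moreover have "smooth_on ?V ?U (\<lambda>z. local_rep d d' g (snd z))"
    by (rule smooth_on_compose[OF V op D(2) sub(2)])
      (use g in \<open>auto simp: smooth_in_charts_def intro: smooth_on_linear bounded_linear_snd\<close>)
  ultimately have "smooth_on ?V ?U (\<lambda>z. (local_rep c c' f (fst z), local_rep d d' g (snd z)))"
    by (rule smooth_on_Pair)
  moreover have "coord (prod_chart c d) ` (A \<times> B) = ?U"
    by (auto simp: image_iff)
  ultimately show "smooth_on (chart_model (prod_chart c d)) (coord (prod_chart c d) ` (A \<times> B))
      (\<lambda>z. (local_rep c c' f (fst z), local_rep d d' g (snd z)))"
    by simp
qed (use A(2) B(2) in \<open>auto simp: subset_iff local_rep_coord[OF c] local_rep_coord[OF d]\<close>)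

lemma smooth_in_charts_prod_id:
  assumes c: "chart_on T c" and d: "chart_on T' d"
    and A: "openin T A" "A \<subseteq> chart_dom c" and B: "openin T' B" "B \<subseteq> chart_dom d"
    and f: "smooth_in_charts c c' A (\<lambda>x. x)" and g: "smooth_in_charts d d' B (\<lambda>x. x)"
  shows "smooth_in_charts (prod_chart c d) (prod_chart c' d') (A \<times> B) (\<lambda>z. z)"
  using smooth_in_charts_prod[OF c d A B f g] by simp

lemma charted_prod:
  assumes M: "charted M" and N: "charted N"
  shows "charted (prod_mfd M N)"
  unfolding charted_def
proof (intro conjI ballI)
  show "(\<Union>c\<in>atlas (prod_mfd M N). chart_dom c) = pts (prod_mfd M N)"
  proof -
    have "(\<Union>c\<in>atlas (prod_mfd M N). chart_dom c) =
        (\<Union>c\<in>atlas M. chart_dom c) \<times> (\<Union>d\<in>atlas N. chart_dom d)"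
      unfolding prod_mfd_def by (auto; force)
    then show ?thesis
      using M N by (simp add: charted_def)
  qed
  show "chart_on (mtop (prod_mfd M N)) c" if "c \<in> atlas (prod_mfd M N)" for c
    using that M N by (auto simp: prod_mfd_def charted_def intro: chart_on_prod)
  fix c c' assume "c \<in> atlas (prod_mfd M N)" "c' \<in> atlas (prod_mfd M N)"
  then obtain c1 c2 d1 d2 where cd: "c = prod_chart c1 c2" "c' = prod_chart d1 d2"
    "c1 \<in> atlas M" "d1 \<in> atlas M" "c2 \<in> atlas N" "d2 \<in> atlas N"
    by (auto simp: prod_mfd_def)
  have on: "chart_on (mtop M) c1" "chart_on (mtop M) d1" "chart_on (mtop N) c2" "chart_on (mtop N) d2"
    using M N cd by (auto simp: charted_def)
  have comp: "compatible c1 d1" "compatible c2 d2"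
    using M N cd by (auto simp: charted_def)
  have op: "openin (mtop M) (chart_dom c1 \<inter> chart_dom d1)" "openin (mtop N) (chart_dom c2 \<inter> chart_dom d2)"
    "openin (mtop M) (chart_dom d1 \<inter> chart_dom c1)" "openin (mtop N) (chart_dom d2 \<inter> chart_dom c2)"
    using on chart_onD(1) by blast+
  show "compatible c c'"
    using comp unfolding cd compatible_iff prod_chart_sel Times_Int_Times
    by (auto intro!: smooth_in_charts_prod_id on op)
qed

lemma prod_chart_charts:
  assumes M: "charted M" and N: "charted N" and c: "c \<in> charts M" and d: "d \<in> charts N"
  shows "prod_chart c d \<in> charts (prod_mfd M N)"
proof (rule charts_if_locally_smooth)
  note con = charts_chart_on[OF c] and don = charts_chart_on[OF d]
  show "chart_on (mtop (prod_mfd M N)) (prod_chart c d)"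
    using chart_on_prod[OF con don] by simp
  show "chart_on (mtop (prod_mfd M N)) e" if "e \<in> atlas (prod_mfd M N)" for e
    using that charted_prod[OF M N] by (simp add: charted_def)
  fix z assume "z \<in> chart_dom (prod_chart c d)"
  then obtain x y where xy: "z = (x, y)" "x \<in> chart_dom c" "y \<in> chart_dom d"
    by auto
  obtain a where a: "a \<in> atlas M" "a \<in> charts M" "x \<in> chart_dom a"
    using chart_at[OF M] chart_dom_pts[OF c] xy by blast
  obtain b where b: "b \<in> atlas N" "b \<in> charts N" "y \<in> chart_dom b"
    using chart_at[OF N] chart_dom_pts[OF d] xy by blast
  have ab: "prod_chart a b \<in> charts (prod_mfd M N)"
    using a(1) b(1) by (intro atlas_charts[OF charted_prod[OF M N]]) (auto simp: prod_mfd_def)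
  note aon = charts_chart_on[OF a(2)] and bon = charts_chart_on[OF b(2)]
  let ?A = "chart_dom a \<inter> chart_dom c" and ?B = "chart_dom b \<inter> chart_dom d"
  have op: "openin (mtop M) ?A" "openin (mtop N) ?B"
    using con don aon bon chart_onD(1) by blast+
  have "openin (mtop (prod_mfd M N)) (?A \<times> ?B)"
    using op by (simp add: openin_prod_Times_iff)
  moreover have "smooth_in_charts (prod_chart c d) (prod_chart a b) (?A \<times> ?B) (\<lambda>z. z)"
    using smooth_in_charts_transition[OF M c a(2)] smooth_in_charts_transition[OF N d b(2)]
    by (intro smooth_in_charts_prod_id[OF con don op(1) _ op(2)]) (auto simp: Int_commute)
  moreover have "smooth_in_charts (prod_chart a b) (prod_chart c d) (?A \<times> ?B) (\<lambda>z. z)"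
    using smooth_in_charts_transition[OF M a(2) c] smooth_in_charts_transition[OF N b(2) d]
    by (intro smooth_in_charts_prod_id[OF aon bon op(1) _ op(2)]) auto
  ultimately show "\<exists>e\<in>charts (prod_mfd M N). \<exists>A. openin (mtop (prod_mfd M N)) A \<and> z \<in> A \<and>
      A \<subseteq> chart_dom e \<and> A \<subseteq> chart_dom (prod_chart c d) \<and>
      smooth_in_charts (prod_chart c d) e A (\<lambda>x. x) \<and> smooth_in_charts e (prod_chart c d) A (\<lambda>x. x)"
    using ab xy a(3) b(3) by (intro bexI[OF _ ab] exI[of _ "?A \<times> ?B"]) auto
qed

lemma smooth_at_fst_snd:
  assumes M: "charted M" and N: "charted N" and z: "z \<in> pts M \<times> pts N"
  shows "smooth_at (prod_mfd M N) M fst z" "smooth_at (prod_mfd M N) N snd z"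
proof -
  obtain c where c: "c \<in> charts M" "fst z \<in> chart_dom c"
    using chart_at[OF M] z by (metis mem_Times_iff)
  obtain d where d: "d \<in> charts N" "snd z \<in> chart_dom d"
    using chart_at[OF N] z by (metis mem_Times_iff)
  have cd: "prod_chart c d \<in> charts (prod_mfd M N)"
    using prod_chart_charts[OF M N c(1) d(1)] .
  note on = charts_chart_on[OF cd]
  let ?A = "chart_dom (prod_chart c d)"
  have A: "openin (mtop (prod_mfd M N)) ?A" "z \<in> ?A"
    using chart_onD(1)[OF on] c d by (auto simp: mem_Times_iff)
  have "smooth_in_charts (prod_chart c d) c ?A fst"
    by (rule smooth_in_chartsI[OF on _ smooth_on_linear[OF bounded_linear_fst]]) auto
  then show "smooth_at (prod_mfd M N) M fst z"
    unfolding smooth_at_def using A c(1) cd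
    by (intro bexI[OF _ cd] bexI[OF _ c(1)] exI[of _ ?A]) auto
  have "smooth_in_charts (prod_chart c d) d ?A snd"
    by (rule smooth_in_chartsI[OF on _ smooth_on_linear[OF bounded_linear_snd]]) auto
  then show "smooth_at (prod_mfd M N) N snd z"
    unfolding smooth_at_def using A d(1) cd
    by (intro bexI[OF _ cd] bexI[OF _ d(1)] exI[of _ ?A]) auto
qed

lemma smooth_at_Pair:
  assumes L: "charted L" and M: "charted M" and N: "charted N"
    and f: "smooth_at L M f p" and g: "smooth_at L N g p"
  shows "smooth_at L (prod_mfd M N) (\<lambda>x. (f x, g x)) p"
proof -
  obtain e where e: "e \<in> charts L" "p \<in> chart_dom e"
    using chart_at[OF L smooth_at_pts(1)[OF f]] by metis
  obtain c where c: "c \<in> charts M" "f p \<in> chart_dom c"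
    using chart_at[OF M smooth_at_pts(2)[OF f]] by metis
  obtain d where d: "d \<in> charts N" "g p \<in> chart_dom d"
    using chart_at[OF N smooth_at_pts(2)[OF g]] by metis
  note eon = charts_chart_on[OF e(1)]
  obtain A where A: "openin (mtop L) A" "p \<in> A" "A \<subseteq> chart_dom e" "f ` A \<subseteq> chart_dom c"
    "smooth_in_charts e c A f"
    using smooth_at_in_charts[OF L M f e c] .
  obtain B where B: "openin (mtop L) B" "p \<in> B" "B \<subseteq> chart_dom e" "g ` B \<subseteq> chart_dom d"
    "smooth_in_charts e d B g"
    using smooth_at_in_charts[OF L N g e d] .
  have "smooth_on (chart_model e) (coord e ` (A \<inter> B)) (\<lambda>u. (local_rep e c f u, local_rep e d g u))"
    using A(5) B(5) unfolding smooth_in_charts_def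
    by (intro smooth_on_Pair) (auto intro: smooth_on_subset)
  then have "smooth_in_charts e (prod_chart c d) (A \<inter> B) (\<lambda>x. (f x, g x))"
    by (rule smooth_in_chartsI[OF eon, rotated]) (use A(3) in \<open>auto simp: subset_iff local_rep_coord[OF eon]\<close>)
  moreover have "openin (mtop L) (A \<inter> B)" "p \<in> A \<inter> B" "A \<inter> B \<subseteq> chart_dom e"
    "(\<lambda>x. (f x, g x)) ` (A \<inter> B) \<subseteq> chart_dom (prod_chart c d)"
    using A B by auto
  ultimately show ?thesis
    unfolding smooth_at_def using e(1) prod_chart_charts[OF M N c(1) d(1)] by blast
qed

section \<open>Embedded submanifolds\<close>

text \<open>The charts from which the atlas of \<open>submfd\<close> is made: in them, \<open>S\<close> is cut out by the subspace \<open>W\<close>.\<close>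

definition slice_chart :: "('a, 'e::euclidean_space) mfd \<Rightarrow> 'a set \<Rightarrow> ('a, 'e) chart \<Rightarrow> 'e set \<Rightarrow> bool" where
  "slice_chart M S c W \<longleftrightarrow> c \<in> charts M \<and> subspace W \<and> W \<subseteq> chart_model c \<and>
     coord c ` (chart_dom c \<inter> S) = coord c ` chart_dom c \<inter> W"

definition restrict_chart :: "('a, 'e) chart \<Rightarrow> 'a set \<Rightarrow> 'e set \<Rightarrow> ('a, 'e) chart" where
  "restrict_chart c S W = \<lparr>chart_dom = chart_dom c \<inter> S, chart_model = W, coord = coord c\<rparr>"

lemma restrict_chart_sel [simp]:
  "chart_dom (restrict_chart c S W) = chart_dom c \<inter> S"
  "chart_model (restrict_chart c S W) = W"
  "coord (restrict_chart c S W) = coord c"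
  by (simp_all add: restrict_chart_def)

definition embedded :: "('a, 'e::euclidean_space) mfd \<Rightarrow> 'a set \<Rightarrow> bool" where
  "embedded M S \<longleftrightarrow> S \<subseteq> pts M \<and> (\<forall>x\<in>S. \<exists>c W. slice_chart M S c W \<and> x \<in> chart_dom c)"

lemma mtop_submfd [simp]: "mtop (submfd M S) = subtopology (mtop M) S"
  by (simp add: submfd_def)

lemma atlas_submfd: "atlas (submfd M S) = {restrict_chart c S W | c W. slice_chart M S c W}"
  by (simp add: submfd_def restrict_chart_def slice_chart_def conj_assoc)

lemma pts_submfd: "embedded M S \<Longrightarrow> pts (submfd M S) = S"
  by (auto simp: embedded_def)

lemma slice_chartD:
  assumes "slice_chart M S c W"
  shows "c \<in> charts M" "subspace W" "W \<subseteq> chart_model c"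
    "\<And>x. x \<in> chart_dom c \<Longrightarrow> x \<in> S \<longleftrightarrow> coord c x \<in> W"
proof -
  show c: "c \<in> charts M" "subspace W" "W \<subseteq> chart_model c"
    using assms by (auto simp: slice_chart_def)
  have eq: "coord c ` (chart_dom c \<inter> S) = coord c ` chart_dom c \<inter> W"
    using assms by (auto simp: slice_chart_def)
  fix x assume x: "x \<in> chart_dom c"
  have inj: "inj_on (coord c) (chart_dom c)"
    using charts_chart_on[OF c(1)] by (rule chart_onD(3))
  have "x \<in> S \<longleftrightarrow> coord c x \<in> coord c ` (chart_dom c \<inter> S)"
    using x inj by (auto dest: inj_onD)
  then show "x \<in> S \<longleftrightarrow> coord c x \<in> W"
    using x eq by auto
qed

lemma slice_chartI:
  assumes "c \<in> charts M" "subspace W" "W \<subseteq> chart_model c"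
    and "\<And>x. x \<in> chart_dom c \<Longrightarrow> coord c x \<in> W \<longleftrightarrow> x \<in> S"
  shows "slice_chart M S c W"
  using assms by (auto simp: slice_chart_def)

lemma chart_on_restrict_chart:
  assumes s: "slice_chart M S c W"
  shows "chart_on (subtopology (mtop M) S) (restrict_chart c S W)"
proof -
  note S = slice_chartD[OF s] and D = chart_onD[OF charts_chart_on[OF slice_chartD(1)[OF s]]]
  show ?thesis
    unfolding chart_on_iff restrict_chart_sel
  proof (intro conjI allI impI)
    show "openin (subtopology (mtop M) S) (chart_dom c \<inter> S)"
      using D(1) by (auto simp: openin_subtopology)
    show "inj_on (coord c) (chart_dom c \<inter> S)"
      using D(3) by (rule inj_on_subset) auto
    show "coord c ` (chart_dom c \<inter> S) \<subseteq> W"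
      using S(4) by auto
    show "openin (top_of_set W) (coord c ` A)"
      if A: "openin (subtopology (mtop M) S) A" "A \<subseteq> chart_dom c \<inter> S" for A
    proof -
      obtain B where B: "openin (mtop M) B" "A = B \<inter> S"
        using A(1) by (auto simp: openin_subtopology)
      have "openin (top_of_set (chart_model c)) (coord c ` (B \<inter> chart_dom c))"
        using B(1) D(1) by (intro D(5)) auto
      then have "openin (top_of_set W) (coord c ` (B \<inter> chart_dom c) \<inter> W)"
        using S(3) by (auto simp: openin_open)
      moreover have "coord c ` (B \<inter> chart_dom c) \<inter> W = coord c ` A"
        using A(2) B(2) S(4) by auto
      ultimately show ?thesis
        by simp
    qed
    show "openin (subtopology (mtop M) S) {x \<in> chart_dom c \<inter> S. coord c x \<in> Y}"
      if Y: "openin (top_of_set W) Y" for Y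
    proof -
      obtain Z where Z: "open Z" "Y = W \<inter> Z"
        using Y by (auto simp: openin_open)
      have "openin (mtop M) {x \<in> chart_dom c. coord c x \<in> chart_model c \<inter> Z}"
        by (rule D(6), rule openin_open_Int, rule Z(1))
      moreover have "{x \<in> chart_dom c \<inter> S. coord c x \<in> Y} =
          {x \<in> chart_dom c. coord c x \<in> chart_model c \<inter> Z} \<inter> S"
        using Z(2) S(3,4) by auto
      ultimately show ?thesis
        by (auto simp: openin_subtopology)
    qed
  qed (use S in auto)
qed

lemma charted_submfd:
  assumes M: "charted M" and S: "embedded M S"
  shows "charted (submfd M S)"
  unfolding charted_def
proof (intro conjI ballI)
  show "chart_on (mtop (submfd M S)) c" if "c \<in> atlas (submfd M S)" for c
    using that chart_on_restrict_chart by (auto simp: atlas_submfd)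
  show "(\<Union>c\<in>atlas (submfd M S). chart_dom c) = pts (submfd M S)"
    unfolding pts_submfd[OF S] using S by (fastforce simp: atlas_submfd embedded_def)
  have "smooth_in_charts (restrict_chart c S V) (restrict_chart d S W)
      (chart_dom (restrict_chart c S V) \<inter> chart_dom (restrict_chart d S W)) (\<lambda>x. x)"
    if c: "slice_chart M S c V" and d: "slice_chart M S d W" for c d V W
  proof -
    have "smooth_in_charts c d (chart_dom c \<inter> S \<inter> (chart_dom d \<inter> S)) (\<lambda>x. x)"
      using smooth_in_charts_transition[OF M slice_chartD(1)[OF c] slice_chartD(1)[OF d]]
      by (rule smooth_in_charts_subset) auto
    then show ?thesis
      unfolding restrict_chart_sel
      by (rule smooth_in_charts_change[OF charts_chart_on[OF slice_chartD(1)[OF c]]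
            chart_on_restrict_chart[OF c], rotated -1])
        (use slice_chartD[OF c] in auto)
  qed
  then show "compatible c d" if "c \<in> atlas (submfd M S)" "d \<in> atlas (submfd M S)" for c d
    using that by (auto simp: atlas_submfd compatible_iff)
qed

lemma restrict_chart_charts:
  assumes "charted M" "embedded M S" "slice_chart M S c W"
  shows "restrict_chart c S W \<in> charts (submfd M S)"
  using assms by (intro atlas_charts charted_submfd) (auto simp: atlas_submfd)

lemma smooth_at_inclusion:
  assumes M: "charted M" and S: "embedded M S" and x: "x \<in> S"
  shows "smooth_at (submfd M S) M (\<lambda>x. x) x"
proof -
  obtain c W where c: "slice_chart M S c W" "x \<in> chart_dom c"
    using S x by (auto simp: embedded_def)
  note on = chart_on_restrict_chart[OF c(1)]
  have "smooth_in_charts (restrict_chart c S W) c (chart_dom c \<inter> S) (\<lambda>x. x)"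
    by (rule smooth_in_chartsI[OF on _ smooth_on_ident]) auto
  moreover have "openin (mtop (submfd M S)) (chart_dom c \<inter> S)"
    using chart_onD(1)[OF on] by simp
  ultimately show ?thesis
    unfolding smooth_at_def using c x
    by (intro bexI[OF _ restrict_chart_charts[OF M S c(1)]] bexI[OF _ slice_chartD(1)[OF c(1)]]
        exI[of _ "chart_dom c \<inter> S"]) auto
qed

text \<open>In a slice chart the coordinate expression of \<open>f\<close> is literally the same for the submanifold as for
  the ambient manifold, and smoothness does not refer to the model space of the target.\<close>

lemma smooth_at_into_submfd:
  assumes L: "charted L" and M: "charted M" and S: "embedded M S"
    and f: "smooth_at L M f p" and B: "openin (mtop L) B" "p \<in> B" "f ` B \<subseteq> S"
  shows "smooth_at L (submfd M S) f p"
proof -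
  have "f p \<in> S"
    using B by blast
  then obtain d W where d: "slice_chart M S d W" "f p \<in> chart_dom d"
    using S unfolding embedded_def by blast
  obtain c where c: "c \<in> charts L" "p \<in> chart_dom c"
    using chart_at[OF L smooth_at_pts(1)[OF f]] by metis
  obtain A where A: "openin (mtop L) A" "p \<in> A" "A \<subseteq> chart_dom c" "f ` A \<subseteq> chart_dom d"
    "smooth_in_charts c d A f"
    using smooth_at_in_charts[OF L M f c slice_chartD(1)[OF d(1)] d(2)] .
  note con = charts_chart_on[OF c(1)]
  have "smooth_in_charts c d (A \<inter> B) f"
    using A(5) by (rule smooth_in_charts_subset) auto
  then have "smooth_in_charts c (restrict_chart d S W) (A \<inter> B) f"
    by (rule smooth_in_charts_change[OF con con, rotated -1]) (use A in auto)
  moreover have "openin (mtop L) (A \<inter> B)" "p \<in> A \<inter> B" "A \<inter> B \<subseteq> chart_dom c"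
    "f ` (A \<inter> B) \<subseteq> chart_dom (restrict_chart d S W)"
    using A B by auto
  ultimately show ?thesis
    unfolding smooth_at_def using c(1) restrict_chart_charts[OF M S d(1)] by blast
qed

section \<open>Submersions\<close>

text \<open>The normal form of a submersion: a linear surjection between the model spaces in suitable charts.
  It yields explicit formulas for local sections and for slice charts of fibre products, so that
  the inverse function theorem is needed only once.\<close>

definition submersive_at ::
  "('a, 'e::euclidean_space) mfd \<Rightarrow> ('b, 'f::euclidean_space) mfd \<Rightarrow> ('a \<Rightarrow> 'b) \<Rightarrow> 'a \<Rightarrow> bool" where
  "submersive_at M N h q \<longleftrightarrow> (\<exists>d\<in>charts M. \<exists>e\<in>charts N. \<exists>D. q \<in> chart_dom d \<and>
     h ` chart_dom d \<subseteq> chart_dom e \<and> linear D \<and> D ` chart_model d = chart_model e \<and>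
     (\<forall>y\<in>chart_dom d. coord e (h y) = D (coord d y)))"

lemma right_inverse_on_subspace:
  fixes D :: "'a::euclidean_space \<Rightarrow> 'b::euclidean_space"
  assumes D: "linear D" "subspace V"
  obtains R where "bounded_linear R" "\<And>w. R w \<in> V" "\<And>w. w \<in> D ` V \<Longrightarrow> D (R w) = w"
proof -
  obtain R where R: "range R \<subseteq> V" "linear R" "\<forall>w\<in>D ` V. D (R w) = w"
    using linear_exists_right_inverse_on[OF D] by blast
  then show ?thesis
    using that[of R] linear_conv_bounded_linear by blast
qed

text \<open>Let \<open>H\<close> be the expression of \<open>h\<close> in charts, \<open>D\<close> its derivative at the given point and \<open>R\<close> a linear
  right inverse of \<open>D\<close>. The map \<open>\<psi> u = u + R (H u - D u)\<close> has the identity as derivative at the point,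
  hence is a local diffeomorphism of the model space, and \<open>D (\<psi> u) = D u + (H u - D u) = H u\<close>. In the
  chart changed by \<open>\<psi>\<close>, the map \<open>h\<close> is therefore \<open>D\<close>.\<close>

lemma submersion_normal_form:
  assumes M: "charted M" and N: "charted N" and h: "submersion M N h" and q: "q \<in> pts M"
  shows "submersive_at M N h q"
proof -
  obtain c e D where c: "c \<in> charts M" "q \<in> chart_dom c" and e: "e \<in> charts N"
    and he: "h ` chart_dom c \<subseteq> chart_dom e"
    and D: "(local_rep c e h has_derivative D) (at (coord c q) within coord c ` chart_dom c)"
    and DV: "D ` chart_model c = chart_model e"
    using h q unfolding submersion_def by blast
  note con = charts_chart_on[OF c(1)] and eon = charts_chart_on[OF e]
  note C = chart_onD[OF con] and E = chart_onD[OF eon]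
  have "smooth_at M N h q"
    using h q by (simp add: submersion_def smooth_mapD(1))
  moreover have "h q \<in> chart_dom e"
    using he c(2) by blast
  ultimately obtain A where A: "openin (mtop M) A" "q \<in> A" "A \<subseteq> chart_dom c"
    "h ` A \<subseteq> chart_dom e" "smooth_in_charts c e A h"
    using smooth_at_in_charts[OF M N _ c e] by blast
  let ?V = "chart_model c" and ?U = "coord c ` A" and ?H = "local_rep c e h"
  have bD: "bounded_linear D"
    using D by (rule has_derivative_bounded_linear)
  then have lD: "linear D"
    by (rule bounded_linear.linear)
  obtain R where R: "bounded_linear R" "\<And>w. R w \<in> ?V" "\<And>w. w \<in> D ` ?V \<Longrightarrow> D (R w) = w"
    using right_inverse_on_subspace[OF lD C(2)] by metis
  define \<psi> where "\<psi> = (\<lambda>u. u + R (?H u - D u))"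
  have HU: "?H (coord c x) = coord e (h x)" "coord e (h x) \<in> chart_model e" if "x \<in> A" for x
    using that A(3,4) local_rep_coord[OF con] E(4) by blast+
  have UV: "?U \<subseteq> ?V"
    using A(3) C(4) by blast
  have opU: "openin (top_of_set ?V) ?U"
    using C(5) A by blast
  have smU: "smooth_on ?V ?U \<psi>"
    using A(5) unfolding smooth_in_charts_def \<psi>_def
    by (intro smooth_on_add smooth_on_ident smooth_on_linear_comp[OF R(1)] smooth_on_diff
        smooth_on_linear[OF bD])
  have \<psi>V: "\<psi> ` ?U \<subseteq> ?V"
    using UV R(2) C(2) by (auto simp: \<psi>_def intro: subspace_add)
  have "(?H has_derivative D) (at (coord c q) within ?U)"
    using D A(3) by (rule has_derivative_subset[OF _ image_mono])
  then have d\<psi>: "(\<psi> has_derivative (\<lambda>v. v + R (D v - D v))) (at (coord c q) within ?U)"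
    unfolding \<psi>_def
    by (intro has_derivative_add has_derivative_ident bounded_linear.has_derivative[OF R(1)]
        has_derivative_diff bounded_linear_imp_has_derivative[OF bD])
  have "R 0 = 0"
    using R(1) by (simp add: linear_0 bounded_linear.linear)
  then have d\<psi>V: "v + R (D v - D v) = v" for v
    by simp
  obtain U1 g where U1: "openin (top_of_set ?V) U1" "coord c q \<in> U1" "U1 \<subseteq> ?U"
    "openin (top_of_set ?V) (\<psi> ` U1)" "smooth_on ?V (\<psi> ` U1) g" "\<And>x. x \<in> U1 \<Longrightarrow> g (\<psi> x) = x"
    using smooth_local_inverse[OF C(2) opU imageI[OF A(2)] smU \<psi>V d\<psi> d\<psi>V] by metis
  let ?B = "{x \<in> chart_dom c. coord c x \<in> U1}"
  let ?c = "c\<lparr>chart_dom := chart_dom c \<inter> ?B\<rparr>"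
  have c': "?c \<in> charts M"
    using charts_restrict[OF c(1) C(6)[OF U1(1)]] .
  have img: "coord ?c ` chart_dom ?c = U1"
    using U1(3) A(3) by auto
  let ?d = "?c\<lparr>coord := \<psi> \<circ> coord ?c\<rparr>"
  have d: "?d \<in> charts M"
  proof (rule charts_postcompose[OF M c'])
    show "smooth_on (chart_model ?c) (coord ?c ` chart_dom ?c) \<psi>"
      unfolding img using smooth_on_subset[OF smU U1(3)] by simp
    show "openin (top_of_set (chart_model ?c)) (\<psi> ` coord ?c ` chart_dom ?c)"
      "smooth_on (chart_model ?c) (\<psi> ` coord ?c ` chart_dom ?c) g"
      unfolding img using U1(4,5) by simp_all
    show "g (\<psi> u) = u" if "u \<in> coord ?c ` chart_dom ?c" for u
      using that unfolding img by (rule U1(6))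
  qed
  have BA: "?B \<subseteq> A"
  proof
    fix x assume x: "x \<in> ?B"
    then have "coord c x \<in> ?U"
      using U1(3) by blast
    then obtain a where "a \<in> A" "coord c x = coord c a"
      by blast
    then show "x \<in> A"
      using x A(3) C(3) by (auto dest: inj_onD)
  qed
  have "coord e (h y) = D (coord ?d y)" if y: "y \<in> chart_dom ?d" for y
  proof -
    have yA: "y \<in> A" and yV: "coord c y \<in> ?V"
      using y BA C(4) by auto
    have "coord e (h y) - D (coord c y) \<in> D ` ?V"
      unfolding DV using HU(2)[OF yA] yV DV E(2) by (blast intro: subspace_diff)
    then have "D (R (coord e (h y) - D (coord c y))) = coord e (h y) - D (coord c y)"
      by (rule R(3))
    then show ?thesis
      using HU(1)[OF yA] by (simp add: \<psi>_def linear_add[OF lD])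
  qed
  moreover have "h ` chart_dom ?d \<subseteq> chart_dom e" "q \<in> chart_dom ?d"
    using he c(2) U1(2) by auto
  ultimately show ?thesis
    unfolding submersive_at_def using d e lD DV
    by (intro bexI[OF _ d] bexI[OF _ e] exI[of _ D]) simp
qed

text \<open>Pull the chart of the source back along the diffeomorphism.\<close>

lemma submersive_at_compose_diffeo:
  fixes M :: "('a, 'e::euclidean_space) mfd" and N :: "('b, 'e) mfd"
  assumes M: "charted M" and N: "charted N"
    and f: "smooth_map M N f" and g: "smooth_map N M g"
    and gf: "\<And>x. x \<in> pts M \<Longrightarrow> g (f x) = x" and fg: "\<And>y. y \<in> pts N \<Longrightarrow> f (g y) = y"
    and h: "submersive_at N L h (f q)" and q: "q \<in> pts M"
    and k: "\<And>x. x \<in> pts M \<Longrightarrow> k x = h (f x)"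
  shows "submersive_at M L k q"
proof -
  obtain d e D where d: "d \<in> charts N" "e \<in> charts L" "f q \<in> chart_dom d"
    "h ` chart_dom d \<subseteq> chart_dom e" "linear D" "D ` chart_model d = chart_model e"
    "\<forall>y\<in>chart_dom d. coord e (h y) = D (coord d y)"
    using h unfolding submersive_at_def by blast
  let ?d = "\<lparr>chart_dom = {x \<in> pts M. f x \<in> chart_dom d}, chart_model = chart_model d,
    coord = coord d \<circ> f\<rparr>"
  have "?d \<in> charts M"
    by (rule charts_pullback[OF M N f g _ _ d(1)]) (simp_all add: gf fg)
  then show ?thesis
    unfolding submersive_at_def using d q k
    by (intro bexI[of _ ?d] bexI[OF _ d(2)] exI[of _ D]) auto
qed

text \<open>In the charts of the normal form the section is the affine map \<open>u \<mapsto> d q + R (u - e (h q))\<close>, where \<open>R\<close>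
  is a linear right inverse of \<open>D\<close>.\<close>

lemma local_section:
  assumes M: "charted M" and N: "charted N" and h: "submersive_at M N h q"
  obtains A s where "openin (mtop N) A" "h q \<in> A" "\<And>x. x \<in> A \<Longrightarrow> s x \<in> pts M"
    "\<And>x. x \<in> A \<Longrightarrow> h (s x) = x" "\<And>x. x \<in> A \<Longrightarrow> smooth_at N M s x"
proof -
  obtain d e D where d: "d \<in> charts M" "e \<in> charts N" "q \<in> chart_dom d"
    "h ` chart_dom d \<subseteq> chart_dom e" "linear D" "D ` chart_model d = chart_model e"
    "\<forall>y\<in>chart_dom d. coord e (h y) = D (coord d y)"
    using h unfolding submersive_at_def by blast
  note don = charts_chart_on[OF d(1)] and eon = charts_chart_on[OF d(2)]
  note DD = chart_onD[OF don] and E = chart_onD[OF eon]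
  obtain R where R: "bounded_linear R" "\<And>w. R w \<in> chart_model d"
    "\<And>w. w \<in> D ` chart_model d \<Longrightarrow> D (R w) = w"
    using right_inverse_on_subspace[OF d(5) DD(2)] by metis
  let ?F = "\<lambda>u. coord d q + R (u - coord e (h q))"
  let ?U = "coord d ` chart_dom d"
  define A where "A = {x \<in> chart_dom e. coord e x \<in> {u \<in> chart_model e. ?F u \<in> ?U}}"
  define s where "s = (\<lambda>x. inv_into (chart_dom d) (coord d) (?F (coord e x)))"
  have smF: "smooth_on V W ?F" for V W
    by (intro smooth_on_add smooth_on_const smooth_on_linear_comp[OF R(1)] smooth_on_diff smooth_on_ident)
  have dq: "coord d q \<in> chart_model d"
    using DD(4) d(3) by blast
  have "openin (top_of_set (chart_model e)) {u \<in> chart_model e. ?F u \<in> ?U}"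
  proof (rule openin_preimage_subspace[OF openin_subtopology_self smooth_on_continuous[OF smF]])
    show "?F ` chart_model e \<subseteq> chart_model d"
      using dq R(2) DD(2) by (auto intro: subspace_add)
    show "openin (top_of_set (chart_model d)) ?U"
      using DD(1,5) by blast
  qed
  then have opA: "openin (mtop N) A"
    unfolding A_def by (rule E(6))
  have "R 0 = 0"
    using R(1) by (simp add: linear_0 bounded_linear.linear)
  then have qA: "h q \<in> A"
    using d(3,4) E(4) by (auto simp: A_def image_subset_iff)
  have s: "s x \<in> chart_dom d" "coord d (s x) = ?F (coord e x)" if "x \<in> A" for x
  proof -
    have "?F (coord e x) \<in> ?U"
      using that by (simp add: A_def)
    then show "s x \<in> chart_dom d" "coord d (s x) = ?F (coord e x)"
      unfolding s_def by (rule inv_into_into, rule f_inv_into_f)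
  qed
  have sec: "h (s x) = x" if x: "x \<in> A" for x
  proof -
    have xe: "x \<in> chart_dom e" "coord e x \<in> chart_model e" and qe: "coord e (h q) \<in> chart_model e"
      using x E(4) d(3,4) by (auto simp: A_def)
    then have "coord e x - coord e (h q) \<in> D ` chart_model d"
      unfolding d(6) using E(2) by (blast intro: subspace_diff)
    then have "D (coord d (s x)) = coord e x"
      using R(3) d(3,7) s(2)[OF x] by (simp add: linear_add[OF d(5)])
    then have "coord e (h (s x)) = coord e x"
      using d(7) s(1)[OF x] by simp
    moreover have "h (s x) \<in> chart_dom e"
      using d(4) s(1)[OF x] by blast
    ultimately show ?thesis
      using E(3) xe(1) by (auto dest: inj_onD)
  qed
  have Ae: "A \<subseteq> chart_dom e"
    by (auto simp: A_def)
  have "smooth_in_charts e d A s"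
    by (rule smooth_in_chartsI[OF eon Ae smF]) (simp add: s(2))
  then have "smooth_at N M s x" if "x \<in> A" for x
    unfolding smooth_at_def using that d opA Ae s(1)
    by (intro bexI[OF _ d(2)] bexI[OF _ d(1)] exI[of _ A]) auto
  then show ?thesis
    using that[of A s] opA qA sec s(1) chart_dom_pts[OF d(1)] by blast
qed

text \<open>Let \<open>h\<close> be the linear surjection \<open>D\<close> in the charts \<open>d\<close> and \<open>e\<close>, let \<open>R\<close> be a linear right inverse of \<open>D\<close>
  and \<open>c\<close> a chart of \<open>P\<close>. In the product chart sheared to \<open>(x, y) \<mapsto> (c x, d y - R (e (f x)))\<close>, the second
  component is mapped by \<open>D\<close> to \<open>e (h y) - e (f x)\<close>. So the fibre product is the slice where the second
  component lies in the kernel of \<open>D\<close>.\<close>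

lemma fibre_product_embedded:
  assumes P: "charted P" and Q: "charted Q" and N: "charted N"
    and f: "smooth_map P N f" and h: "\<And>q. q \<in> pts Q \<Longrightarrow> submersive_at Q N h q"
  shows "embedded (prod_mfd P Q) {(p, q). p \<in> pts P \<and> q \<in> pts Q \<and> f p = h q}" (is "embedded _ ?S")
proof -
  have "\<exists>c W. slice_chart (prod_mfd P Q) ?S c W \<and> (p, q) \<in> chart_dom c"
    if p: "p \<in> pts P" and q: "q \<in> pts Q" and fp: "f p = h q" for p q
  proof -
    obtain d e D where d: "d \<in> charts Q" "e \<in> charts N" "q \<in> chart_dom d"
      "h ` chart_dom d \<subseteq> chart_dom e" "linear D" "D ` chart_model d = chart_model e"
      "\<forall>y\<in>chart_dom d. coord e (h y) = D (coord d y)"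
      using h[OF q] unfolding submersive_at_def by blast
    obtain c0 where c0: "c0 \<in> charts P" "p \<in> chart_dom c0"
      using chart_at[OF P p] by metis
    have "f p \<in> chart_dom e"
      using fp d(3,4) by auto
    then obtain A where A: "openin (mtop P) A" "p \<in> A" "A \<subseteq> chart_dom c0" "f ` A \<subseteq> chart_dom e"
      "smooth_in_charts c0 e A f"
      using smooth_at_in_charts[OF P N smooth_mapD(1)[OF f p] c0 d(2)] by metis
    define c where "c = c0\<lparr>chart_dom := chart_dom c0 \<inter> A\<rparr>"
    have c: "c \<in> charts P"
      unfolding c_def using charts_restrict[OF c0(1) A(1)] .
    have dc: "chart_dom c = A"
      using A(3) by (auto simp: c_def)
    note con = charts_chart_on[OF c] and don = charts_chart_on[OF d(1)] and eon = charts_chart_on[OF d(2)]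
    note C = chart_onD[OF con] and DD = chart_onD[OF don] and E = chart_onD[OF eon]
    have "smooth_in_charts c e A f"
      by (rule smooth_in_charts_change[OF charts_chart_on[OF c0(1)] con A(3) _ _ _ _ A(5)])
        (use A(3) dc in \<open>auto simp: c_def\<close>)
    let ?F = "local_rep c e f"
    have smF: "smooth_on (chart_model c) (coord c ` A) ?F"
      using \<open>smooth_in_charts c e A f\<close> by (simp add: smooth_in_charts_def)
    have F: "?F (coord c x) = coord e (f x)" "coord e (f x) \<in> chart_model e" if "x \<in> A" for x
      using that local_rep_coord[OF con] A(4) E(4) dc by blast+
    obtain R where R: "bounded_linear R" "\<And>w. R w \<in> chart_model d"
      "\<And>w. w \<in> D ` chart_model d \<Longrightarrow> D (R w) = w"
      using right_inverse_on_subspace[OF d(5) DD(2)] by metis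
    let ?V = "chart_model c \<times> chart_model d" and ?Y = "coord c ` A \<times> chart_model d"
    let ?U = "coord c ` A \<times> coord d ` chart_dom d"
    \<comment> \<open>The shear and its inverse are defined on \<open>?Y\<close>, a full strip over the first coordinate, so the image
      of \<open>?U\<close> is open as a preimage under the inverse.\<close>
    let ?\<psi> = "\<lambda>z. (fst z, snd z - R (?F (fst z)))" and ?\<psi>' = "\<lambda>z. (fst z, snd z + R (?F (fst z)))"
    have V: "subspace ?V"
      using C(2) DD(2) by (rule subspace_Times)
    have UY: "?U \<subseteq> ?Y"
      using DD(4) by auto
    have opA: "openin (top_of_set (chart_model c)) (coord c ` A)"
      using C(1,5) dc by blast
    have opY: "openin (top_of_set ?V) ?Y"
      using opA by (rule openin_Times) simp
    have opU: "openin (top_of_set ?V) ?U"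
      using opA by (rule openin_Times) (use DD(1,5) in blast)
    have Ac: "coord c ` A \<subseteq> chart_model c"
      using C(4) dc by simp
    have "smooth_on ?V ?Y (\<lambda>z. ?F (fst z))"
      by (rule smooth_on_compose[OF V opY C(2) Ac _ smooth_on_linear[OF bounded_linear_fst] smF]) auto
    then have RF: "smooth_on ?V ?Y (\<lambda>z. R (?F (fst z)))"
      by (rule smooth_on_linear_comp[OF R(1)])
    have sm: "smooth_on ?V ?Y ?\<psi>" "smooth_on ?V ?Y ?\<psi>'"
      by (intro smooth_on_Pair smooth_on_diff smooth_on_add RF
          smooth_on_linear[OF bounded_linear_fst] smooth_on_linear[OF bounded_linear_snd])+
    have \<psi>Y: "?\<psi> ` ?Y \<subseteq> ?Y" "?\<psi>' ` ?Y \<subseteq> ?Y"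
      using R(2) DD(2) by (auto intro: subspace_diff subspace_add)
    have im: "?\<psi> ` ?U = {z \<in> ?Y. ?\<psi>' z \<in> ?U}"
    proof
      have "?\<psi> ` ?U \<subseteq> ?Y"
        using \<psi>Y(1) image_mono[OF UY] by (rule order_trans[rotated])
      moreover have "?\<psi>' (?\<psi> z) = z" for z
        by simp
      ultimately show "?\<psi> ` ?U \<subseteq> {z \<in> ?Y. ?\<psi>' z \<in> ?U}"
        by (auto simp del: mem_Sigma_iff)
      show "{z \<in> ?Y. ?\<psi>' z \<in> ?U} \<subseteq> ?\<psi> ` ?U"
      proof
        fix z assume "z \<in> {z \<in> ?Y. ?\<psi>' z \<in> ?U}"
        then show "z \<in> ?\<psi> ` ?U"
          by (intro image_eqI[of _ _ "?\<psi>' z"]) auto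
      qed
    qed
    have op\<psi>: "openin (top_of_set ?V) (?\<psi> ` ?U)"
      unfolding im
    proof (rule openin_preimage_subspace[OF opY smooth_on_continuous[OF sm(2)] _ opU])
      show "?\<psi>' ` ?Y \<subseteq> ?V"
        using \<psi>Y(2) openin_imp_subset[OF opY] by blast
    qed
    have cd: "prod_chart c d \<in> charts (prod_mfd P Q)"
      using prod_chart_charts[OF P Q c d(1)] .
    have img: "coord (prod_chart c d) ` chart_dom (prod_chart c d) = ?U"
      by (auto simp: dc image_iff)
    let ?c = "(prod_chart c d)\<lparr>coord := ?\<psi> \<circ> coord (prod_chart c d)\<rparr>"
    have cc: "?c \<in> charts (prod_mfd P Q)"
    proof (rule charts_postcompose[OF charted_prod[OF P Q] cd])
      show "smooth_on (chart_model (prod_chart c d)) (coord (prod_chart c d) ` chart_dom (prod_chart c d)) ?\<psi>"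
        unfolding img using smooth_on_subset[OF sm(1) UY] by simp
      show "openin (top_of_set (chart_model (prod_chart c d)))
          (?\<psi> ` coord (prod_chart c d) ` chart_dom (prod_chart c d))"
        unfolding img using op\<psi> by simp
      have "?\<psi> ` ?U \<subseteq> ?Y"
        unfolding im by blast
      then show "smooth_on (chart_model (prod_chart c d))
          (?\<psi> ` coord (prod_chart c d) ` chart_dom (prod_chart c d)) ?\<psi>'"
        unfolding img using smooth_on_subset[OF sm(2)] by simp
    qed simp
    let ?W = "chart_model c \<times> {v \<in> chart_model d. D v = 0}"
    have key: "coord ?c (x, y) \<in> ?W \<longleftrightarrow> f x = h y" if x: "x \<in> A" and y: "y \<in> chart_dom d" for x y
    proof -
      have xc: "coord c x \<in> chart_model c" and yd: "coord d y \<in> chart_model d"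
        using x y Ac DD(4) by auto
      have "D (coord d y - R (coord e (f x))) = coord e (h y) - coord e (f x)"
        using R(3) d(6,7) F(2)[OF x] y by (simp add: linear_diff[OF d(5)])
      moreover have "coord d y - R (coord e (f x)) \<in> chart_model d"
        using yd R(2) DD(2) by (blast intro: subspace_diff)
      ultimately have "coord ?c (x, y) \<in> ?W \<longleftrightarrow> coord e (h y) = coord e (f x)"
        using xc F(1)[OF x] by simp
      also have "\<dots> \<longleftrightarrow> h y = f x"
        using d(4) A(4) x y by (intro inj_on_eq_iff[OF E(3)]) auto
      also have "\<dots> \<longleftrightarrow> f x = h y"
        by (rule eq_commute)
      finally show ?thesis .
    qed
    have "slice_chart (prod_mfd P Q) ?S ?c ?W"
    proof (rule slice_chartI[OF cc])
      have "subspace {v \<in> chart_model d. D v = 0}"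
        using DD(2) d(5) unfolding subspace_def by (auto simp: linear_0 linear_add linear_scale)
      then show "subspace ?W"
        by (rule subspace_Times[OF C(2)])
      show "?W \<subseteq> chart_model ?c"
        by auto
      fix z assume z: "z \<in> chart_dom ?c"
      obtain x y where xy: "z = (x, y)"
        by (cases z)
      have xyd: "x \<in> A" "y \<in> chart_dom d"
        using z xy dc by auto
      have "x \<in> pts P" "y \<in> pts Q"
        using xyd chart_dom_pts[OF c] chart_dom_pts[OF d(1)] dc by auto
      then show "coord ?c z \<in> ?W \<longleftrightarrow> z \<in> ?S"
        unfolding xy key[OF xyd] by simp
    qed
    moreover have "(p, q) \<in> chart_dom ?c"
      using A(2) d(3) dc by simp
    ultimately show ?thesis
      by blast
  qed
  then show ?thesis
    unfolding embedded_def by auto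
qed

section \<open>Lie groupoids and principal bundles\<close>

lemma groupoidD:
  assumes "is_groupoid G"
  shows "\<And>x. x \<in> obj G \<Longrightarrow> ident G x \<in> arr G" "\<And>x. x \<in> obj G \<Longrightarrow> src G (ident G x) = x"
    "\<And>x. x \<in> obj G \<Longrightarrow> tgt G (ident G x) = x"
    "\<And>g. g \<in> arr G \<Longrightarrow> ginv G g \<in> arr G" "\<And>g. g \<in> arr G \<Longrightarrow> src G (ginv G g) = tgt G g"
    "\<And>g. g \<in> arr G \<Longrightarrow> tgt G (ginv G g) = src G g"
    "\<And>g h. g \<in> arr G \<Longrightarrow> h \<in> arr G \<Longrightarrow> src G g = tgt G h \<Longrightarrow> mult G g h \<in> arr G"
    "\<And>g h. g \<in> arr G \<Longrightarrow> h \<in> arr G \<Longrightarrow> src G g = tgt G h \<Longrightarrow> src G (mult G g h) = src G h"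
    "\<And>g h. g \<in> arr G \<Longrightarrow> h \<in> arr G \<Longrightarrow> src G g = tgt G h \<Longrightarrow> tgt G (mult G g h) = tgt G g"
    "\<And>g h k. g \<in> arr G \<Longrightarrow> h \<in> arr G \<Longrightarrow> k \<in> arr G \<Longrightarrow> src G g = tgt G h \<Longrightarrow> src G h = tgt G k \<Longrightarrow>
      mult G (mult G g h) k = mult G g (mult G h k)"
    "\<And>g. g \<in> arr G \<Longrightarrow> mult G g (ident G (src G g)) = g"
    "\<And>g. g \<in> arr G \<Longrightarrow> mult G (ident G (tgt G g)) g = g"
    "\<And>g. g \<in> arr G \<Longrightarrow> mult G g (ginv G g) = ident G (tgt G g)"
    "\<And>g. g \<in> arr G \<Longrightarrow> mult G (ginv G g) g = ident G (src G g)"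
  using assms by (simp_all add: is_groupoid_def)

lemma ginv_ginv:
  assumes G: "is_groupoid G" and g: "g \<in> arr G"
  shows "ginv G (ginv G g) = g"
proof -
  note D = groupoidD[OF G]
  let ?h = "ginv G g" and ?k = "ginv G (ginv G g)"
  have "?k = mult G ?k (mult G ?h g)"
    using D(4-6,11,14) g by metis
  also have "\<dots> = mult G (mult G ?k ?h) g"
    using D(4-6,10) g by simp
  also have "\<dots> = g"
    using D(4-6,12,14) g by simp
  finally show ?thesis .
qed

lemma ginv_ident:
  assumes G: "is_groupoid G" and x: "x \<in> obj G"
  shows "ginv G (ident G x) = ident G x"
  using groupoidD[OF G] x by metis

lemma mult_left_cancel:
  assumes G: "is_groupoid G" and "h \<in> arr G" "k \<in> arr G" "tgt G h = tgt G k"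
  shows "mult G h (mult G (ginv G h) k) = k"
proof -
  note D = groupoidD[OF G]
  have "mult G h (mult G (ginv G h) k) = mult G (mult G h (ginv G h)) k"
    using D(10)[of h "ginv G h" k] D(4-6) assms by simp
  also have "mult G h (ginv G h) = ident G (tgt G k)"
    using D(13)[of h] assms by simp
  also have "mult G (ident G (tgt G k)) k = k"
    using D(12) assms by blast
  finally show ?thesis .
qed

lemma lie_groupoidD:
  assumes "lie_groupoid G"
  shows "is_groupoid G" "charted (objects G)" "charted (arrows G)"
    "submersion (arrows G) (objects G) (src G)" "smooth_map (arrows G) (arrows G) (ginv G)"
  using assms by (simp_all add: lie_groupoid_def manifold_charted)

text \<open>The target map is the source map after inversion, and inversion is a diffeomorphism.\<close>

lemma tgt_submersive_at:
  assumes G: "lie_groupoid G" and g: "g \<in> arr G"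
  shows "submersive_at (arrows G) (objects G) (tgt G) g"
proof (rule submersive_at_compose_diffeo)
  note L = lie_groupoidD[OF G] and D = groupoidD[OF lie_groupoidD(1)[OF G]]
  show "charted (arrows G)" "smooth_map (arrows G) (arrows G) (ginv G)"
    "smooth_map (arrows G) (arrows G) (ginv G)" "charted (arrows G)"
    using L by simp_all
  show "submersive_at (arrows G) (objects G) (src G) (ginv G g)"
    using submersion_normal_form[OF L(3,2,4)] D(4) g by blast
  show "ginv G (ginv G x) = x" "ginv G (ginv G x) = x" if "x \<in> arr G" for x
    using ginv_ginv[OF L(1) that] by simp_all
  show "tgt G x = src G (ginv G x)" if "x \<in> arr G" for x
    using D(5)[OF that] by simp
qed (rule g)

lemma act_dom_embedded:
  assumes G: "lie_groupoid G" and P: "charted P" and \<epsilon>: "smooth_map P (objects G) \<epsilon>"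
  shows "embedded (prod_mfd P (arrows G)) (act_dom G P \<epsilon>)"
  unfolding act_dom_def
  using fibre_product_embedded[OF P lie_groupoidD(3,2)[OF G] \<epsilon> tgt_submersive_at[OF G]] .

lemma fib_prod_embedded:
  assumes P: "charted P" and Q: "charted Q" and M: "charted M"
    and \<pi>: "smooth_map P M \<pi>" and \<rho>: "submersion Q M \<rho>"
  shows "embedded (prod_mfd P Q) (fib_prod P \<pi> Q \<rho>)"
  unfolding fib_prod_def
  using fibre_product_embedded[OF P Q M \<pi> submersion_normal_form[OF Q M \<rho>]] .

lemma principal_bundleD:
  assumes "principal_bundle G M P"
  shows "charted (total P)" "charted M" "smooth_map (total P) (objects G) (moment P)"
    "smooth_map (act_mfd G (total P) (moment P)) (total P) (\<lambda>(p, g). act P p g)"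
    "\<And>p g. (p, g) \<in> act_dom G (total P) (moment P) \<Longrightarrow> moment P (act P p g) = src G g"
    "\<And>p g h. (p, g) \<in> act_dom G (total P) (moment P) \<Longrightarrow> h \<in> arr G \<Longrightarrow> src G g = tgt G h \<Longrightarrow>
      act P (act P p g) h = act P p (mult G g h)"
    "\<And>p. p \<in> pts (total P) \<Longrightarrow> act P p (ident G (moment P p)) = p"
    "submersion (total P) M (bproj P)" "bproj P ` pts (total P) = pts M"
    "\<And>p g. (p, g) \<in> act_dom G (total P) (moment P) \<Longrightarrow> bproj P (act P p g) = bproj P p"
    "diffeomorphism (act_mfd G (total P) (moment P))
       (fib_prod_mfd (total P) (bproj P) (total P) (bproj P)) (\<lambda>(p, g). (p, act P p g))"
  using assms unfolding principal_bundle_def right_action_def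
  by (auto simp: manifold_charted)

lemma
  assumes G: "lie_groupoid G" and P: "principal_bundle G M P"
  shows charted_act_mfd: "charted (act_mfd G (total P) (moment P))"
    and pts_act_mfd: "pts (act_mfd G (total P) (moment P)) = act_dom G (total P) (moment P)"
proof -
  note D = principal_bundleD[OF P]
  note E = act_dom_embedded[OF G D(1,3)]
  show "charted (act_mfd G (total P) (moment P))"
    unfolding act_mfd_def
    using charted_submfd[OF charted_prod[OF D(1) lie_groupoidD(3)[OF G]] E] .
  show "pts (act_mfd G (total P) (moment P)) = act_dom G (total P) (moment P)"
    unfolding act_mfd_def by (rule pts_submfd[OF E])
qed

lemma
  assumes P: "principal_bundle G M P" and Q: "principal_bundle G M Q"
  shows charted_fib_prod: "charted (fib_prod_mfd (total P) (bproj P) (total Q) (bproj Q))"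
    and pts_fib_prod: "pts (fib_prod_mfd (total P) (bproj P) (total Q) (bproj Q)) =
      fib_prod (total P) (bproj P) (total Q) (bproj Q)"
    and emb_fib_prod: "embedded (prod_mfd (total P) (total Q)) (fib_prod (total P) (bproj P) (total Q) (bproj Q))"
proof -
  note D = principal_bundleD[OF P] and D' = principal_bundleD[OF Q]
  have "smooth_map (total P) M (bproj P)"
    using D(8) by (simp add: submersion_def)
  note E = fib_prod_embedded[OF D(1) D'(1) D(2) this D'(8)]
  show "charted (fib_prod_mfd (total P) (bproj P) (total Q) (bproj Q))"
    unfolding fib_prod_mfd_def
    using charted_submfd[OF charted_prod[OF D(1) D'(1)] E] .
  show "pts (fib_prod_mfd (total P) (bproj P) (total Q) (bproj Q)) =
      fib_prod (total P) (bproj P) (total Q) (bproj Q)"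
    unfolding fib_prod_mfd_def by (rule pts_submfd[OF E])
  show "embedded (prod_mfd (total P) (total Q)) (fib_prod (total P) (bproj P) (total Q) (bproj Q))"
    by (rule E)
qed

lemma act_in_total:
  assumes "lie_groupoid G" and P: "principal_bundle G M P"
    and "(p, g) \<in> act_dom G (total P) (moment P)"
  shows "act P p g \<in> pts (total P)"
  using smooth_mapD(2)[OF principal_bundleD(4)[OF P], of "(p, g)"] pts_act_mfd[OF assms(1,2)] assms(3)
  by simp

text \<open>The action is smooth on the embedded submanifold \<open>act_mfd\<close> only, so a pair of smooth maps has to be
  seen to be smooth as a map into it before the action can be applied.\<close>

lemma smooth_at_act:
  assumes G: "lie_groupoid G" and P: "principal_bundle G M P" and L: "charted L"
    and f: "smooth_at L (total P) f x" and k: "smooth_at L (arrows G) k x"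
    and B: "openin (mtop L) B" "x \<in> B" "\<And>y. y \<in> B \<Longrightarrow> (f y, k y) \<in> act_dom G (total P) (moment P)"
  shows "smooth_at L (total P) (\<lambda>y. act P (f y) (k y)) x"
proof -
  note D = principal_bundleD[OF P] and A = lie_groupoidD(3)[OF G]
  have "smooth_at L (prod_mfd (total P) (arrows G)) (\<lambda>y. (f y, k y)) x"
    using smooth_at_Pair[OF L D(1) A f k] .
  then have fk: "smooth_at L (act_mfd G (total P) (moment P)) (\<lambda>y. (f y, k y)) x"
    unfolding act_mfd_def
    by (rule smooth_at_into_submfd[OF L charted_prod[OF D(1) A] act_dom_embedded[OF G D(1,3)] _ B(1,2)])
      (use B(3) in auto)
  have "smooth_at (act_mfd G (total P) (moment P)) (total P) (\<lambda>(p, g). act P p g) (f x, k x)"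
    using smooth_mapD(1)[OF D(4)] pts_act_mfd[OF G P] B(2,3) by blast
  from smooth_at_comp[OF L charted_act_mfd[OF G P] fk this] show ?thesis
    by simp
qed

lemma smooth_at_ident:
  assumes M: "charted M" and x: "x \<in> pts M"
  shows "smooth_at M M (\<lambda>x. x) x"
proof -
  obtain c where c: "c \<in> charts M" "x \<in> chart_dom c"
    using chart_at[OF M x] by metis
  have "smooth_in_charts c c (chart_dom c) (\<lambda>x. x)"
    using smooth_in_charts_transition[OF M c(1) c(1)] by simp
  then show ?thesis
    unfolding smooth_at_def using c chart_onD(1)[OF charts_chart_on[OF c(1)]] by blast
qed

text \<open>The arrow \<open>g\<close> with \<open>act P q g = q'\<close>, for \<open>q\<close> and \<open>q'\<close> in the same fibre. It is read off from the inverse of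
  the diffeomorphism \<open>(p, g) \<mapsto> (p, pg)\<close>, hence depends smoothly on the two points.\<close>

definition division ::
  "('g, 'eg::euclidean_space, 'x, 'ex) groupoid \<Rightarrow> ('p, 'ep::euclidean_space, 'm, 'x, 'g) pbundle \<Rightarrow> 'p \<Rightarrow> 'p \<Rightarrow> 'g" where
  "division G P q q' =
     snd (inv_into (act_dom G (total P) (moment P)) (\<lambda>(p, g). (p, act P p g)) (q, q'))"

lemma division_solves:
  assumes G: "lie_groupoid G" and P: "principal_bundle G M P"
    and q: "q \<in> pts (total P)" "q' \<in> pts (total P)" "bproj P q = bproj P q'"
  shows "(q, division G P q q') \<in> act_dom G (total P) (moment P)" "act P q (division G P q q') = q'"
proof -
  let ?A = "act_dom G (total P) (moment P)" and ?f = "\<lambda>(p, g). (p, act P p g)"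
  have "bij_betw ?f ?A (fib_prod (total P) (bproj P) (total P) (bproj P))"
    using principal_bundleD(11)[OF P] pts_act_mfd[OF G P] pts_fib_prod[OF P P]
    by (simp add: diffeomorphism_def)
  moreover have "(q, q') \<in> fib_prod (total P) (bproj P) (total P) (bproj P)"
    using q by (simp add: fib_prod_def)
  ultimately have im: "(q, q') \<in> ?f ` ?A"
    by (simp add: bij_betw_def)
  obtain p g where pg: "inv_into ?A ?f (q, q') = (p, g)"
    by fastforce
  have "(p, g) \<in> ?A" "p = q" "act P p g = q'"
    using inv_into_into[OF im] f_inv_into_f[OF im] pg by auto
  then show "(q, division G P q q') \<in> ?A" "act P q (division G P q q') = q'"
    unfolding division_def pg by auto
qed

lemma division_act:
  assumes G: "lie_groupoid G" and P: "principal_bundle G M P"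
    and q: "(q, g) \<in> act_dom G (total P) (moment P)"
  shows "division G P q (act P q g) = g"
proof -
  let ?A = "act_dom G (total P) (moment P)" and ?f = "\<lambda>(p, g). (p, act P p g)"
  have "inj_on ?f ?A"
    using principal_bundleD(11)[OF P] pts_act_mfd[OF G P]
    by (simp add: diffeomorphism_def bij_betw_def)
  from inv_into_f_f[OF this q] show ?thesis
    by (simp add: division_def)
qed

lemma smooth_at_division:
  assumes G: "lie_groupoid G" and P: "principal_bundle G M P" and L: "charted L"
    and f: "smooth_at L (total P) f x" and k: "smooth_at L (total P) k x"
    and B: "openin (mtop L) B" "x \<in> B"
      "\<And>y. y \<in> B \<Longrightarrow> (f y, k y) \<in> fib_prod (total P) (bproj P) (total P) (bproj P)"
  shows "smooth_at L (arrows G) (\<lambda>y. division G P (f y) (k y)) x"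
proof -
  note D = principal_bundleD[OF P] and A = lie_groupoidD(3)[OF G]
  let ?F = "fib_prod_mfd (total P) (bproj P) (total P) (bproj P)"
  let ?A = "act_mfd G (total P) (moment P)" and ?D = "act_dom G (total P) (moment P)"
  let ?i = "inv_into ?D (\<lambda>(p, g). (p, act P p g))"
  have "smooth_at L (prod_mfd (total P) (total P)) (\<lambda>y. (f y, k y)) x"
    using smooth_at_Pair[OF L D(1) D(1) f k] .
  then have fk: "smooth_at L ?F (\<lambda>y. (f y, k y)) x"
    unfolding fib_prod_mfd_def
    by (rule smooth_at_into_submfd[OF L charted_prod[OF D(1) D(1)] emb_fib_prod[OF P P] _ B(1,2)])
      (use B(3) in auto)
  have i: "smooth_map ?F ?A ?i"
    using D(11) pts_act_mfd[OF G P] by (simp add: diffeomorphism_def)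
  have fx: "(f x, k x) \<in> pts ?F"
    using B(2,3) pts_fib_prod[OF P P] by blast
  have i1: "smooth_at ?F ?A ?i (f x, k x)"
    using smooth_mapD(1)[OF i fx] .
  have iD: "?i (f x, k x) \<in> ?D"
    using smooth_mapD(2)[OF i fx] pts_act_mfd[OF G P] by blast
  have 1: "smooth_at L ?A (\<lambda>y. ?i (f y, k y)) x"
    using smooth_at_comp[OF L charted_fib_prod[OF P P] fk i1] .
  have "smooth_at ?A (prod_mfd (total P) (arrows G)) (\<lambda>z. z) (?i (f x, k x))"
    unfolding act_mfd_def
    using smooth_at_inclusion[OF charted_prod[OF D(1) A] act_dom_embedded[OF G D(1,3)] iD] .
  from smooth_at_comp[OF L charted_act_mfd[OF G P] 1 this]
  have 2: "smooth_at L (prod_mfd (total P) (arrows G)) (\<lambda>y. ?i (f y, k y)) x" .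
  have "?i (f x, k x) \<in> pts (total P) \<times> arr G"
    using iD by (auto simp: act_dom_def)
  from smooth_at_comp[OF L charted_prod[OF D(1) A] 2 smooth_at_fst_snd(2)[OF D(1) A this]]
  show ?thesis
    by (simp add: division_def)
qed

section \<open>Morphisms and gauge transformations\<close>

lemma bundle_morphismD:
  assumes "\<sigma> \<in> bundle_morphisms G P Q"
  shows "\<sigma> \<in> extensional (pts (total P))" "smooth_map (total P) (total Q) \<sigma>"
    "\<And>p. p \<in> pts (total P) \<Longrightarrow> \<sigma> p \<in> pts (total Q)"
    "\<And>p. p \<in> pts (total P) \<Longrightarrow> bproj Q (\<sigma> p) = bproj P p"
    "\<And>p. p \<in> pts (total P) \<Longrightarrow> moment Q (\<sigma> p) = moment P p"
    "\<And>p g. (p, g) \<in> act_dom G (total P) (moment P) \<Longrightarrow> \<sigma> (act P p g) = act Q (\<sigma> p) g"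
proof -
  show sm: "smooth_map (total P) (total Q) \<sigma>"
    using assms by (simp add: bundle_morphisms_def)
  show "\<And>p. p \<in> pts (total P) \<Longrightarrow> \<sigma> p \<in> pts (total Q)"
    using smooth_mapD(2)[OF sm] .
qed (use assms in \<open>auto simp: bundle_morphisms_def\<close>)

lemma gauge_transformationD:
  assumes "K \<in> gauge_transformations G P Q"
  defines "F \<equiv> fib_prod (total P) (bproj P) (total Q) (bproj Q)"
  shows "K \<in> extensional F"
    "smooth_map (fib_prod_mfd (total P) (bproj P) (total Q) (bproj Q)) (arrows G) K"
    "\<And>p q. (p, q) \<in> F \<Longrightarrow> src G (K (p, q)) = moment P p"
    "\<And>p q. (p, q) \<in> F \<Longrightarrow> tgt G (K (p, q)) = moment Q q"
    "\<And>p q g h. (p, q) \<in> F \<Longrightarrow> g \<in> arr G \<Longrightarrow> h \<in> arr G \<Longrightarrow> tgt G g = moment P p \<Longrightarrow>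
      tgt G h = moment Q q \<Longrightarrow>
      K (act P p g, act Q q h) = mult G (mult G (ginv G h) (K (p, q))) g"
  using assms unfolding gauge_transformations_def F_def by blast+

lemma gauge_in_arr:
  assumes P: "principal_bundle G M P" and Q: "principal_bundle G M Q"
    and K: "K \<in> gauge_transformations G P Q"
    and pq: "(p, q) \<in> fib_prod (total P) (bproj P) (total Q) (bproj Q)"
  shows "K (p, q) \<in> arr G" "(q, K (p, q)) \<in> act_dom G (total Q) (moment Q)"
proof -
  show "K (p, q) \<in> arr G"
    using smooth_mapD(2)[OF gauge_transformationD(2)[OF K]] pts_fib_prod[OF P Q] pq by blast
  then show "(q, K (p, q)) \<in> act_dom G (total Q) (moment Q)"
    using gauge_transformationD(4)[OF K pq] pq by (simp add: act_dom_def fib_prod_def)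
qed

definition gauge_of_morphism ::
  "('g, 'eg::euclidean_space, 'x, 'ex) groupoid \<Rightarrow> ('p, 'ep::euclidean_space, 'm, 'x, 'g) pbundle \<Rightarrow>
   ('q, 'eq::euclidean_space, 'm, 'x, 'g) pbundle \<Rightarrow> ('p \<Rightarrow> 'q) \<Rightarrow> 'p \<times> 'q \<Rightarrow> 'g" where
  "gauge_of_morphism G P Q \<sigma> =
     (\<lambda>(p, q)\<in>fib_prod (total P) (bproj P) (total Q) (bproj Q). division G Q q (\<sigma> p))"

text \<open>The choice of \<open>q\<close> in the fibre is immaterial, by the lemma \<open>gauge_act_independent\<close> below.\<close>

definition morphism_of_gauge ::
  "('p, 'ep, 'm, 'x, 'g) pbundle \<Rightarrow> ('q, 'eq, 'm, 'x, 'g) pbundle \<Rightarrow> ('p \<times> 'q \<Rightarrow> 'g) \<Rightarrow> 'p \<Rightarrow> 'q" where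
  "morphism_of_gauge P Q K =
     (\<lambda>p\<in>pts (total P). let q = SOME q. q \<in> pts (total Q) \<and> bproj Q q = bproj P p in act Q q (K (p, q)))"

text \<open>Smoothness holds because division is smooth. For equivariance, write \<open>k\<close> for the arrow with
  \<open>q k = \<sigma> p\<close>; the arrow \<open>k' = h\<^sup>-\<^sup>1 k g\<close> satisfies \<open>(q h) k' = (q k) g = (\<sigma> p) g = \<sigma> (p g)\<close>, and the action is
  free.\<close>

lemma gauge_of_morphism_in_gauge_transformations:
  assumes G: "lie_groupoid G" and P: "principal_bundle G M P" and Q: "principal_bundle G M Q"
    and \<sigma>: "\<sigma> \<in> bundle_morphisms G P Q"
  shows "gauge_of_morphism G P Q \<sigma> \<in> gauge_transformations G P Q"
proof -
  note D = principal_bundleD[OF P] and D' = principal_bundleD[OF Q]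
  note GD = groupoidD[OF lie_groupoidD(1)[OF G]]
  note S = bundle_morphismD[OF \<sigma>]
  let ?F = "fib_prod (total P) (bproj P) (total Q) (bproj Q)"
  let ?FM = "fib_prod_mfd (total P) (bproj P) (total Q) (bproj Q)"
  let ?K = "gauge_of_morphism G P Q \<sigma>"
  have K: "?K (p, q) = division G Q q (\<sigma> p)" if "(p, q) \<in> ?F" for p q
    using that by (simp add: gauge_of_morphism_def)
  have Kdiv: "(q, ?K (p, q)) \<in> act_dom G (total Q) (moment Q)" "act Q q (?K (p, q)) = \<sigma> p"
    if "(p, q) \<in> ?F" for p q
    using division_solves[OF G Q, of q "\<sigma> p"] that S(3,4)[of p] K[OF that] by (auto simp: fib_prod_def)
  have sm: "smooth_at ?FM (arrows G) ?K z" if z: "z \<in> ?F" for z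
  proof -
    have zz: "z \<in> pts (total P) \<times> pts (total Q)"
      using z by (auto simp: fib_prod_def)
    have op: "openin (mtop ?FM) ?F"
      using openin_topspace[of "mtop ?FM"] by (simp only: pts_fib_prod[OF P Q])
    have inc: "smooth_at ?FM (prod_mfd (total P) (total Q)) (\<lambda>z. z) z"
      unfolding fib_prod_mfd_def
      using smooth_at_inclusion[OF charted_prod[OF D(1) D'(1)] emb_fib_prod[OF P Q] z] .
    have 1: "smooth_at ?FM (total P) (\<lambda>z. fst z) z"
      using smooth_at_comp[OF charted_fib_prod[OF P Q] charted_prod[OF D(1) D'(1)] inc
          smooth_at_fst_snd(1)[OF D(1) D'(1) zz]] .
    have 2: "smooth_at ?FM (total Q) (\<lambda>z. snd z) z"
      using smooth_at_comp[OF charted_fib_prod[OF P Q] charted_prod[OF D(1) D'(1)] inc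
          smooth_at_fst_snd(2)[OF D(1) D'(1) zz]] .
    have "smooth_at (total P) (total Q) \<sigma> (fst z)"
      using zz by (intro smooth_mapD(1)[OF S(2)]) auto
    from smooth_at_comp[OF charted_fib_prod[OF P Q] D(1) 1 this]
    have 3: "smooth_at ?FM (total Q) (\<lambda>z. \<sigma> (fst z)) z" .
    have "smooth_at ?FM (arrows G) (\<lambda>z. division G Q (snd z) (\<sigma> (fst z))) z"
    proof (rule smooth_at_division[OF G Q charted_fib_prod[OF P Q] 2 3 op z])
      show "(snd y, \<sigma> (fst y)) \<in> fib_prod (total Q) (bproj Q) (total Q) (bproj Q)" if "y \<in> ?F" for y
        using that S(3,4)[of "fst y"] by (auto simp: fib_prod_def)
    qed
    then show ?thesis
      by (rule smooth_at_cong[OF _ op z]) (auto simp: K split: prod.split)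
  qed
  have arr: "?K z \<in> arr G" if "z \<in> ?F" for z
    using that Kdiv(1)[of "fst z" "snd z"] by (simp add: act_dom_def)
  have equi: "?K (act P p g, act Q q h) = mult G (mult G (ginv G h) (?K (p, q))) g"
    if pq: "(p, q) \<in> ?F" and g: "g \<in> arr G" "tgt G g = moment P p" and h: "h \<in> arr G" "tgt G h = moment Q q"
    for p q g h
  proof -
    let ?k = "?K (p, q)" and ?k' = "mult G (mult G (ginv G h) (?K (p, q))) g"
    have k: "?k \<in> arr G" "tgt G ?k = moment Q q" "act Q q ?k = \<sigma> p"
      using Kdiv[OF pq] by (simp_all add: act_dom_def)
    have pg: "(p, g) \<in> act_dom G (total P) (moment P)" and qh: "(q, h) \<in> act_dom G (total Q) (moment Q)"
      using pq g h by (auto simp: act_dom_def fib_prod_def)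
    have pQ: "p \<in> pts (total P)" "q \<in> pts (total Q)"
      using pq by (auto simp: fib_prod_def)
    have sk: "src G ?k = moment P p"
      using D'(5)[OF Kdiv(1)[OF pq]] k(3) S(5)[OF pQ(1)] by simp
    have F': "(act P p g, act Q q h) \<in> ?F"
      using act_in_total[OF G P pg] act_in_total[OF G Q qh] D(10)[OF pg] D'(10)[OF qh] pq
      by (simp add: fib_prod_def)
    have hk: "mult G (ginv G h) ?k \<in> arr G" "src G (mult G (ginv G h) ?k) = src G ?k"
      "tgt G (mult G (ginv G h) ?k) = src G h"
      using GD k h by simp_all
    have k': "?k' \<in> arr G" "tgt G ?k' = src G h"
      using GD hk g sk by simp_all
    have qh': "(act Q q h, ?k') \<in> act_dom G (total Q) (moment Q)"
      using act_in_total[OF G Q qh] k' D'(5)[OF qh] by (simp add: act_dom_def)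
    have "act Q (act Q q h) ?k' = act Q q (mult G h ?k')"
      using D'(6)[OF qh k'(1)] k'(2) by simp
    also have "mult G h ?k' = mult G (mult G h (mult G (ginv G h) ?k)) g"
      using GD(10)[OF h(1) hk(1) g(1)] hk g sk by simp
    also have "mult G h (mult G (ginv G h) ?k) = ?k"
      using mult_left_cancel[OF lie_groupoidD(1)[OF G] h(1) k(1)] h k by simp
    also have "act Q q (mult G ?k g) = act Q (act Q q ?k) g"
      using D'(6)[OF Kdiv(1)[OF pq] g(1)] sk g by simp
    also have "\<dots> = \<sigma> (act P p g)"
      using k(3) S(6)[OF pg] by simp
    finally have "\<sigma> (act P p g) = act Q (act Q q h) ?k'" ..
    then show ?thesis
      using K[OF F'] division_act[OF G Q qh'] by simp
  qed
  have "src G (?K (p, q)) = moment P p" "tgt G (?K (p, q)) = moment Q q" if pq: "(p, q) \<in> ?F" for p q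
  proof -
    have "p \<in> pts (total P)"
      using pq by (simp add: fib_prod_def)
    then show "src G (?K (p, q)) = moment P p"
      using D'(5)[OF Kdiv(1)[OF pq]] Kdiv(2)[OF pq] S(5) by simp
    show "tgt G (?K (p, q)) = moment Q q"
      using Kdiv(1)[OF pq] by (simp add: act_dom_def)
  qed
  moreover have "smooth_map ?FM (arrows G) ?K"
    unfolding smooth_map_iff pts_fib_prod[OF P Q] using sm arr by blast
  moreover have "?K \<in> extensional ?F"
    by (simp add: gauge_of_morphism_def)
  ultimately show ?thesis
    unfolding gauge_transformations_def using equi by blast
qed

text \<open>If \<open>q' = q h\<close>, then \<open>q' K(p, q') = (q h) (h\<^sup>-\<^sup>1 K(p, q)) = q K(p, q)\<close>.\<close>

lemma gauge_act_independent:
  assumes G: "lie_groupoid G" and P: "principal_bundle G M P" and Q: "principal_bundle G M Q"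
    and K: "K \<in> gauge_transformations G P Q"
    and pq: "(p, q) \<in> fib_prod (total P) (bproj P) (total Q) (bproj Q)"
    and pq': "(p, q') \<in> fib_prod (total P) (bproj P) (total Q) (bproj Q)"
  shows "act Q q (K (p, q)) = act Q q' (K (p, q'))"
proof -
  note D = principal_bundleD[OF P] and D' = principal_bundleD[OF Q]
  note GD = groupoidD[OF lie_groupoidD(1)[OF G]]
  let ?h = "division G Q q q'" and ?k = "K (p, q)" and ?e = "ident G (moment P p)"
  have q: "q \<in> pts (total Q)" "q' \<in> pts (total Q)" "bproj Q q = bproj Q q'" and p: "p \<in> pts (total P)"
    using pq pq' by (auto simp: fib_prod_def)
  note h = division_solves[OF G Q q]
  then have ha: "?h \<in> arr G" "tgt G ?h = moment Q q"
    by (simp_all add: act_dom_def)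
  note k = gauge_in_arr[OF P Q K pq] and Kst = gauge_transformationD(3,4)[OF K pq]
  have obj: "moment P p \<in> obj G"
    using smooth_mapD(2)[OF D(3) p] .
  have hk: "mult G (ginv G ?h) ?k \<in> arr G" "src G (mult G (ginv G ?h) ?k) = moment P p"
    "tgt G (mult G (ginv G ?h) ?k) = src G ?h"
    using GD ha k Kst by simp_all
  have "K (act P p ?e, act Q q ?h) = mult G (mult G (ginv G ?h) ?k) ?e"
    using gauge_transformationD(5)[OF K pq _ ha(1) _ ha(2)] GD(1,3) obj by simp
  then have "K (p, q') = mult G (mult G (ginv G ?h) ?k) ?e"
    using D(7)[OF p] h(2) by simp
  also have "\<dots> = mult G (ginv G ?h) ?k"
    using GD(11)[OF hk(1)] hk(2) by simp
  finally have "act Q q' (K (p, q')) = act Q (act Q q ?h) (mult G (ginv G ?h) ?k)"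
    using h(2) by simp
  also have "\<dots> = act Q q (mult G ?h (mult G (ginv G ?h) ?k))"
    using D'(6)[OF h(1) hk(1)] hk(3) by simp
  also have "\<dots> = act Q q ?k"
    using mult_left_cancel[OF lie_groupoidD(1)[OF G] ha(1) k(1)] ha(2) Kst(2) by simp
  finally show ?thesis ..
qed

lemma fibre_point:
  assumes P: "principal_bundle G M P" and Q: "principal_bundle G M Q" and p: "p \<in> pts (total P)"
  obtains q where "(p, q) \<in> fib_prod (total P) (bproj P) (total Q) (bproj Q)"
proof -
  have "bproj P p \<in> pts M"
    using principal_bundleD(9)[OF P] p by blast
  then obtain q where "q \<in> pts (total Q)" "bproj Q q = bproj P p"
    using principal_bundleD(9)[OF Q] by (metis imageE)
  then show ?thesis
    using that[of q] p by (simp add: fib_prod_def)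
qed

lemma morphism_of_gauge_eq:
  assumes G: "lie_groupoid G" and P: "principal_bundle G M P" and Q: "principal_bundle G M Q"
    and K: "K \<in> gauge_transformations G P Q"
    and pq: "(p, q) \<in> fib_prod (total P) (bproj P) (total Q) (bproj Q)"
  shows "morphism_of_gauge P Q K p = act Q q (K (p, q))"
proof -
  let ?q = "SOME q. q \<in> pts (total Q) \<and> bproj Q q = bproj P p"
  have p: "p \<in> pts (total P)"
    using pq by (simp add: fib_prod_def)
  have "?q \<in> pts (total Q) \<and> bproj Q ?q = bproj P p"
    by (rule someI[of _ q]) (use pq in \<open>simp add: fib_prod_def\<close>)
  then have "(p, ?q) \<in> fib_prod (total P) (bproj P) (total Q) (bproj Q)"
    using p by (simp add: fib_prod_def)
  from gauge_act_independent[OF G P Q K this pq] show ?thesis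
    using p by (simp add: morphism_of_gauge_def)
qed

text \<open>A local section \<open>s\<close> of the projection of \<open>Q\<close> makes the choice of \<open>q\<close> smooth: near each point, \<open>p\<close> is sent to
  \<open>s (\<pi> p)\<close> acted on by \<open>K (p, s (\<pi> p))\<close>.\<close>

lemma morphism_of_gauge_in_bundle_morphisms:
  assumes G: "lie_groupoid G" and P: "principal_bundle G M P" and Q: "principal_bundle G M Q"
    and K: "K \<in> gauge_transformations G P Q"
  shows "morphism_of_gauge P Q K \<in> bundle_morphisms G P Q"
proof -
  note D = principal_bundleD[OF P] and D' = principal_bundleD[OF Q]
  note GD = groupoidD[OF lie_groupoidD(1)[OF G]]
  let ?F = "fib_prod (total P) (bproj P) (total Q) (bproj Q)"
  let ?FM = "fib_prod_mfd (total P) (bproj P) (total Q) (bproj Q)"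
  let ?\<sigma> = "morphism_of_gauge P Q K"
  note eq = morphism_of_gauge_eq[OF G P Q K] and arr = gauge_in_arr[OF P Q K]
  note st = gauge_transformationD(3,4)[OF K]
  have \<pi>: "smooth_map (total P) M (bproj P)"
    using D(8) by (simp add: submersion_def)
  have sm: "smooth_at (total P) (total Q) ?\<sigma> p" if p: "p \<in> pts (total P)" for p
  proof -
    obtain q where q: "(p, q) \<in> ?F"
      using fibre_point[OF P Q p] .
    then have "q \<in> pts (total Q)" and pq: "bproj Q q = bproj P p"
      by (auto simp: fib_prod_def)
    from submersion_normal_form[OF D'(1) D(2) D'(8) this(1)]
    obtain A s where A: "openin (mtop M) A" "bproj Q q \<in> A" "\<And>x. x \<in> A \<Longrightarrow> s x \<in> pts (total Q)"
      "\<And>x. x \<in> A \<Longrightarrow> bproj Q (s x) = x" "\<And>x. x \<in> A \<Longrightarrow> smooth_at M (total Q) s x"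
      using local_section[OF D'(1) D(2)] by metis
    let ?B = "{x \<in> pts (total P). bproj P x \<in> A}" and ?s = "\<lambda>x. s (bproj P x)"
    have B: "openin (mtop (total P)) ?B" "p \<in> ?B"
      using smooth_map_preimage[OF \<pi> A(1)] p pq A(2) by auto
    have F: "(x, ?s x) \<in> ?F" if "x \<in> ?B" for x
      using that A(3,4) by (simp add: fib_prod_def)
    have s: "smooth_at (total P) (total Q) ?s p"
      using smooth_at_comp[OF D(1,2) smooth_mapD(1)[OF \<pi> p] A(5)] B(2) by blast
    have id: "smooth_at (total P) (total P) (\<lambda>x. x) p"
      using smooth_at_ident[OF D(1) p] .
    have "smooth_at (total P) (prod_mfd (total P) (total Q)) (\<lambda>x. (x, ?s x)) p"
      using smooth_at_Pair[OF D(1) D(1) D'(1) id s] .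
    then have "smooth_at (total P) ?FM (\<lambda>x. (x, ?s x)) p"
      unfolding fib_prod_mfd_def
      by (rule smooth_at_into_submfd[OF D(1) charted_prod[OF D(1) D'(1)] emb_fib_prod[OF P Q] _ B])
        (use F in auto)
    moreover have "smooth_at ?FM (arrows G) K (p, ?s p)"
      using smooth_mapD(1)[OF gauge_transformationD(2)[OF K]] pts_fib_prod[OF P Q] F[OF B(2)] by blast
    ultimately have Ks: "smooth_at (total P) (arrows G) (\<lambda>x. K (x, ?s x)) p"
      by (rule smooth_at_comp[OF D(1) charted_fib_prod[OF P Q]])
    have "smooth_at (total P) (total Q) (\<lambda>x. act Q (?s x) (K (x, ?s x))) p"
      by (rule smooth_at_act[OF G Q D(1) s Ks B]) (rule arr(2)[OF F])
    then show ?thesis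
      by (rule smooth_at_cong[OF _ B]) (simp add: eq[OF F])
  qed
  have val: "?\<sigma> p \<in> pts (total Q)" "bproj Q (?\<sigma> p) = bproj P p" "moment Q (?\<sigma> p) = moment P p"
    if p: "p \<in> pts (total P)" for p
  proof -
    obtain q where q: "(p, q) \<in> ?F"
      using fibre_point[OF P Q p] .
    show "?\<sigma> p \<in> pts (total Q)" "bproj Q (?\<sigma> p) = bproj P p" "moment Q (?\<sigma> p) = moment P p"
      unfolding eq[OF q]
      using act_in_total[OF G Q arr(2)[OF q]] D'(10)[OF arr(2)[OF q]] D'(5)[OF arr(2)[OF q]] st[OF q] q
      by (simp_all add: fib_prod_def)
  qed
  have equi: "?\<sigma> (act P p g) = act Q (?\<sigma> p) g" if pg: "(p, g) \<in> act_dom G (total P) (moment P)" for p g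
  proof -
    have p: "p \<in> pts (total P)" and g: "g \<in> arr G" "tgt G g = moment P p"
      using pg by (auto simp: act_dom_def)
    obtain q where q: "(p, q) \<in> ?F"
      using fibre_point[OF P Q p] .
    have qQ: "q \<in> pts (total Q)"
      using q by (simp add: fib_prod_def)
    have obj: "moment Q q \<in> obj G"
      using smooth_mapD(2)[OF D'(3) qQ] .
    let ?e = "ident G (moment Q q)" and ?k = "K (p, q)"
    have q': "(act P p g, q) \<in> ?F"
      using act_in_total[OF G P pg] D(10)[OF pg] q by (simp add: fib_prod_def)
    have "K (act P p g, act Q q ?e) = mult G (mult G (ginv G ?e) ?k) g"
      using gauge_transformationD(5)[OF K q g(1) _ g(2)] GD(1,3) obj by simp
    also have "\<dots> = mult G ?k g"
      using ginv_ident[OF lie_groupoidD(1)[OF G] obj] GD(12)[OF arr(1)[OF q]] st(2)[OF q] by simp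
    finally have "K (act P p g, q) = mult G ?k g"
      using D'(7)[OF qQ] by simp
    then have "?\<sigma> (act P p g) = act Q q (mult G ?k g)"
      using eq[OF q'] by simp
    also have "\<dots> = act Q (act Q q ?k) g"
      using D'(6)[OF arr(2)[OF q] g(1)] st(1)[OF q] g(2) by simp
    finally show ?thesis
      using eq[OF q] by simp
  qed
  have "smooth_map (total P) (total Q) ?\<sigma>"
    unfolding smooth_map_iff using sm val(1) by blast
  moreover have "?\<sigma> \<in> extensional (pts (total P))"
    by (simp add: morphism_of_gauge_def)
  ultimately show ?thesis
    unfolding bundle_morphisms_def using val equi by blast
qed

theorem theorem5p6:
  fixes G :: "('g, 'eg::euclidean_space, 'x, 'ex::euclidean_space) groupoid"
    and M :: "('m, 'em::euclidean_space) mfd"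
    and P1 :: "('p, 'ep::euclidean_space, 'm, 'x, 'g) pbundle"
    and P2 :: "('q, 'eq::euclidean_space, 'm, 'x, 'g) pbundle"
  assumes "lie_groupoid G"
    and "manifold M" and "Hausdorff_space (mtop M)"
    and "principal_bundle G M P1" and "principal_bundle G M P2"
  shows "\<exists>\<Phi>. bij_betw \<Phi> (bundle_morphisms G P1 P2) (gauge_transformations G P1 P2)"
proof (intro exI bij_betw_byWitness[where f' = "morphism_of_gauge P1 P2"])
  note G = assms(1) and P = assms(4) and Q = assms(5)
  let ?F = "fib_prod (total P1) (bproj P1) (total P2) (bproj P2)"
  show "gauge_of_morphism G P1 P2 ` bundle_morphisms G P1 P2 \<subseteq> gauge_transformations G P1 P2"
    using gauge_of_morphism_in_gauge_transformations[OF G P Q] by blast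
  show "morphism_of_gauge P1 P2 ` gauge_transformations G P1 P2 \<subseteq> bundle_morphisms G P1 P2"
    using morphism_of_gauge_in_bundle_morphisms[OF G P Q] by blast
  show "\<forall>\<sigma>\<in>bundle_morphisms G P1 P2. morphism_of_gauge P1 P2 (gauge_of_morphism G P1 P2 \<sigma>) = \<sigma>"
  proof
    fix \<sigma> assume \<sigma>: "\<sigma> \<in> bundle_morphisms G P1 P2"
    note S = bundle_morphismD[OF \<sigma>]
    note K = gauge_of_morphism_in_gauge_transformations[OF G P Q \<sigma>]
    show "morphism_of_gauge P1 P2 (gauge_of_morphism G P1 P2 \<sigma>) = \<sigma>"
    proof (rule extensionalityI[OF _ S(1)])
      show "morphism_of_gauge P1 P2 (gauge_of_morphism G P1 P2 \<sigma>) \<in> extensional (pts (total P1))"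
        by (simp add: morphism_of_gauge_def)
      fix p assume p: "p \<in> pts (total P1)"
      obtain q where q: "(p, q) \<in> ?F"
        using fibre_point[OF P Q p] .
      have "act P2 q (division G P2 q (\<sigma> p)) = \<sigma> p"
        using q S(3,4)[OF p] by (intro division_solves(2)[OF G Q]) (auto simp: fib_prod_def)
      then show "morphism_of_gauge P1 P2 (gauge_of_morphism G P1 P2 \<sigma>) p = \<sigma> p"
        using morphism_of_gauge_eq[OF G P Q K q] q by (simp add: gauge_of_morphism_def)
    qed
  qed
  show "\<forall>K\<in>gauge_transformations G P1 P2. gauge_of_morphism G P1 P2 (morphism_of_gauge P1 P2 K) = K"
  proof
    fix K assume K: "K \<in> gauge_transformations G P1 P2"
    show "gauge_of_morphism G P1 P2 (morphism_of_gauge P1 P2 K) = K"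
    proof (rule extensionalityI[OF _ gauge_transformationD(1)[OF K]])
      show "gauge_of_morphism G P1 P2 (morphism_of_gauge P1 P2 K) \<in> extensional ?F"
        by (simp add: gauge_of_morphism_def)
      fix z assume z: "z \<in> ?F"
      obtain p q where pq: "z = (p, q)"
        by fastforce
      then show "gauge_of_morphism G P1 P2 (morphism_of_gauge P1 P2 K) z = K z"
        using morphism_of_gauge_eq[OF G P Q K, of p q] division_act[OF G Q gauge_in_arr(2)[OF P Q K, of p q]] z
        by (simp add: gauge_of_morphism_def)
    qed
  qed
qed

end
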